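(* Let $(T,\mathcal{A},\mu)$ be a complete finite measure space with a decomposition $T=T_{pa}\sqcup T_{na}$ into purely atomic and nonatomic parts, let $\varphi\colon T\times\mathbb{R}^n\times\mathbb{R}^m\to\overline{\mathbb{R}}$ be a normal integrand for which there exists $\nu\in L^1(T,\mathbb{R}_+)$ with $\varphi_t(v,w)\ge-\nu(t)$ for all $t\in T$, $v\in\mathbb{R}^n$, $w\in\mathbb{R}^m$, and let $E_\varphi(x,\mathbf{y}):=\int_T\varphi_t(x,\mathbf{y}(t))\,\mu(dt)$ on $\mathbb{R}^n\times L^1(T,\mathbb{R}^m)$. Let $(\bar x,\bar{\mathbf{y}})\in\operatorname{dom}E_\varphi$ be such that for some $\rho>0$ the function $\varphi_t(v,\cdot)$ is convex whenever $v\in\mathbb{B}_\rho(\bar x)$ and $t\in T_{na}$, and let $(\bar x^*,\bar{\mathbf{y}}^* )\in\widehat\partial E_\varphi(\bar x,\bar{\mathbf{y}})$. Suppose that there exist $\hat\rho>0$ and an integrable function $\hat\nu\colon T\to(0,\infty)$ such that $$\varphi_t(u,w)-\langle\bar{\mathbf{y}}^*(t),w-\bar{\mathbf{y}}(t)\rangle\ge-\hat\nu(t)\quad\text{for all }u\in\mathbb{B}_{\hat\rho}(\bar x),\ w\in\mathbb{R}^m,\ t\in T.$$ Then there exist sequences $\{x_k\}\subset\mathbb{R}^n$, $\{\mathbf{x}_k\}\subset L^\infty(T,\mathbb{R}^n)$, $\{\mathbf{x}_k^*\}\subset L^1(T,\mathbb{R}^n)$, $\{\mathbf{y}_k\}\subset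 L^1(T,\mathbb{R}^m)$, and $\{\mathbf{y}_k^*\}\subset L^\infty(T,\mathbb{R}^m)$ such that: (i) $(\mathbf{x}_k^*(t),\mathbf{y}_k^*(t))\in\widehat\partial\varphi_t(\mathbf{x}_k(t),\mathbf{y}_k(t))$ for a.e. $t\in T$ and all $k\in\mathbb{N}$; (ii) $\|\bar x-x_k\|\to0$, $\|\bar x-\mathbf{x}_k\|_\infty\to0$, $\|\bar{\mathbf{y}}-\mathbf{y}_k\|_1\to0$, and $\|\bar{\mathbf{y}}^*-\mathbf{y}_k^*\|_\infty\to0$ as $k\to\infty$; (iii) $\big\|\int_T\mathbf{x}_k^*(t)\,\mu(dt)-\bar x^*\big\|\to0$ and $\int_T\|\mathbf{x}_k^*(t)\|\cdot\|\mathbf{x}_k(t)-x_k\|\,\mu(dt)\to0$ as $k\to\infty$; (iv) $\int_T\big|\varphi_t(\mathbf{x}_k(t),\mathbf{y}_k(t))-\varphi_t(\bar x,\bar{\mathbf{y}}(t))\big|\,\mu(dt)\to0$ as $k\to\infty$.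
   Context: $\overline{\mathbb{R}}=[-\infty,\infty]$; $\|\cdot\|$ is the Euclidean norm; $\mathbb{B}_r(\bar x)$ is the closed ball of radius $r$. Boldface letters denote measurable functions on $T$; points $x\in\mathbb{R}^n$ are identified with constant functions, so $\|x-\mathbf{x}\|_\infty=\operatorname{ess\,sup}_{t\in T}\|x-\mathbf{x}(t)\|$. The integral of a measurable $\alpha\colon T\to\overline{\mathbb{R}}$ is $\int_T\max\{\alpha,0\}\,d\mu+\int_T\min\{\alpha,0\}\,d\mu$ with $\infty+(-\infty)=\infty$. Normal integrand: $\varphi$ is $\mathcal{A}\otimes\mathcal{B}(\mathbb{R}^{n+m})$-measurable and $\varphi_t:=\varphi(t,\cdot,\cdot)$ is lower semicontinuous for every $t\in T$. $\operatorname{dom}E_\varphi=\{(x,\mathbf{y})\mid E_\varphi(x,\mathbf{y})<\infty\}$. Decomposition of the measure: $T_{pa},T_{na}\in\mathcal{A}$ are disjoint with union $T$, $\mu(\cdot\cap T_{pa})$ is purely atomic with countably many disjoint atoms, and $\mu(\cdot\cap T_{na})$ is nonatomic. Regular subdifferential on $\mathbb{R}^d$: for $\psi\colon\mathbb{R}^d\to\overline{\mathbb{R}}$ and $\bar z$ with $\psi(\bar z)$ finite, $\widehat\partial\psi(\bar z):=\{z^*\in\mathbb{R}^d\mid(z^*,-1)\in\widehat N((\bar z,\psi(\bar z));\operatorname{epi}\psi)\}$, where $\operatorname{epi}\psi=\{(z,\alpha)\mid\alpha\ge\psi(z)\}$ and $\widehat N(\bar u;\Omega):=\{u^*\mid\limsup_{u\to\bar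 u,\,u\in\Omega}\langle u^*,u-\bar u\rangle/\|u-\bar u\|\le0\}$ for $\bar u\in\Omega$; $\widehat\partial\psi(\bar z)=\emptyset$ if $\psi(\bar z)$ is not finite. Regular subdifferential of $E_\varphi$ at $(\bar x,\bar{\mathbf{y}})\in\operatorname{dom}E_\varphi$: $\widehat\partial E_\varphi(\bar x,\bar{\mathbf{y}})$ is the set of all $(\bar x^*,\bar{\mathbf{y}}^* )\in\mathbb{R}^n\times L^\infty(T,\mathbb{R}^m)$ such that $$\liminf_{(x,\mathbf{y})\to(\bar x,\bar{\mathbf{y}})}\frac{E_\varphi(x,\mathbf{y})-E_\varphi(\bar x,\bar{\mathbf{y}})-\langle\bar x^*,x-\bar x\rangle-\int_T\langle\bar{\mathbf{y}}^*(t),\mathbf{y}(t)-\bar{\mathbf{y}}(t)\rangle\mu(dt)}{\|x-\bar x\|+\|\mathbf{y}-\bar{\mathbf{y}}\|_1}\ge0,$$ where the convergence is in $\mathbb{R}^n\times L^1(T,\mathbb{R}^m)$. *)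

theory Defs
  imports "HOL-Analysis.Analysis" "HOL-Probability.Essential_Supremum"
begin

section \<open>Extended real-valued functions\<close>

text \<open>The sum of type \<^typ>\<open>ereal\<close> satisfies \<open>\<infinity> + (-\<infinity>) = \<infinity>\<close>, which is the convention wanted here
  for integrals. The library's Lebesgue integrals do not cover integrands of this type.\<close>

definition ext_integral :: "'t measure \<Rightarrow> ('t \<Rightarrow> ereal) \<Rightarrow> ereal" where
  "ext_integral M f =
     enn2ereal (\<integral>\<^sup>+ t. e2ennreal (max (f t) 0) \<partial>M) + - enn2ereal (\<integral>\<^sup>+ t. e2ennreal (- min (f t) 0) \<partial>M)"

definition lsc :: "('a::topological_space \<Rightarrow> ereal) \<Rightarrow> bool" where
  "lsc f \<longleftrightarrow> (\<forall>z. f z \<le> Liminf (at z) f)"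

text \<open>The constant \<^const>\<open>epigraph\<close> of the library is restricted to real-valued functions.\<close>

definition epi :: "('a \<Rightarrow> ereal) \<Rightarrow> ('a \<times> real) set" where
  "epi f = {(z, \<alpha>). f z \<le> ereal \<alpha>}"

definition convex_ereal :: "('a::real_vector \<Rightarrow> ereal) \<Rightarrow> bool" where
  "convex_ereal f \<longleftrightarrow> convex (epi f)"

definition regular_normal_cone :: "'a::real_inner set \<Rightarrow> 'a \<Rightarrow> 'a set" where
  "regular_normal_cone \<Omega> z =
     {z'. Limsup (at z within \<Omega>) (\<lambda>u. ereal (inner z' (u - z) / norm (u - z))) \<le> 0}"

definition regular_subdiff :: "('a::real_inner \<Rightarrow> ereal) \<Rightarrow> 'a \<Rightarrow> 'a set" where
  "regular_subdiff f z =
     {z'. \<bar>f z\<bar> \<noteq> \<infinity> \<and> (z', -1) \<in> regular_normal_cone (epi f) (z, real_of_ereal (f z))}"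

section \<open>Measures\<close>

definition is_atom :: "'t measure \<Rightarrow> 't set \<Rightarrow> bool" where
  "is_atom M A \<longleftrightarrow> A \<in> sets M \<and> emeasure M A > 0 \<and>
     (\<forall>B\<in>sets M. B \<subseteq> A \<longrightarrow> emeasure M B < emeasure M A \<longrightarrow> emeasure M B = 0)"

definition purely_atomic :: "'t measure \<Rightarrow> bool" where
  "purely_atomic M \<longleftrightarrow> (\<forall>B\<in>sets M. emeasure M B > 0 \<longrightarrow> (\<exists>A. A \<subseteq> B \<and> is_atom M A))"

definition nonatomic :: "'t measure \<Rightarrow> bool" where
  "nonatomic M \<longleftrightarrow> \<not> (\<exists>A. is_atom M A)"

text \<open>The density of the indicator of \<open>S\<close> is the measure \<open>B \<mapsto> \<mu>(B \<inter> S)\<close>. The atoms exhaust the purely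
  atomic part only up to a null set, so that a null purely atomic part (without atoms) is allowed.\<close>

definition atomic_decomposition :: "'t measure \<Rightarrow> 't set \<Rightarrow> 't set \<Rightarrow> bool" where
  "atomic_decomposition M Tpa Tna \<longleftrightarrow>
     Tpa \<in> sets M \<and> Tna \<in> sets M \<and> Tpa \<inter> Tna = {} \<and> Tpa \<union> Tna = space M \<and>
     purely_atomic (density M (indicator Tpa)) \<and>
     (\<exists>\<C>. countable \<C> \<and> disjoint \<C> \<and> (\<forall>A\<in>\<C>. is_atom (density M (indicator Tpa)) A) \<and>
          space M - \<Union>\<C> \<in> null_sets (density M (indicator Tpa))) \<and>
     nonatomic (density M (indicator Tna))"

section \<open>Spaces of integrable and of essentially bounded functions\<close>

text \<open>Elements of \<open>L\<^sup>1\<close> and \<open>L\<^sup>\<infinity>\<close> are represented by functions, not by equivalence classes.\<close>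

definition L1_norm :: "'t measure \<Rightarrow> ('t \<Rightarrow> 'a::euclidean_space) \<Rightarrow> real" where
  "L1_norm M f = (\<integral>t. norm (f t) \<partial>M)"

text \<open>With values in \<^typ>\<open>ennreal\<close>, the essential supremum over a space of measure zero is \<open>0\<close>;
  in \<^typ>\<open>ereal\<close> it would be \<open>-\<infinity>\<close>.\<close>

definition Linf_norm :: "'t measure \<Rightarrow> ('t \<Rightarrow> 'a::euclidean_space) \<Rightarrow> ennreal" where
  "Linf_norm M f = esssup M (\<lambda>t. ennreal (norm (f t)))"

definition Linf :: "'t measure \<Rightarrow> ('t \<Rightarrow> 'a::euclidean_space) set" where
  "Linf M = {f \<in> borel_measurable M. Linf_norm M f < \<infinity>}"

section \<open>Normal integrands and expected integral functionals\<close>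

text \<open>Here and below, \<open>\<real>\<^sup>n \<times> \<real>\<^sup>m\<close> is the product type, whose norm, inner product and Borel sets are
  those of \<open>\<real>\<^bsup>n+m\<^esup>\<close>.\<close>

definition normal_integrand ::
  "'t measure \<Rightarrow> ('t \<Rightarrow> 'x::euclidean_space \<times> 'y::euclidean_space \<Rightarrow> ereal) \<Rightarrow> bool" where
  "normal_integrand M \<phi> \<longleftrightarrow>
     (\<lambda>(t, z). \<phi> t z) \<in> borel_measurable (M \<Otimes>\<^sub>M borel) \<and> (\<forall>t\<in>space M. lsc (\<phi> t))"

definition Efun ::
  "'t measure \<Rightarrow> ('t \<Rightarrow> 'x::euclidean_space \<times> 'y::euclidean_space \<Rightarrow> ereal) \<Rightarrow> 'x \<Rightarrow> ('t \<Rightarrow> 'y) \<Rightarrow> ereal" where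
  "Efun M \<phi> x y = ext_integral M (\<lambda>t. \<phi> t (x, y t))"

definition domE ::
  "'t measure \<Rightarrow> ('t \<Rightarrow> 'x::euclidean_space \<times> 'y::euclidean_space \<Rightarrow> ereal) \<Rightarrow> ('x \<times> ('t \<Rightarrow> 'y)) set" where
  "domE M \<phi> = {(x, y). integrable M y \<and> Efun M \<phi> x y < \<infinity>}"

definition dist_XL1 ::
  "'t measure \<Rightarrow> 'x::euclidean_space \<Rightarrow> ('t \<Rightarrow> 'y::euclidean_space) \<Rightarrow> 'x \<Rightarrow> ('t \<Rightarrow> 'y) \<Rightarrow> real" where
  "dist_XL1 M x0 y0 x y = norm (x - x0) + L1_norm M (\<lambda>t. y t - y0 t)"

text \<open>Punctured neighbourhoods of \<open>(x0, y0)\<close> in \<open>\<real>\<^sup>n \<times> L\<^sup>1\<close>; the pairs equal to \<open>(x0, y0)\<close> almost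
  everywhere are left out because they make the difference quotient below meaningless.\<close>

definition at_XL1 ::
  "'t measure \<Rightarrow> 'x::euclidean_space \<Rightarrow> ('t \<Rightarrow> 'y::euclidean_space) \<Rightarrow> ('x \<times> ('t \<Rightarrow> 'y)) filter" where
  "at_XL1 M x0 y0 = (INF \<epsilon>\<in>{0<..}. principal
     {(x, y). integrable M y \<and> 0 < dist_XL1 M x0 y0 x y \<and> dist_XL1 M x0 y0 x y < \<epsilon>})"

definition regular_subdiff_E ::
  "'t measure \<Rightarrow> ('t \<Rightarrow> 'x::euclidean_space \<times> 'y::euclidean_space \<Rightarrow> ereal) \<Rightarrow>
     'x \<Rightarrow> ('t \<Rightarrow> 'y) \<Rightarrow> ('x \<times> ('t \<Rightarrow> 'y)) set" where
  "regular_subdiff_E M \<phi> x0 y0 = {(x', y'). (x0, y0) \<in> domE M \<phi> \<and> y' \<in> Linf M \<and>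
     0 \<le> Liminf (at_XL1 M x0 y0) (\<lambda>(x, y).
       (Efun M \<phi> x y - Efun M \<phi> x0 y0 - ereal (inner x' (x - x0))
          - ereal (\<integral>t. inner (y' t) (y t - y0 t) \<partial>M))
       / ereal (dist_XL1 M x0 y0 x y))}"

end

theory Submission
  imports Defs
begin

text \<open>Write \<open>xb\<close>, \<open>yb\<close>, \<open>xs\<close>, \<open>ys\<close> for \<open>xbar\<close>, \<open>ybar\<close>, \<open>xbar'\<close>, \<open>ybar'\<close>. Fix a tolerance \<open>e > 0\<close>, let \<open>b t\<close> be the value of \<open>\<phi> t\<close> at the base point \<open>(xb, yb t)\<close> and tilt the integrand:
\<open>\<phi> t (u, w) - \<langle>ys t, w - yb t\<rangle> + e * norm (w - yb t)\<close>. That \<open>(xs, ys)\<close> is a regular subgradient means that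
\<open>(xb, yb)\<close> minimizes the integral of the tilted integrand, less \<open>\<langle>xs, x - xb\<rangle> - e * norm (x - xb)\<close>, among
the pairs near it in \<open>\<real>\<^sup>n \<times> L\<^sup>1\<close>. The parameter \<open>x\<close> is now decoupled from the integrand: it is replaced by a
function \<open>u t\<close> at the price of a penalty \<open>k * q t * (norm (u t - x))\<^sup>2\<close>. For given \<open>x\<close> and \<open>k\<close> the minimization over
\<open>u\<close> and \<open>w\<close> can be done separately for each \<open>t\<close>, and a finite-dimensional minimization over \<open>x\<close> remains. At a
minimizer, the optimality condition in \<open>(u, w)\<close> puts \<open>2 * k * q t * (x - u t)\<close>, together with a vector close to
\<open>ys t\<close>, into the regular subdifferential of \<open>\<phi> t\<close> (\<open>pointwise_subgradient\<close>), and the optimality condition in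
\<open>x\<close> says that the integral of the first vector is close to \<open>xs\<close> (\<open>first_order\<close>). What has to be shown
is that the penalized minimizers are close to the base point.

Minimality passes from \<open>L\<^sup>1\<close> to single points as follows. In \<open>L\<^sup>1\<close> a change of \<open>yb\<close> on a small set is a small change. Hence the points
\<open>t\<close> at which some \<open>w\<close>, however far away, improves on \<open>yb t\<close> form a set \<open>S\<close> whose nonnull subsets have measure at
least some \<open>c > 0\<close> (\<open>exceptional_set\<close>). On such a set, functions that are small in \<open>L\<^sup>1\<close> are uniformly small. So
\<open>w\<close> is restricted to a ball about \<open>yb t\<close> for \<open>t \<in> S\<close>, and this restriction is inactive at the penalized minimizers.

The infimum of the tilted integrand over all \<open>u\<close> near \<open>xb\<close> increases to \<open>b t\<close> as the
neighbourhood shrinks, by lower semicontinuity and because the term \<open>e * norm (w - yb t)\<close> keeps the minimizing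
\<open>w\<close> bounded; so do the integrals (\<open>minorant\<close>). The penalized minimum is not larger than the value at the base
point, up to a small constant. Comparing the two estimates shows in one stroke that \<open>y\<close> is close to \<open>yb\<close> in \<open>L\<^sup>1\<close>,
that the penalty is small and that the values of the integrand are close to \<open>b\<close> in \<open>L\<^sup>1\<close> (\<open>near_optimal\<close>). The minimizing \<open>x\<close> is
close to \<open>xb\<close> by an argument of Dini type (\<open>minimizers_near\<close>). The weight \<open>q\<close> dominates \<open>b\<close> and the
lower bound of the integrand, and this makes \<open>u\<close> close to \<open>xb\<close> uniformly in \<open>t\<close>.

The pointwise minimizers have to be chosen measurably in \<open>t\<close>. This rests on the measurable projection
theorem for complete finite measures (\<open>measurable_projection\<close>), which is proved by Choquet's capacity argument for the
Souslin operation, and on lexicographic minimization in compact sections (\<open>compact_selection\<close>).\<close>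

section \<open>The measurable projection theorem\<close>

text \<open>Continuity into a discrete space, for the product topology on \<open>nat \<Rightarrow> nat\<close>.\<close>

definition locally_constant :: "((nat \<Rightarrow> nat) \<Rightarrow> 'b) \<Rightarrow> bool" where
  "locally_constant f \<longleftrightarrow> (\<forall>\<sigma>. \<exists>N. \<forall>\<tau>. (\<forall>i<N. \<tau> i = \<sigma> i) \<longrightarrow> f \<tau> = f \<sigma>)"

text \<open>A multifunction of this kind is a finite union of rectangles \<open>A \<times> K\<close> with \<open>A\<close> measurable and \<open>K\<close> compact. Encoded as a
simple function whose values are sets, it inherits closure under finite unions and intersections, and the
measurability of its projection, from the calculus of simple functions.\<close>

definition simple_compact :: "'t measure \<Rightarrow> ('t \<Rightarrow> 'z::t2_space set) \<Rightarrow> bool" where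
  "simple_compact M L \<longleftrightarrow> simple_function M L \<and> (\<forall>t\<in>space M. compact (L t))"

text \<open>The result of the Souslin operation on simple compact multifunctions. Usually the \<open>n\<close>-th factor depends on the
first \<open>n\<close> coordinates of \<open>\<sigma>\<close>; here it may depend on a prefix whose length varies with \<open>\<sigma>\<close>, so that closure under countable unions
and intersections is a mere recoding of \<open>\<sigma>\<close>.\<close>

definition souslin :: "'t measure \<Rightarrow> ('t \<Rightarrow> 'z::t2_space set) \<Rightarrow> bool" where
  "souslin M E \<longleftrightarrow> (\<exists>B :: nat \<Rightarrow> (nat \<Rightarrow> nat) \<Rightarrow> 't \<Rightarrow> 'z set. (\<forall>n \<sigma>. simple_compact M (B n \<sigma>)) \<and> (\<forall>n. locally_constant (B n)) \<and>
      (\<forall>t\<in>space M. E t = {z. \<exists>\<sigma>. \<forall>n. z \<in> B n \<sigma> t}))"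

lemma compact_nested_nonempty:
  fixes F :: "nat \<Rightarrow> 'a::topological_space set"
  assumes "compact C" "\<And>n. closed (F n)" "\<And>n. F n \<inter> C \<noteq> {}" "decseq F"
  shows "(\<Inter>n. F n) \<inter> C \<noteq> {}"
proof -
  have "C \<inter> \<Inter>(range F) \<noteq> {}"
  proof (rule compact_imp_fip)
    fix F' assume "finite F'" "F' \<subseteq> range F"
    then obtain I where I: "finite I" "F' = F ` I"
      by (meson finite_subset_image)
    show "C \<inter> \<Inter>F' \<noteq> {}"
    proof (cases "I = {}")
      case True
      then show ?thesis using assms(3)[of 0] I by auto
    next
      case False
      have "F (Max I) \<subseteq> \<Inter>F'"
        using I False \<open>decseq F\<close> by (auto simp: decseq_def dest: Max_ge)
      then show ?thesis using assms(3)[of "Max I"] by blast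
    qed
  qed (use assms in auto)
  then show ?thesis by blast
qed

lemma compact_box_baire: "compact {\<sigma>::nat \<Rightarrow> nat. \<forall>i. \<sigma> i \<le> m i}"
proof -
  have "compactin (product_topology (\<lambda>i::nat. euclidean :: nat topology) UNIV) (PiE UNIV (\<lambda>i. {..m i}))"
    by (auto simp: compactin_PiE finite_imp_compact)
  moreover have "PiE UNIV (\<lambda>i. {..m i}) = {\<sigma>. \<forall>i. \<sigma> i \<le> m i}"
    by (auto simp: PiE_UNIV_domain)
  ultimately show ?thesis
    by (simp add: euclidean_product_topology)
qed

lemma open_cylinder: "open {\<tau>::nat \<Rightarrow> nat. \<forall>i<N. \<tau> i = \<sigma> i}"
proof -
  have eq: "{\<tau>::nat \<Rightarrow> nat. \<forall>i<N. \<tau> i = \<sigma> i} = (\<Inter>i\<in>{..<N}. (\<lambda>\<tau>. \<tau> i) -` {\<sigma> i})" by auto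
  have "open ((\<lambda>\<tau>::nat \<Rightarrow> nat. \<tau> i) -` {\<sigma> i})" for i
    by (intro open_vimage continuous_on_product_coordinates) (simp add: open_discrete)
  then show ?thesis unfolding eq by (intro open_INT) auto
qed

lemma locally_constant_open:
  assumes "locally_constant f" shows "open {\<sigma>. P (f \<sigma>)}"
proof (subst open_subopen, clarify)
  fix \<sigma> assume P: "P (f \<sigma>)"
  obtain N where N: "\<And>\<tau>. \<forall>i<N. \<tau> i = \<sigma> i \<Longrightarrow> f \<tau> = f \<sigma>"
    using assms unfolding locally_constant_def by blast
  have "{\<tau>. \<forall>i<N. \<tau> i = \<sigma> i} \<subseteq> {\<sigma>. P (f \<sigma>)}"
  proof clarify
    fix \<tau> assume "\<forall>i<N. \<tau> i = \<sigma> i"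
    from N[OF this] P show "P (f \<tau>)" by simp
  qed
  then show "\<exists>T. open T \<and> \<sigma> \<in> T \<and> T \<subseteq> {\<sigma>. P (f \<sigma>)}"
    using open_cylinder[of N \<sigma>] by (intro exI[of _ "{\<tau>. \<forall>i<N. \<tau> i = \<sigma> i}"]) simp
qed

lemma locally_constant_closed:
  assumes "locally_constant f" shows "closed {\<sigma>. P (f \<sigma>)}"
  using locally_constant_open[OF assms, of "\<lambda>x. \<not> P x"]
  by (simp add: closed_def Collect_neg_eq)

text \<open>On the compact set of all \<open>\<sigma>\<close> below \<open>m\<close>, finitely many of the cylinders on which \<open>f\<close> is constant suffice, and the longest of
their prefixes serves every \<open>\<sigma>\<close>.\<close>

lemma locally_constant_uniform:
  assumes "locally_constant f"
  shows "\<exists>k. \<forall>\<sigma> \<tau>. (\<forall>i. \<sigma> i \<le> m i) \<longrightarrow> (\<forall>i<k. \<tau> i = \<sigma> i) \<longrightarrow> f \<tau> = f \<sigma>"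
proof -
  obtain N where N: "\<And>\<sigma> \<tau>. \<forall>i<N \<sigma>. \<tau> i = \<sigma> i \<Longrightarrow> f \<tau> = f \<sigma>"
    using assms unfolding locally_constant_def by metis
  define C where "C = {\<sigma>::nat \<Rightarrow> nat. \<forall>i. \<sigma> i \<le> m i}"
  obtain D where D: "D \<subseteq> C" "finite D" "C \<subseteq> (\<Union>\<sigma>\<in>D. {\<tau>. \<forall>i<N \<sigma>. \<tau> i = \<sigma> i})"
    using compactE_image[OF compact_box_baire[of m, folded C_def], of C "\<lambda>\<sigma>. {\<tau>. \<forall>i<N \<sigma>. \<tau> i = \<sigma> i}"]
      open_cylinder by blast
  show ?thesis
  proof (intro exI[of _ "Max (insert 0 (N ` D))"] allI impI)
    fix \<sigma> \<tau> :: "nat \<Rightarrow> nat"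
    assume s: "\<forall>i. \<sigma> i \<le> m i" and t: "\<forall>i<Max (insert 0 (N ` D)). \<tau> i = \<sigma> i"
    have "\<sigma> \<in> (\<Union>\<sigma>\<in>D. {\<tau>. \<forall>i<N \<sigma>. \<tau> i = \<sigma> i})"
      by (rule subsetD[OF D(3)]) (simp add: C_def s)
    then obtain \<rho> where r: "\<rho> \<in> D" "\<forall>i<N \<rho>. \<sigma> i = \<rho> i" by (elim UN_E CollectE)
    have "N \<rho> \<le> Max (insert 0 (N ` D))" using D r by auto
    with t r have "\<forall>i<N \<rho>. \<tau> i = \<rho> i" by auto
    then show "f \<tau> = f \<sigma>" using N r(2) by metis
  qed
qed

lemma locally_constant_map:
  assumes "\<And>j. locally_constant (B j)"
  shows "locally_constant (\<lambda>\<sigma>. map (\<lambda>j. B j \<sigma>) [0..<n])"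
  unfolding locally_constant_def
proof
  fix \<sigma>
  have "\<forall>j. \<exists>N. \<forall>\<tau>. (\<forall>i<N. \<tau> i = \<sigma> i) \<longrightarrow> B j \<tau> = B j \<sigma>"
    using assms by (auto simp: locally_constant_def)
  from choice[OF this] obtain N where N: "\<And>j \<tau>. \<forall>i<N j. \<tau> i = \<sigma> i \<Longrightarrow> B j \<tau> = B j \<sigma>"
    by auto
  show "\<exists>K. \<forall>\<tau>. (\<forall>i<K. \<tau> i = \<sigma> i) \<longrightarrow> map (\<lambda>j. B j \<tau>) [0..<n] = map (\<lambda>j. B j \<sigma>) [0..<n]"
  proof (intro exI allI impI)
    fix \<tau> assume "\<forall>i<Max (insert 0 (N ` {..<n})). \<tau> i = \<sigma> i"
    moreover have "N j \<le> Max (insert 0 (N ` {..<n}))" if "j < n" for j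
      using that by auto
    ultimately have "B j \<tau> = B j \<sigma>" if "j < n" for j
      using N that by (meson order_less_le_trans)
    then show "map (\<lambda>j. B j \<tau>) [0..<n] = map (\<lambda>j. B j \<sigma>) [0..<n]" by auto
  qed
qed

lemma simple_compact_empty: "simple_compact M (\<lambda>t. {})"
  by (simp add: simple_compact_def)

lemma simple_compact_Un:
  "simple_compact M K \<Longrightarrow> simple_compact M L \<Longrightarrow> simple_compact M (\<lambda>t. K t \<union> L t)"
  unfolding simple_compact_def using simple_function_compose2[of M K L "(\<union>)"] by auto

lemma simple_compact_Int:
  "simple_compact M K \<Longrightarrow> simple_compact M L \<Longrightarrow> simple_compact M (\<lambda>t. K t \<inter> L t)"
  unfolding simple_compact_def using simple_function_compose2[of M K L "(\<inter>)"] by (auto intro: compact_Int)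

lemma simple_compact_UN_finite:
  "finite F \<Longrightarrow> (\<And>i. i \<in> F \<Longrightarrow> simple_compact M (K i)) \<Longrightarrow> simple_compact M (\<lambda>t. \<Union>i\<in>F. K i t)"
  by (induction F rule: finite_induct) (simp_all add: simple_compact_empty simple_compact_Un)

lemma simple_compact_INT:
  "(\<And>i. simple_compact M (K i)) \<Longrightarrow> simple_compact M (\<lambda>t. \<Inter>i\<in>{..n::nat}. K i t)"
  by (induction n) (simp_all add: simple_compact_Int atMost_Suc)

lemma simple_compact_cong:
  assumes "simple_compact M K" "\<And>t. t \<in> space M \<Longrightarrow> K t = L t"
  shows "simple_compact M L"
  using assms simple_function_cong[of M K L] by (auto simp: simple_compact_def)

lemma simple_compact_nonempty_sets:
  "simple_compact M L \<Longrightarrow> {t\<in>space M. L t \<noteq> {}} \<in> sets M"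
  using simple_functionD(2)[of M L "- {{}}"]
  by (auto simp: simple_compact_def vimage_def Int_def conj_commute)

lemma souslinE:
  fixes E :: "'t \<Rightarrow> 'z::t2_space set"
  assumes "souslin M E"
  obtains B :: "nat \<Rightarrow> (nat \<Rightarrow> nat) \<Rightarrow> 't \<Rightarrow> 'z set"
    where "\<And>n \<sigma>. simple_compact M (B n \<sigma>)" "\<And>n. locally_constant (B n)"
      "\<And>t. t \<in> space M \<Longrightarrow> E t = {z. \<exists>\<sigma>. \<forall>n. z \<in> B n \<sigma> t}"
proof -
  from assms[unfolded souslin_def] obtain B :: "nat \<Rightarrow> (nat \<Rightarrow> nat) \<Rightarrow> 't \<Rightarrow> 'z set"
    where B: "(\<forall>n \<sigma>. simple_compact M (B n \<sigma>)) \<and> (\<forall>n. locally_constant (B n)) \<and>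
      (\<forall>t\<in>space M. E t = {z. \<exists>\<sigma>. \<forall>n. z \<in> B n \<sigma> t})" by (elim exE)
  show thesis by (rule that[of B]) (use B in simp_all)
qed

text \<open>Choquet's capacity argument. Outer measure is continuous along increasing sequences of arbitrary sets, so that the
coordinates of \<open>\<sigma>\<close> can be bounded one after the other, by \<open>m 0\<close>, \<open>m 1\<close> and so on, while the outer measure of the projection stays
above \<open>a\<close>. Once all coordinates are bounded, only finitely many \<open>\<sigma>\<close> matter for the first \<open>n\<close> factors; these factors yield
a decreasing sequence of simple compact multifunctions. Compactness, of the sections and of the set of bounded \<open>\<sigma>\<close>, puts the
intersection of their projections into the projection of \<open>E\<close>.\<close>

lemma souslin_inner_approx:
  fixes E :: "'t \<Rightarrow> 'z::t2_space set"
  assumes fin: "finite_measure M" and "souslin M E"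
    and a: "a < outer_measure_of M {t\<in>space M. E t \<noteq> {}}"
  shows "\<exists>A\<in>sets M. A \<subseteq> {t\<in>space M. E t \<noteq> {}} \<and> a \<le> emeasure M A"
proof -
  interpret finite_measure M by fact
  from \<open>souslin M E\<close> obtain B :: "nat \<Rightarrow> (nat \<Rightarrow> nat) \<Rightarrow> 't \<Rightarrow> 'z set"
    where B: "\<And>n \<sigma>. simple_compact M (B n \<sigma>)" "\<And>n. locally_constant (B n)"
      "\<And>t. t \<in> space M \<Longrightarrow> E t = {z. \<exists>\<sigma>. \<forall>n. z \<in> B n \<sigma> t}"
    by (rule souslinE) blast
  define P where "P xs = {t\<in>space M. \<exists>\<sigma> z. (\<forall>i<length xs. \<sigma> i \<le> xs ! i) \<and> (\<forall>n. z \<in> B n \<sigma> t)}" for xs :: "nat list"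
  have step: "\<exists>j. a < outer_measure_of M (P (xs @ [j]))" if "a < outer_measure_of M (P xs)" for xs
  proof -
    have "P xs = (\<Union>j. P (xs @ [j]))"
    proof (intro equalityI subsetI)
      fix t assume "t \<in> P xs"
      then obtain \<sigma> z where t: "t \<in> space M" "\<forall>i<length xs. \<sigma> i \<le> xs ! i" "\<forall>n. z \<in> B n \<sigma> t"
        by (auto simp: P_def)
      have "t \<in> P (xs @ [\<sigma> (length xs)])"
        unfolding P_def using t by (auto simp: nth_append less_Suc_eq intro!: exI[of _ \<sigma>] exI[of _ z])
      then show "t \<in> (\<Union>j. P (xs @ [j]))" by blast
    next
      fix t assume "t \<in> (\<Union>j. P (xs @ [j]))"
      then obtain j \<sigma> z where t: "t \<in> space M" "\<forall>i<Suc (length xs). \<sigma> i \<le> (xs @ [j]) ! i" "\<forall>n. z \<in> B n \<sigma> t"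
        by (auto simp: P_def)
      have "\<forall>i<length xs. \<sigma> i \<le> xs ! i" using t(2) by (metis less_Suc_eq nth_append)
      with t show "t \<in> P xs" unfolding P_def by blast
    qed
    moreover have "incseq (\<lambda>j. P (xs @ [j]))"
    proof (rule incseq_SucI, rule subsetI)
      fix j t assume "t \<in> P (xs @ [j])"
      then obtain \<sigma> z where t: "t \<in> space M" "\<forall>i<Suc (length xs). \<sigma> i \<le> (xs @ [j]) ! i" "\<forall>n. z \<in> B n \<sigma> t"
        by (auto simp: P_def)
      have "\<forall>i<Suc (length xs). \<sigma> i \<le> (xs @ [Suc j]) ! i"
        using t(2) by (auto simp: nth_append less_Suc_eq)
      with t show "t \<in> P (xs @ [Suc j])" unfolding P_def by auto
    qed
    ultimately have "outer_measure_of M (P xs) = (SUP j. outer_measure_of M (P (xs @ [j])))"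
      using SUP_outer_measure_of_incseq[of "\<lambda>j. P (xs @ [j])" M] by (auto simp: P_def)
    with that show ?thesis by (auto simp: less_SUP_iff)
  qed
  have "P [] = {t\<in>space M. E t \<noteq> {}}" by (auto simp: P_def B(3); blast)
  with a have "a < outer_measure_of M (P [])" by simp
  then have "\<exists>xs. \<forall>n. (a < outer_measure_of M (P (xs n)) \<and> length (xs n) = n) \<and> (\<exists>j. xs (Suc n) = xs n @ [j])"
    using step by (intro dependent_nat_choice) fastforce+
  then obtain xs where xs: "\<And>n. a < outer_measure_of M (P (xs n))" "\<And>n. length (xs n) = n"
      "\<And>n. \<exists>j. xs (Suc n) = xs n @ [j]" by blast
  define m where "m i = xs (Suc i) ! i" for i
  have m: "xs n ! i = m i" if "i < n" for i n
    using that
  proof (induction n)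
    case (Suc n)
    then show ?case using xs(2)[of n] xs(3)[of n]
      by (cases "i = n") (auto simp: m_def nth_append)
  qed simp
  define L where "L n t = {z. \<exists>\<sigma>. (\<forall>i. \<sigma> i \<le> m i) \<and> (\<forall>j\<le>n. z \<in> B j \<sigma> t)}" for n t
  have L: "simple_compact M (L n) \<and> a \<le> outer_measure_of M {t\<in>space M. L n t \<noteq> {}}" for n
  proof -
    obtain k where k': "\<forall>\<sigma> \<tau>. (\<forall>i. \<sigma> i \<le> m i) \<longrightarrow> (\<forall>i<k. \<tau> i = \<sigma> i) \<longrightarrow>
        map (\<lambda>j. B j \<tau>) [0..<Suc n] = map (\<lambda>j. B j \<sigma>) [0..<Suc n]"
      using locally_constant_uniform[OF locally_constant_map[of B "Suc n", OF B(2)], of m] by (elim exE)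
    have k: "B j \<tau> = B j \<sigma>" if "\<forall>i. \<sigma> i \<le> m i" "\<forall>i<k. \<tau> i = \<sigma> i" "j \<le> n" for j \<sigma> \<tau>
    proof -
      have "map (\<lambda>j. B j \<tau>) [0..<Suc n] = map (\<lambda>j. B j \<sigma>) [0..<Suc n]"
        using k'[rule_format, of \<sigma> \<tau>] that(1,2) by simp
      then show ?thesis using that(3) by (simp del: upt_Suc)
    qed
    \<comment> \<open>Only the first \<open>k\<close> coordinates matter; all later ones are set to \<open>0\<close>, which respects every bound.\<close>
    define tr where "tr \<sigma> = (\<lambda>i. if i < k then \<sigma> i else 0 :: nat)" for \<sigma> :: "nat \<Rightarrow> nat"
    define F where "F = tr ` (PiE {..<k} (\<lambda>i. {..m i}))"
    have finF: "finite F" unfolding F_def by (intro finite_imageI finite_PiE) auto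
    have Fm: "\<forall>i. \<sigma> i \<le> m i" if mem: "\<sigma> \<in> F" for \<sigma>
    proof -
      obtain g where "g \<in> PiE {..<k} (\<lambda>i. {..m i})" "\<sigma> = tr g"
        using mem[unfolded F_def] by (rule imageE)
      then show ?thesis by (simp add: tr_def PiE_iff)
    qed
    have trF: "tr \<sigma> \<in> F" if "\<forall>i<k. \<sigma> i \<le> m i" for \<sigma>
    proof -
      have "tr \<sigma> = tr (restrict \<sigma> {..<k})" by (auto simp: tr_def fun_eq_iff)
      moreover have "restrict \<sigma> {..<k} \<in> PiE {..<k} (\<lambda>i. {..m i})" using that by auto
      ultimately show ?thesis unfolding F_def by blast
    qed
    have eqB: "B j \<sigma> = B j (tr \<sigma>)" if "\<forall>i<k. \<sigma> i \<le> m i" "j \<le> n" for j \<sigma>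
      using k[of "tr \<sigma>" \<sigma> j] Fm[OF trF[OF that(1)]] that(2) by (auto simp: tr_def)
    have "L n t = (\<Union>\<sigma>\<in>F. \<Inter>j\<in>{..n}. B j \<sigma> t)" for t
    proof (intro equalityI subsetI)
      fix z assume "z \<in> L n t"
      then obtain \<sigma> where "\<forall>i. \<sigma> i \<le> m i" "\<forall>j\<le>n. z \<in> B j \<sigma> t" by (auto simp: L_def)
      then show "z \<in> (\<Union>\<sigma>\<in>F. \<Inter>j\<in>{..n}. B j \<sigma> t)" using trF[of \<sigma>] eqB[of \<sigma>] by fastforce
    qed (use Fm in \<open>auto simp: L_def\<close>)
    moreover have "simple_compact M (\<lambda>t. \<Union>\<sigma>\<in>F. \<Inter>j\<in>{..n}. B j \<sigma> t)"
      by (intro simple_compact_UN_finite simple_compact_INT finF B)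
    ultimately have 1: "simple_compact M (L n)" by (simp add: simple_compact_cong)
    have "P (xs k) \<subseteq> {t\<in>space M. L n t \<noteq> {}}"
    proof
      fix t assume "t \<in> P (xs k)"
      then obtain \<sigma> z where t: "t \<in> space M" "\<forall>i<k. \<sigma> i \<le> m i" "\<forall>n. z \<in> B n \<sigma> t"
        by (auto simp: P_def xs(2) m)
      then have "z \<in> L n t"
        using t(3) Fm[OF trF[OF t(2)]] eqB[OF t(2), symmetric] unfolding L_def by (auto intro!: exI[of _ "tr \<sigma>"])
      with t show "t \<in> {t\<in>space M. L n t \<noteq> {}}" by auto
    qed
    then have "a \<le> outer_measure_of M {t\<in>space M. L n t \<noteq> {}}"
      using xs(1)[of k] outer_measure_of_mono by (meson order_less_imp_le order_trans)
    with 1 show ?thesis by blast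
  qed
  define A where "A n = {t\<in>space M. L n t \<noteq> {}}" for n
  have Am: "A n \<in> sets M" for n unfolding A_def using L simple_compact_nonempty_sets by blast
  have Ldec: "decseq (\<lambda>n. L n t)" for t
    by (rule antimonoI) (unfold L_def, blast intro: order_trans)
  have "decseq A" using Ldec by (fastforce simp: decseq_def A_def)
  then have "emeasure M (\<Inter>n. A n) = (INF n. emeasure M (A n))"
    using Am by (intro INF_emeasure_decseq[symmetric]) auto
  moreover have "a \<le> emeasure M (A n)" for n
    using L[of n] Am[of n] by (simp add: A_def)
  ultimately have a2: "a \<le> emeasure M (\<Inter>n. A n)" by (simp add: le_INF_iff)
  have "(\<Inter>n. A n) \<subseteq> {t\<in>space M. E t \<noteq> {}}"
  proof
    fix t assume "t \<in> (\<Inter>n. A n)"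
    then have t: "t \<in> space M" "\<And>n. L n t \<noteq> {}" by (auto simp: A_def)
    have cL: "compact (L n t)" for n using L[of n] t by (auto simp: simple_compact_def)
    have "(\<Inter>n. L n t) \<inter> L 0 t \<noteq> {}"
    proof (rule compact_nested_nonempty[OF cL])
      fix n
      have "L n t \<subseteq> L 0 t" using antimonoD[OF Ldec, of 0 n] by simp
      then show "L n t \<inter> L 0 t \<noteq> {}" using t(2)[of n] by blast
    qed (auto intro: compact_imp_closed cL Ldec)
    then obtain z where z: "\<And>n. z \<in> L n t" by auto
    \<comment> \<open>The point \<open>z\<close> has for each \<open>n\<close> its own sequence below \<open>m\<close>; compactness provides a common one.\<close>
    define S where "S n = {\<sigma>. \<forall>j\<le>n. z \<in> B j \<sigma> t}" for n
    have "(\<Inter>n. S n) \<inter> {\<sigma>. \<forall>i. \<sigma> i \<le> m i} \<noteq> {}"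
    proof (rule compact_nested_nonempty[OF compact_box_baire])
      fix n
      have "S n = (\<Inter>j\<in>{..n}. {\<sigma>. z \<in> B j \<sigma> t})" by (auto simp: S_def)
      then show "closed (S n)"
        using locally_constant_closed[OF B(2), of "\<lambda>K. z \<in> K t"] by auto
      show "S n \<inter> {\<sigma>. \<forall>i. \<sigma> i \<le> m i} \<noteq> {}" using z[of n] by (auto simp: S_def L_def)
    qed (auto simp: S_def decseq_def)
    then obtain \<sigma> where "\<forall>n. z \<in> B n \<sigma> t" by (auto simp: S_def)
    then have "z \<in> E t" using B(3) t(1) by auto
    with t(1) show "t \<in> {t\<in>space M. E t \<noteq> {}}" by auto
  qed
  with a2 Am show ?thesis by (intro bexI[of _ "\<Inter>n. A n"]) auto
qed

lemma souslin_family: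
  fixes E :: "nat \<Rightarrow> 't \<Rightarrow> 'z::t2_space set"
  assumes "\<And>i. souslin M (E i)"
  shows "\<exists>B :: nat \<Rightarrow> nat \<Rightarrow> (nat \<Rightarrow> nat) \<Rightarrow> 't \<Rightarrow> 'z set. \<forall>i. (\<forall>n \<sigma>. simple_compact M (B i n \<sigma>)) \<and>
      (\<forall>n. locally_constant (B i n)) \<and> (\<forall>t\<in>space M. E i t = {z. \<exists>\<sigma>. \<forall>n. z \<in> B i n \<sigma> t})"
  using assms unfolding souslin_def by (intro choice allI)

text \<open>The first coordinate of \<open>\<sigma>\<close> selects a member of the family, the others are its sequence.\<close>

lemma souslin_UN:
  fixes E :: "nat \<Rightarrow> 't \<Rightarrow> 'z::t2_space set"
  assumes "\<And>i. souslin M (E i)"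
  shows "souslin M (\<lambda>t. \<Union>i. E i t)"
proof -
  from souslin_family[of M E, OF assms] obtain B :: "nat \<Rightarrow> nat \<Rightarrow> (nat \<Rightarrow> nat) \<Rightarrow> 't \<Rightarrow> 'z set"
    where B0: "\<forall>i. (\<forall>n \<sigma>. simple_compact M (B i n \<sigma>)) \<and>
      (\<forall>n. locally_constant (B i n)) \<and> (\<forall>t\<in>space M. E i t = {z. \<exists>\<sigma>. \<forall>n. z \<in> B i n \<sigma> t})"
    by (elim exE)
  have B: "simple_compact M (B i n \<sigma>)" "locally_constant (B i n)"
      "t \<in> space M \<Longrightarrow> E i t = {z. \<exists>\<sigma>. \<forall>n. z \<in> B i n \<sigma> t}" for i n \<sigma> t
    using B0 by simp_all
  define B' where "B' n \<sigma> = B (\<sigma> 0) n (\<lambda>j. \<sigma> (Suc j))" for n and \<sigma> :: "nat \<Rightarrow> nat"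
  have "locally_constant (B' n)" for n
    unfolding locally_constant_def
  proof
    fix \<sigma> :: "nat \<Rightarrow> nat"
    obtain N where N: "\<forall>\<tau>. (\<forall>i<N. \<tau> i = \<sigma> (Suc i)) \<longrightarrow> B (\<sigma> 0) n \<tau> = B (\<sigma> 0) n (\<lambda>j. \<sigma> (Suc j))"
      using B(2)[of "\<sigma> 0" n, unfolded locally_constant_def, THEN spec, of "\<lambda>j. \<sigma> (Suc j)"] by (elim exE)
    have "B' n \<tau> = B' n \<sigma>" if "\<forall>i<Suc N. \<tau> i = \<sigma> i" for \<tau>
    proof -
      have "\<tau> 0 = \<sigma> 0" using that by auto
      moreover have "B (\<sigma> 0) n (\<lambda>j. \<tau> (Suc j)) = B (\<sigma> 0) n (\<lambda>j. \<sigma> (Suc j))"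
        by (rule N[rule_format]) (use that in auto)
      ultimately show ?thesis by (simp add: B'_def)
    qed
    then show "\<exists>N. \<forall>\<tau>. (\<forall>i<N. \<tau> i = \<sigma> i) \<longrightarrow> B' n \<tau> = B' n \<sigma>" by blast
  qed
  moreover have "(\<Union>i. E i t) = {z. \<exists>\<sigma>. \<forall>n. z \<in> B' n \<sigma> t}" if ts: "t \<in> space M" for t
  proof (intro equalityI subsetI)
    fix z assume "z \<in> (\<Union>i. E i t)"
    then obtain i \<sigma> where "\<forall>n. z \<in> B i n \<sigma> t" using B(3)[OF ts] by auto
    then have "\<forall>n. z \<in> B' n (case_nat i \<sigma>) t" by (simp add: B'_def)
    then show "z \<in> {z. \<exists>\<sigma>. \<forall>n. z \<in> B' n \<sigma> t}" by blast
  next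
    fix z assume "z \<in> {z. \<exists>\<sigma>. \<forall>n. z \<in> B' n \<sigma> t}"
    then show "z \<in> (\<Union>i. E i t)" using B(3)[OF ts] by (auto simp: B'_def)
  qed
  moreover have "simple_compact M (B' n \<sigma>)" for n \<sigma> by (simp add: B'_def B(1))
  ultimately show ?thesis unfolding souslin_def by blast
qed

text \<open>By means of \<open>prod_encode\<close>, one sequence \<open>\<sigma>\<close> carries a sequence for every member of the family.\<close>

lemma souslin_INT:
  fixes E :: "nat \<Rightarrow> 't \<Rightarrow> 'z::t2_space set"
  assumes "\<And>i. souslin M (E i)"
  shows "souslin M (\<lambda>t. \<Inter>i. E i t)"
proof -
  from souslin_family[of M E, OF assms] obtain B :: "nat \<Rightarrow> nat \<Rightarrow> (nat \<Rightarrow> nat) \<Rightarrow> 't \<Rightarrow> 'z set"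
    where B0: "\<forall>i. (\<forall>n \<sigma>. simple_compact M (B i n \<sigma>)) \<and>
      (\<forall>n. locally_constant (B i n)) \<and> (\<forall>t\<in>space M. E i t = {z. \<exists>\<sigma>. \<forall>n. z \<in> B i n \<sigma> t})"
    by (elim exE)
  have B: "simple_compact M (B i n \<sigma>)" "locally_constant (B i n)"
      "t \<in> space M \<Longrightarrow> E i t = {z. \<exists>\<sigma>. \<forall>n. z \<in> B i n \<sigma> t}" for i n \<sigma> t
    using B0 by simp_all
  define B' where "B' k \<sigma> = B (fst (prod_decode k)) (snd (prod_decode k)) (\<lambda>j. \<sigma> (prod_encode (fst (prod_decode k), j)))"
    for k and \<sigma> :: "nat \<Rightarrow> nat"
  have "locally_constant (B' k)" for k
    unfolding locally_constant_def
  proof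
    fix \<sigma> :: "nat \<Rightarrow> nat"
    define i n where "i = fst (prod_decode k)" and "n = snd (prod_decode k)"
    obtain N where N: "\<forall>\<tau>. (\<forall>j<N. \<tau> j = \<sigma> (prod_encode (i, j))) \<longrightarrow>
        B i n \<tau> = B i n (\<lambda>j. \<sigma> (prod_encode (i, j)))"
      using B(2)[of i n, unfolded locally_constant_def, THEN spec, of "\<lambda>j. \<sigma> (prod_encode (i, j))"] by (elim exE)
    define K where "K = Suc (Max (insert 0 ((\<lambda>j. prod_encode (i, j)) ` {..<N})))"
    have K: "prod_encode (i, j) < K" if "j < N" for j
      unfolding K_def less_Suc_eq_le using that by (intro Max_ge) auto
    have "B' k \<tau> = B' k \<sigma>" if "\<forall>i<K. \<tau> i = \<sigma> i" for \<tau>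
      unfolding B'_def i_def[symmetric] n_def[symmetric]
      by (rule N[rule_format]) (use that K in blast)
    then show "\<exists>N. \<forall>\<tau>. (\<forall>i<N. \<tau> i = \<sigma> i) \<longrightarrow> B' k \<tau> = B' k \<sigma>" by blast
  qed
  moreover have "(\<Inter>i. E i t) = {z. \<exists>\<sigma>. \<forall>n. z \<in> B' n \<sigma> t}" if ts: "t \<in> space M" for t
  proof (intro equalityI subsetI)
    fix z assume "z \<in> (\<Inter>i. E i t)"
    then have "\<forall>i. \<exists>\<sigma>. \<forall>n. z \<in> B i n \<sigma> t" using B(3)[OF ts] by auto
    from choice[OF this] obtain s where s: "\<And>i n. z \<in> B i n (s i) t" by auto
    define \<sigma> where "\<sigma> k = s (fst (prod_decode k)) (snd (prod_decode k))" for k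
    have "\<forall>n. z \<in> B' n \<sigma> t" using s by (simp add: B'_def \<sigma>_def)
    then show "z \<in> {z. \<exists>\<sigma>. \<forall>n. z \<in> B' n \<sigma> t}" by blast
  next
    fix z assume "z \<in> {z. \<exists>\<sigma>. \<forall>n. z \<in> B' n \<sigma> t}"
    then obtain \<sigma> where s: "\<And>k. z \<in> B' k \<sigma> t" by blast
    have "z \<in> B i n (\<lambda>j. \<sigma> (prod_encode (i, j))) t" for i n
      using s[of "prod_encode (i, n)"] by (simp add: B'_def)
    then show "z \<in> (\<Inter>i. E i t)" using B(3)[OF ts] by blast
  qed
  moreover have "simple_compact M (B' n \<sigma>)" for n \<sigma> by (simp add: B'_def B(1))
  ultimately show ?thesis unfolding souslin_def by blast
qed

lemma souslin_simple_compact: "simple_compact M K \<Longrightarrow> souslin M K"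
  unfolding souslin_def by (intro exI[of _ "\<lambda>_ _. K"]) (auto simp: locally_constant_def)

lemma souslin_cong:
  "souslin M E \<Longrightarrow> (\<And>t. t \<in> space M \<Longrightarrow> E t = F t) \<Longrightarrow> souslin M F"
  unfolding souslin_def by (simp cong: ball_cong)

lemma simple_compact_rectangle:
  assumes "A \<in> sets M" "compact C"
  shows "simple_compact M (\<lambda>t. if t \<in> A then C else {})"
proof -
  have "simple_function M (\<lambda>t. if t \<in> A then C else {})"
    using simple_function_If_set[of M "\<lambda>_. C" "\<lambda>_. {}" A] assms(1)
      sets.sets_into_space[OF assms(1)] by (simp add: Int_absorb2)
  then show ?thesis using assms(2) by (simp add: simple_compact_def)
qed

lemma souslin_rectangle_open:
  fixes U :: "'z::euclidean_space set"
  assumes "A \<in> sets M" "open U"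
  shows "souslin M (\<lambda>t. if t \<in> A then U else {})"
proof -
  obtain D :: "'z set set" where D: "countable D" "D \<subseteq> Pow U" "\<And>X. X \<in> D \<Longrightarrow> \<exists>a b. X = cbox a b" "\<Union>D = U"
    using open_countable_Union_open_cbox[OF assms(2)] by metis
  define D' where "D' = insert {} D"
  define K where "K = from_nat_into D'"
  have "range K = D'" unfolding K_def using D(1) by (intro range_from_nat_into) (auto simp: D'_def)
  then have KD: "K i = {} \<or> K i \<in> D" "(\<Union>i. K i) = U" for i
    using D(4) by (auto simp: D'_def)
  have K: "compact (K i)" for i
    using KD(1)[of i] D(3)[of "K i"] by auto
  have "souslin M (\<lambda>t. \<Union>i. if t \<in> A then K i else {})"
    by (intro souslin_UN souslin_simple_compact simple_compact_rectangle assms K)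
  then show ?thesis by (rule souslin_cong) (use KD(2) in \<open>auto split: if_splits\<close>)
qed

lemma souslin_rectangle_closed:
  fixes C :: "'z::euclidean_space set"
  assumes "A \<in> sets M" "closed C"
  shows "souslin M (\<lambda>t. if t \<in> A then C else {})"
proof -
  have "souslin M (\<lambda>t. \<Union>i::nat. if t \<in> A then C \<inter> cball 0 (real i) else {})"
    by (intro souslin_UN souslin_simple_compact simple_compact_rectangle assms) (auto simp: assms(2) closed_Int_compact)
  then show ?thesis
    by (rule souslin_cong) (auto simp: real_arch_simple split: if_splits)
qed

text \<open>Complements of Souslin sets need not be Souslin. The sets that are Souslin together with their complement form a
\<open>\<sigma>\<close>-algebra, however, and it contains the rectangles because open and closed sets are countable unions of compact sets.\<close>

lemma souslin_pair_sets:
  fixes E :: "('t \<times> 'z::euclidean_space) set"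
  assumes "E \<in> sets (M \<Otimes>\<^sub>M borel)"
  shows "souslin M (\<lambda>t. {z. (t, z) \<in> E})"
proof -
  define \<Omega> where "\<Omega> = space M \<times> (UNIV :: 'z set)"
  define \<S> where "\<S> = {E. E \<subseteq> \<Omega> \<and> souslin M (\<lambda>t. {z. (t, z) \<in> E}) \<and> souslin M (\<lambda>t. {z. (t, z) \<notin> E})}"
  have sig: "sigma_algebra \<Omega> \<S>"
    unfolding sigma_algebra_iff2
  proof (intro conjI ballI allI impI)
    have "souslin M (\<lambda>t. if t \<in> space M then UNIV :: 'z set else {})"
      by (rule souslin_rectangle_open) auto
    then have "souslin M (\<lambda>t. UNIV :: 'z set)" by (rule souslin_cong) auto
    then show "{} \<in> \<S>" by (simp add: \<S>_def souslin_simple_compact simple_compact_empty)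
    show "\<Omega> - s \<in> \<S>" if "s \<in> \<S>" for s
    proof -
      have s: "souslin M (\<lambda>t. {z. (t, z) \<in> s})" "souslin M (\<lambda>t. {z. (t, z) \<notin> s})"
        using that by (auto simp: \<S>_def)
      show ?thesis unfolding \<S>_def
      proof (intro CollectI conjI)
        show "souslin M (\<lambda>t. {z. (t, z) \<in> \<Omega> - s})"
          by (rule souslin_cong[OF s(2)]) (auto simp: \<Omega>_def)
        show "souslin M (\<lambda>t. {z. (t, z) \<notin> \<Omega> - s})"
          by (rule souslin_cong[OF s(1)]) (auto simp: \<Omega>_def)
      qed auto
    qed
    show "(\<Union>i::nat. A i) \<in> \<S>" if "range A \<subseteq> \<S>" for A
    proof -
      have A: "A i \<subseteq> \<Omega>" "souslin M (\<lambda>t. {z. (t, z) \<in> A i})" "souslin M (\<lambda>t. {z. (t, z) \<notin> A i})" for i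
        using that by (auto simp: \<S>_def)
      show ?thesis unfolding \<S>_def
      proof (intro CollectI conjI)
        show "souslin M (\<lambda>t. {z. (t, z) \<in> (\<Union>i. A i)})"
          by (rule souslin_cong[OF souslin_UN[of M "\<lambda>i t. {z. (t, z) \<in> A i}"]]) (auto simp: A)
        show "souslin M (\<lambda>t. {z. (t, z) \<notin> (\<Union>i. A i)})"
          by (rule souslin_cong[OF souslin_INT[of M "\<lambda>i t. {z. (t, z) \<notin> A i}"]]) (auto simp: A)
      qed (use A in blast)
    qed
  qed (auto simp: \<S>_def)
  then interpret S: sigma_algebra \<Omega> \<S> .
  have cyl: "A \<times> UNIV \<in> \<S>" if A: "A \<in> sets M" for A
    unfolding \<S>_def
  proof (intro CollectI conjI)
    show "A \<times> UNIV \<subseteq> \<Omega>" using sets.sets_into_space[OF A] by (auto simp: \<Omega>_def)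
    show "souslin M (\<lambda>t. {z::'z. (t, z) \<in> A \<times> UNIV})"
      by (rule souslin_cong[OF souslin_rectangle_open[OF A, of UNIV]]) auto
    have "space M - A \<in> sets M" using A by auto
    from souslin_rectangle_open[OF this, of "UNIV :: 'z set"]
    show "souslin M (\<lambda>t. {z::'z. (t, z) \<notin> A \<times> UNIV})"
      by (auto elim!: souslin_cong)
  qed
  have base: "space M \<times> B \<in> \<S>" if "B \<in> sets borel" for B :: "'z set"
  proof -
    have "B \<in> sigma_sets UNIV {S. open S}" using that by (simp add: borel_def)
    then show ?thesis
  proof (induction rule: sigma_sets.induct)
    case (Basic U)
    then have U: "open U" by simp
    show ?case unfolding \<S>_def
    proof (intro CollectI conjI)
      show "souslin M (\<lambda>t. {z::'z. (t, z) \<in> space M \<times> U})"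
        by (rule souslin_cong[OF souslin_rectangle_open[OF sets.top U]]) auto
      show "souslin M (\<lambda>t. {z::'z. (t, z) \<notin> space M \<times> U})"
        by (rule souslin_cong[OF souslin_rectangle_closed[OF sets.top, of "- U"]]) (use U in auto)
    qed (auto simp: \<Omega>_def)
  next
    case Empty
    then show ?case using S.empty_sets by simp
  next
    case (Compl B)
    then have "\<Omega> - space M \<times> B \<in> \<S>" by auto
    then show ?case by (simp add: \<Omega>_def Times_Diff_distrib1 Sigma_Diff_distrib2)
  next
    case (Union B)
    then have "(\<Union>i. space M \<times> B i) \<in> \<S>" by auto
    then show ?case by (auto elim!: back_subst[of "\<lambda>X. X \<in> \<S>"])
  qed
  qed
  have rect: "A \<times> B \<in> \<S>" if "A \<in> sets M" "B \<in> sets borel" for A and B :: "'z set"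
  proof -
    have "A \<times> UNIV \<inter> space M \<times> B \<in> \<S>" using cyl base that by blast
    then show ?thesis using sets.sets_into_space[OF that(1)] by (simp add: Times_Int_Times Int_absorb2)
  qed
  have "sets (M \<Otimes>\<^sub>M (borel :: 'z measure)) \<subseteq> \<S>"
    unfolding sets_pair_measure
    using S.sigma_sets_subset[of "{a \<times> b | a b. a \<in> sets M \<and> b \<in> sets (borel :: 'z measure)}"] rect
    by (auto simp: \<Omega>_def)
  with assms show ?thesis by (auto simp: \<S>_def)
qed

text \<open>The inner approximations exhaust the outer measure of the projection. It therefore differs from a measurable set by a
subset of a null set, and completeness applies.\<close>

theorem measurable_projection:
  fixes E :: "('t \<times> 'z::euclidean_space) set"
  assumes "finite_measure M" "complete_measure M" "E \<in> sets (M \<Otimes>\<^sub>M borel)"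
  shows "{t\<in>space M. \<exists>z. (t, z) \<in> E} \<in> sets M"
proof -
  interpret finite_measure M by fact
  define P where "P = {t\<in>space M. \<exists>z. (t, z) \<in> E}"
  have P: "P \<subseteq> space M" by (auto simp: P_def)
  obtain U where U: "U \<in> sets M" "P \<subseteq> U" "outer_measure_of M P = emeasure M U"
    using outer_measure_of_attain[OF P] by blast
  have inner: "\<exists>A\<in>sets M. A \<subseteq> P \<and> a \<le> emeasure M A" if "a < emeasure M U" for a
    using souslin_inner_approx[OF assms(1) souslin_pair_sets[OF assms(3)], of a] that U(3)
    by (simp add: P_def)
  have "\<exists>V\<in>sets M. V \<subseteq> P \<and> emeasure M U \<le> emeasure M V"
  proof (cases "emeasure M U = 0")
    case True
    then show ?thesis by (intro bexI[of _ "{}"]) auto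
  next
    case False
    then obtain a where a: "\<And>n::nat. a n < emeasure M U" "a \<longlonglongrightarrow> emeasure M U"
      using approx_from_below_dense_linorder[of 0 "emeasure M U"] by (auto simp: zero_less_iff_neq_zero)
    have "\<forall>n. \<exists>A\<in>sets M. A \<subseteq> P \<and> a n \<le> emeasure M A" using inner a(1) by blast
    then obtain A where A: "\<And>n. A n \<in> sets M" "\<And>n. A n \<subseteq> P" "\<And>n. a n \<le> emeasure M (A n)"
      by metis
    have "a n \<le> emeasure M (\<Union>n. A n)" for n
      using A by (intro order_trans[OF A(3)[of n]] emeasure_mono) auto
    then have "emeasure M U \<le> emeasure M (\<Union>n. A n)"
      by (intro LIMSEQ_le_const2[OF a(2)]) auto
    then show ?thesis using A by (intro bexI[of _ "\<Union>n. A n"]) auto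
  qed
  then obtain V where V: "V \<in> sets M" "V \<subseteq> P" "emeasure M U \<le> emeasure M V" by blast
  have "emeasure M V = emeasure M U"
    using V U emeasure_mono[of V U M] by (intro antisym) auto
  then have "U - V \<in> null_sets M"
    using U V emeasure_Diff[of M V U] by (intro null_setsI) auto
  then have "P - V \<in> sets M"
    using complete_measure.complete[OF assms(2), of "P - V" "U - V"] U(2) by blast
  then have "V \<union> (P - V) \<in> sets M" using V by blast
  then show ?thesis using V(2) by (simp add: P_def[symmetric] Un_absorb1)
qed

section \<open>Measurable selections of minimizers\<close>

text \<open>The sets \<open>{t. (INF z. H t z) < y}\<close> are the projections of the sets \<open>{(t, z). H t z < y}\<close>.\<close>

lemma measurable_INF_section:
  fixes H :: "'t \<Rightarrow> 'z::euclidean_space \<Rightarrow> ereal"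
  assumes "finite_measure M" "complete_measure M"
    and [measurable]: "(\<lambda>(t, z). H t z) \<in> borel_measurable (M \<Otimes>\<^sub>M borel)"
  shows "(\<lambda>t. INF z. H t z) \<in> borel_measurable M"
proof (rule borel_measurableI_less)
  fix y :: ereal
  have "{p \<in> space (M \<Otimes>\<^sub>M (borel::'z measure)). (\<lambda>(t, z). H t z) p < y} \<in> sets (M \<Otimes>\<^sub>M borel)"
    by measurable
  from measurable_projection[OF assms(1,2) this]
  show "{t \<in> space M. (INF z. H t z) < y} \<in> sets M"
    by (simp add: INF_less_iff space_pair_measure conj_commute cong: conj_cong)
qed

text \<open>Minimizing the linear functions \<open>\<lambda>z. inner z b\<close> for \<open>b \<in> F\<close> one after the other keeps the sections compact, and nonempty if
they were so. For \<open>F = Basis\<close> at most one point of each section remains.\<close>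

lemma lexicographic_shrink:
  fixes E :: "('t \<times> 'z::euclidean_space) set"
  assumes M: "finite_measure M" "complete_measure M" and E: "E \<in> sets (M \<Otimes>\<^sub>M borel)"
    and cpt: "\<And>t. t \<in> space M \<Longrightarrow> compact {z. (t, z) \<in> E}"
    and "finite F"
  shows "\<exists>E'\<subseteq>E. E' \<in> sets (M \<Otimes>\<^sub>M borel) \<and>
      (\<forall>t\<in>space M. compact {z. (t, z) \<in> E'} \<and> ((\<exists>z. (t, z) \<in> E) \<longrightarrow> (\<exists>z. (t, z) \<in> E'))) \<and>
      (\<forall>t z z' b. (t, z) \<in> E' \<longrightarrow> (t, z') \<in> E' \<longrightarrow> b \<in> F \<longrightarrow> inner z b = inner z' b)"
  using \<open>finite F\<close>
proof (induction F rule: finite_induct)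
  case empty
  then show ?case using E cpt by (intro exI[of _ E]) auto
next
  case (insert b F)
  then obtain E' where E': "E' \<subseteq> E" "E' \<in> sets (M \<Otimes>\<^sub>M borel)"
      "\<And>t. t \<in> space M \<Longrightarrow> compact {z. (t, z) \<in> E'}"
      "\<And>t. t \<in> space M \<Longrightarrow> (\<exists>z. (t, z) \<in> E) \<Longrightarrow> (\<exists>z. (t, z) \<in> E')"
      "\<And>t z z' b. (t, z) \<in> E' \<Longrightarrow> (t, z') \<in> E' \<Longrightarrow> b \<in> F \<Longrightarrow> inner z b = inner z' b"
    by blast
  note [measurable] = E'(2)
  define H where "H t z = (if (t, z) \<in> E' then ereal (inner z b) else \<infinity>)" for t z
  define v where "v t = (INF z. H t z)" for t
  have H_meas: "(\<lambda>(t, z). H t z) \<in> borel_measurable (M \<Otimes>\<^sub>M borel)"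
  proof -
    have "(\<lambda>p. if p \<in> E' then ereal (inner (snd p) b) else \<infinity>) \<in> borel_measurable (M \<Otimes>\<^sub>M borel)"
      by measurable
    then show ?thesis by (simp add: H_def case_prod_beta')
  qed
  have [measurable]: "v \<in> borel_measurable M"
    unfolding v_def by (rule measurable_INF_section[OF M H_meas])
  define E'' where "E'' = {p \<in> space (M \<Otimes>\<^sub>M borel). p \<in> E' \<and> ereal (inner (snd p) b) = v (fst p)}"
  have m1: "E'' \<in> sets (M \<Otimes>\<^sub>M borel)" unfolding E''_def by measurable
  have m2: "compact {z. (t, z) \<in> E''}" "(\<exists>z. (t, z) \<in> E) \<Longrightarrow> (\<exists>z. (t, z) \<in> E'')"
    if t: "t \<in> space M" for t
  proof -
    have eq: "{z. (t, z) \<in> E''} = {z. (t, z) \<in> E'} \<inter> {z. ereal (inner z b) = v t}"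
      using t by (auto simp: E''_def space_pair_measure)
    have "closed {z. ereal (inner z b) = v t}"
      by (intro closed_Collect_eq continuous_intros)
    then show "compact {z. (t, z) \<in> E''}"
      unfolding eq using E'(3)[OF t] by (intro compact_Int_closed)
    assume "\<exists>z. (t, z) \<in> E"
    then have ne: "{z. (t, z) \<in> E'} \<noteq> {}" using E'(4)[OF t] by blast
    have "continuous_on {z. (t, z) \<in> E'} (\<lambda>z. inner z b)" by (intro continuous_intros)
    from continuous_attains_inf[OF E'(3)[OF t] ne this]
    obtain z0 where z0: "(t, z0) \<in> E'" "\<And>z. (t, z) \<in> E' \<Longrightarrow> inner z0 b \<le> inner z b"
      by auto
    have "v t = ereal (inner z0 b)"
      unfolding v_def using z0 by (intro antisym INF_lower2[of z0] INF_greatest) (auto simp: H_def)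
    then show "\<exists>z. (t, z) \<in> E''"
      using z0(1) t by (intro exI[of _ z0]) (auto simp: E''_def space_pair_measure)
  qed
  have m3: "inner z c = inner z' c" if "(t, z) \<in> E''" "(t, z') \<in> E''" "c \<in> insert b F" for t z z' c
  proof (cases "c = b")
    case True
    have "ereal (inner z b) = ereal (inner z' b)" using that by (simp add: E''_def)
    then show ?thesis using True by simp
  next
    case False
    then show ?thesis using that E'(5)[of t z z' c] by (simp add: E''_def)
  qed
  have m4: "E'' \<subseteq> E" using E'(1) by (auto simp: E''_def)
  show ?case
  proof (intro exI[of _ E''] conjI ballI allI impI)
    show "inner z c = inner z' c" if "(t, z) \<in> E''" "(t, z') \<in> E''" "c \<in> insert b F" for t z z' c
      using that by (rule m3)
  qed (fact m1 m4 | rule m2, assumption+)+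
qed

text \<open>Once the sections are singletons, the preimages under the selection are projections of measurable sets.\<close>

lemma compact_selection:
  fixes E :: "('t \<times> 'z::euclidean_space) set"
  assumes M: "finite_measure M" "complete_measure M" and E: "E \<in> sets (M \<Otimes>\<^sub>M borel)"
    and cpt: "\<And>t. t \<in> space M \<Longrightarrow> compact {z. (t, z) \<in> E}"
  shows "\<exists>f\<in>borel_measurable M. \<forall>t\<in>space M. (\<exists>z. (t, z) \<in> E) \<longrightarrow> (t, f t) \<in> E"
proof -
  obtain E' where E': "E' \<subseteq> E" "E' \<in> sets (M \<Otimes>\<^sub>M borel)"
      "\<And>t. t \<in> space M \<Longrightarrow> (\<exists>z. (t, z) \<in> E) \<Longrightarrow> (\<exists>z. (t, z) \<in> E')"
      "\<And>t z z' b. (t, z) \<in> E' \<Longrightarrow> (t, z') \<in> E' \<Longrightarrow> b \<in> Basis \<Longrightarrow> inner z b = inner z' b"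
    using lexicographic_shrink[OF M E cpt finite_Basis] by blast
  define D where "D = {t\<in>space M. \<exists>z. (t, z) \<in> E'}"
  define f where "f t = (if t \<in> D then (THE z. (t, z) \<in> E') else 0)" for t
  have f: "f t = z" if "(t, z) \<in> E'" "t \<in> space M" for t z
  proof -
    have "(THE z. (t, z) \<in> E') = z"
    proof (rule the_equality)
      fix z' assume "(t, z') \<in> E'"
      from E'(4)[OF this that(1)] show "z' = z" by (rule euclidean_eqI)
    qed (rule that(1))
    then show ?thesis using that by (auto simp: f_def D_def)
  qed
  have D: "D \<in> sets M" unfolding D_def by (rule measurable_projection[OF M E'(2)])
  have "f \<in> borel_measurable M"
  proof (rule borel_measurableI)
    fix S :: "'z set" assume S: "open S"
    define G where "G = E' \<inter> (space M \<times> S)"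
    have "G \<in> sets (M \<Otimes>\<^sub>M borel)" unfolding G_def using S E'(2) by auto
    then have 1: "{t\<in>space M. \<exists>z. (t, z) \<in> G} \<in> sets M" by (rule measurable_projection[OF M])
    have "f -` S \<inter> space M = {t\<in>space M. \<exists>z. (t, z) \<in> G} \<union> (if 0 \<in> S then space M - D else {})"
    proof (rule set_eqI)
      fix t
      show "t \<in> f -` S \<inter> space M \<longleftrightarrow> t \<in> {t\<in>space M. \<exists>z. (t, z) \<in> G} \<union> (if 0 \<in> S then space M - D else {})"
      proof (cases "t \<in> D")
        case True
        then obtain z where z: "t \<in> space M" "(t, z) \<in> E'" by (auto simp: D_def)
        have fz: "f t = z" by (rule f[OF z(2,1)])
        have "(\<exists>z. (t, z) \<in> G) \<longleftrightarrow> z \<in> S"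
        proof
          assume "\<exists>z. (t, z) \<in> G"
          then obtain z' where z': "(t, z') \<in> E'" "z' \<in> S" by (auto simp: G_def)
          then show "z \<in> S" using f[OF z'(1) z(1)] fz by simp
        next
          assume "z \<in> S"
          then have "(t, z) \<in> G" using z by (simp add: G_def)
          then show "\<exists>z. (t, z) \<in> G" by (rule exI)
        qed
        then show ?thesis using z True fz by simp
      next
        case False
        then show ?thesis by (auto simp: f_def D_def G_def)
      qed
    qed
    then show "f -` S \<inter> space M \<in> sets M" using 1 D by auto
  qed
  moreover have "(t, f t) \<in> E" if t: "t \<in> space M" "\<exists>z. (t, z) \<in> E" for t
  proof -
    obtain z where z: "(t, z) \<in> E'" using E'(3)[OF t] by (rule exE)
    then show ?thesis using f[OF z t(1)] E'(1) by (simp add: subset_iff)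
  qed
  ultimately show ?thesis by blast
qed

text \<open>Lower semicontinuity and boundedness of the sublevel sets in one condition.\<close>

definition inf_compact :: "('z::topological_space \<Rightarrow> ereal) \<Rightarrow> bool" where
  "inf_compact h \<longleftrightarrow> (\<forall>a::real. compact {z. h z \<le> ereal a})"

lemma inf_compact_attains:
  fixes h :: "'z::t2_space \<Rightarrow> ereal"
  assumes "inf_compact h"
  obtains z where "\<And>z'. h z \<le> h z'"
proof -
  define i where "i = (INF z. h z)"
  show thesis
  proof (cases "i = \<infinity>")
    case True
    then have "h z = \<infinity>" for z
      unfolding i_def by (metis INF_lower UNIV_I ereal_infty_less_eq(1))
    then show ?thesis using that by simp
  next
    case False
    then obtain a0 where a0: "i < ereal a0" using ereal_dense2[of i \<infinity>] by (auto simp: less_top)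
    define F where "F = (\<lambda>a. {z. h z \<le> ereal a}) ` {a. i < ereal a}"
    have "{z. h z \<le> ereal a0} \<inter> \<Inter>F \<noteq> {}"
    proof (rule compact_imp_fip)
      show "compact {z. h z \<le> ereal a0}" using assms by (simp add: inf_compact_def)
      show "closed T" if "T \<in> F" for T
        using that assms by (auto simp: F_def inf_compact_def intro: compact_imp_closed)
      fix F' assume F': "finite F'" "F' \<subseteq> F"
      then obtain I where I: "finite I" "I \<subseteq> {a. i < ereal a}" "F' = (\<lambda>a. {z. h z \<le> ereal a}) ` I"
        unfolding F_def by (meson finite_subset_image)
      define m where "m = Min (insert a0 I)"
      have "m \<in> insert a0 I" unfolding m_def using I by (intro Min_in) auto
      then have "i < ereal m" using a0 I(2) by auto
      then obtain z where z: "h z < ereal m" unfolding i_def by (auto simp: INF_less_iff)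
      have "h z \<le> ereal a" if "a \<in> insert a0 I" for a
      proof -
        have "m \<le> a" unfolding m_def using that I by (intro Min_le) auto
        then show ?thesis using z by (meson ereal_less_eq(3) less_imp_le order_trans)
      qed
      then show "{z. h z \<le> ereal a0} \<inter> \<Inter>F' \<noteq> {}" unfolding I(3) by blast
    qed
    then obtain z where z: "\<And>a. i < ereal a \<Longrightarrow> h z \<le> ereal a" by (auto simp: F_def)
    have "h z \<le> i"
    proof (rule ccontr)
      assume "\<not> h z \<le> i"
      then obtain a where "i < ereal a" "ereal a < h z" using ereal_dense2[of i "h z"] by (auto simp: not_le)
      with z[of a] show False by simp
    qed
    then have "h z \<le> h z'" for z'
      by (rule order_trans) (auto simp: i_def intro: INF_lower)
    then show ?thesis using that by blast
  qed
qed

text \<open>Where the infimum is finite, the minimizers form a compact sublevel set, from which a measurable selection can be made; where it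
is \<open>\<infinity>\<close>, every point is a minimizer.\<close>

lemma measurable_minimizer:
  fixes H :: "'t \<Rightarrow> 'z::euclidean_space \<Rightarrow> ereal"
  assumes M: "finite_measure M" "complete_measure M"
    and H: "(\<lambda>(t, z). H t z) \<in> borel_measurable (M \<Otimes>\<^sub>M borel)"
    and cpt: "\<And>t. t \<in> space M \<Longrightarrow> inf_compact (H t)"
    and lower: "\<And>t z. t \<in> space M \<Longrightarrow> H t z \<noteq> -\<infinity>"
  obtains f where "f \<in> borel_measurable M" "\<And>t z. t \<in> space M \<Longrightarrow> H t (f t) \<le> H t z"
proof -
  define v where "v t = (INF z. H t z)" for t
  have [measurable]: "v \<in> borel_measurable M"
    unfolding v_def by (rule measurable_INF_section[OF M H])
  have [measurable]: "(\<lambda>p. H (fst p) (snd p)) \<in> borel_measurable (M \<Otimes>\<^sub>M borel)"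
    using H by (simp add: case_prod_beta')
  define E where "E = {p \<in> space (M \<Otimes>\<^sub>M (borel::'z measure)). H (fst p) (snd p) \<le> v (fst p) \<and> v (fst p) < \<infinity>}"
  have E: "E \<in> sets (M \<Otimes>\<^sub>M borel)" unfolding E_def by measurable
  have vlow: "v t \<noteq> -\<infinity>" and att: "\<exists>z. H t z = v t" if t: "t \<in> space M" for t
  proof -
    obtain z where z: "\<And>z'. H t z \<le> H t z'" using inf_compact_attains[OF cpt[OF t]] by blast
    have "v t = H t z" unfolding v_def using z by (intro antisym INF_lower INF_greatest) auto
    then show "v t \<noteq> -\<infinity>" "\<exists>z. H t z = v t" using lower[OF t] by auto
  qed
  have "compact {z. (t, z) \<in> E}" if t: "t \<in> space M" for t
  proof (cases "v t")
    case (real a)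
    then have "{z. (t, z) \<in> E} = {z. H t z \<le> ereal a}" using t by (auto simp: E_def space_pair_measure)
    then show ?thesis using cpt[OF t] by (simp add: inf_compact_def)
  qed (use vlow[OF t] in \<open>auto simp: E_def\<close>)
  from compact_selection[OF M E this] obtain f where f: "f \<in> borel_measurable M"
    "\<And>t. t \<in> space M \<Longrightarrow> (\<exists>z. (t, z) \<in> E) \<Longrightarrow> (t, f t) \<in> E" by blast
  have "H t (f t) \<le> H t z" if t: "t \<in> space M" for t z
  proof (cases "v t < \<infinity>")
    case True
    obtain z0 where "H t z0 = v t" using att[OF t] by blast
    then have "(t, z0) \<in> E" using t True by (auto simp: E_def space_pair_measure)
    then have "(t, f t) \<in> E" using f(2)[OF t] by blast
    then have "H t (f t) \<le> v t" by (simp add: E_def)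
    also have "v t \<le> H t z" unfolding v_def by (intro INF_lower) auto
    finally show ?thesis .
  next
    case False
    then have "v t = \<infinity>" by (simp add: less_top)
    moreover have "v t \<le> H t z" unfolding v_def by (intro INF_lower) auto
    ultimately show ?thesis by simp
  qed
  with f(1) show thesis by (rule that)
qed

section \<open>Lower semicontinuous functions and regular subgradients\<close>

text \<open>The level depends on the point so that a continuous perturbation of \<open>f\<close> can be moved to the right-hand side.\<close>

lemma lsc_closed_sublevel:
  fixes f :: "'a::topological_space \<Rightarrow> ereal"
  assumes "lsc f" "continuous_on UNIV c"
  shows "closed {z. f z \<le> ereal (c z)}"
proof -
  have "open {z. ereal (c z) < f z}"
  proof (subst open_subopen, rule ballI)
    fix z assume "z \<in> {z. ereal (c z) < f z}"
    then obtain a where a: "ereal (c z) < ereal a" "ereal a < f z" using ereal_dense2 by blast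
    have "ereal a < Liminf (at z) f" using assms(1) a(2) unfolding lsc_def by (meson less_le_trans)
    then have "eventually (\<lambda>z'. ereal a < f z') (at z)" by (rule less_LiminfD)
    then have 1: "eventually (\<lambda>z'. ereal a < f z') (nhds z)"
      using a(2) by (auto simp: eventually_at_filter elim: eventually_mono)
    have "(c \<longlongrightarrow> c z) (at z)"
      using assms(2) by (simp add: continuous_on_def)
    then have "eventually (\<lambda>z'. c z' < a) (at z)" using a(1) by (auto dest: order_tendstoD)
    then have 2: "eventually (\<lambda>z'. c z' < a) (nhds z)"
      using a(1) by (auto simp: eventually_at_filter elim: eventually_mono)
    from 1 2 have "eventually (\<lambda>z'. ereal (c z') < f z') (nhds z)"
      by eventually_elim (meson ereal_less(2) less_trans less_ereal.simps(1))
    then show "\<exists>T. open T \<and> z \<in> T \<and> T \<subseteq> {z. ereal (c z) < f z}"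
      by (auto simp: eventually_nhds)
  qed
  moreover have "{z. f z \<le> ereal (c z)} = - {z. ereal (c z) < f z}" by auto
  ultimately show ?thesis by (simp add: closed_def)
qed

text \<open>The points of the epigraph near \<open>(z, f z)\<close> lie above the graph of \<open>a + (R - R z)\<close>, which has the normal \<open>(v, -1)\<close>
at \<open>(z, a)\<close>. All subgradients below arise in this way, which is why the penalized problem contains a smoothed norm.\<close>

lemma regular_subdiff_if_smooth_minorant:
  fixes f :: "'a::euclidean_space \<Rightarrow> ereal"
  assumes fz: "f z = ereal a" and deriv: "(R has_derivative (\<lambda>h. inner v h)) (at z)"
    and ev: "eventually (\<lambda>z'. ereal (a + (R z' - R z)) \<le> f z') (nhds z)"
  shows "v \<in> regular_subdiff f z"
proof -
  have "Limsup (at (z, a) within epi f) (\<lambda>u. ereal (inner (v, - 1) (u - (z, a)) / norm (u - (z, a)))) \<le> 0"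
    unfolding Limsup_le_iff
  proof (intro allI impI)
    fix y :: ereal assume "0 < y"
    then obtain k where k: "0 < k" "ereal k < y" using ereal_dense2[of 0 y] by auto
    obtain d1 where d1: "d1 > 0" "\<And>z'. norm (z' - z) < d1 \<Longrightarrow> norm (R z' - R z - inner v (z' - z)) \<le> k * norm (z' - z)"
      using deriv k(1) unfolding has_derivative_at_alt by blast
    obtain d2 where d2: "d2 > 0" "\<And>z'. dist z' z < d2 \<Longrightarrow> ereal (a + (R z' - R z)) \<le> f z'"
      using ev unfolding eventually_nhds_metric by blast
    show "\<forall>\<^sub>F u in at (z, a) within epi f. ereal (inner (v, - 1) (u - (z, a)) / norm (u - (z, a))) < y"
      unfolding eventually_at
    proof (intro exI[of _ "min d1 d2"] conjI ballI impI)
      fix u assume u: "u \<in> epi f" "u \<noteq> (z, a) \<and> dist u (z, a) < min d1 d2"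
      obtain z' \<alpha> where ue: "u = (z', \<alpha>)" by (cases u)
      have dz: "norm (z' - z) \<le> norm (u - (z, a))" unfolding ue by (simp add: norm_fst_le)
      then have dd: "norm (z' - z) < d1" "dist z' z < d2" using u(2) by (auto simp: dist_norm)
      have "ereal (a + (R z' - R z)) \<le> ereal \<alpha>"
        using d2(2)[OF dd(2)] u(1) unfolding epi_def ue by (blast intro: order_trans)
      then have "inner v (z' - z) - (\<alpha> - a) \<le> inner v (z' - z) - (R z' - R z)" by simp
      also have "\<dots> \<le> k * norm (z' - z)" using d1(2)[OF dd(1)] by simp
      also have "\<dots> \<le> k * norm (u - (z, a))" using dz k(1) by (intro mult_left_mono) auto
      finally have "inner (v, - 1) (u - (z, a)) \<le> k * norm (u - (z, a))" by (simp add: ue)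
      then have "inner (v, - 1) (u - (z, a)) / norm (u - (z, a)) \<le> k"
        using u(2) by (simp add: divide_le_eq)
      then show "ereal (inner (v, - 1) (u - (z, a)) / norm (u - (z, a))) < y"
        using k(2) by (meson ereal_less_eq(3) le_less_trans)
    qed (use d1 d2 in auto)
  qed
  then show ?thesis by (simp add: regular_subdiff_def regular_normal_cone_def fz)
qed

section \<open>Tilted integrands and their measurable minimizers\<close>

lemma borel_measurable_fst_snd [measurable]:
  "fst \<in> borel_measurable (borel :: ('a::euclidean_space \<times> 'b::euclidean_space) measure)"
  "snd \<in> borel_measurable (borel :: ('a::euclidean_space \<times> 'b::euclidean_space) measure)"
  by (intro borel_measurable_continuous_onI continuous_intros)+

text \<open>The lower estimate which a regular subgradient of the integral functional provides on a ball of radius \<open>d\<close>. Only pairs \<open>(x, y)\<close> are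
considered whose integrand agrees with an integrable real function \<open>f\<close> almost everywhere, and \<open>b\<close> plays this role for the
base point; the estimate is then one between real integrals.\<close>

definition local_minorant ::
  "'t measure \<Rightarrow> ('t \<Rightarrow> 'x::euclidean_space \<times> 'y::euclidean_space \<Rightarrow> ereal) \<Rightarrow> 'x \<Rightarrow> ('t \<Rightarrow> 'y) \<Rightarrow> ('t \<Rightarrow> real) \<Rightarrow>
     'x \<Rightarrow> ('t \<Rightarrow> 'y) \<Rightarrow> real \<Rightarrow> real \<Rightarrow> bool" where
  "local_minorant M \<phi> x0 y0 b x' y' e d \<longleftrightarrow>
     (\<forall>x y f. integrable M y \<longrightarrow> integrable M f \<longrightarrow> (AE t in M. \<phi> t (x, y t) = ereal (f t)) \<longrightarrow>
        norm (x - x0) + (\<integral>t. norm (y t - y0 t) \<partial>M) < d \<longrightarrow>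
        (\<integral>t. b t \<partial>M) + inner x' (x - x0) + (\<integral>t. inner (y' t) (y t - y0 t) \<partial>M)
          - e * (norm (x - x0) + (\<integral>t. norm (y t - y0 t) \<partial>M)) \<le> (\<integral>t. f t \<partial>M))"

text \<open>The base point is \<open>(xb, yb)\<close>, with values \<open>b\<close>; the pair \<open>(xs, ys)\<close> enters as a subgradient only through \<open>local_minorant\<close>.\<close>

locale integral_functional =
  fixes M :: "'t measure" and \<phi> :: "'t \<Rightarrow> 'x::euclidean_space \<times> 'y::euclidean_space \<Rightarrow> ereal"
    and xb xs :: 'x and yb ys :: "'t \<Rightarrow> 'y" and b nh :: "'t \<Rightarrow> real" and \<rho> Cs :: real
  assumes fin: "finite_measure M" and complete: "complete_measure M"
    and normal: "normal_integrand M \<phi>"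
    and yb: "integrable M yb"
    and ys: "ys \<in> borel_measurable M" and ys_bound: "AE t in M. norm (ys t) \<le> Cs"
    and nh: "integrable M nh" and nh_pos: "\<And>t. t \<in> space M \<Longrightarrow> 0 < nh t"
    and \<rho>: "\<rho> > 0"
    and lower: "\<And>t u w. t \<in> space M \<Longrightarrow> u \<in> cball xb \<rho> \<Longrightarrow>
      ereal (inner (ys t) (w - yb t) - nh t) \<le> \<phi> t (u, w)"
    and b: "integrable M b" and b_eq: "AE t in M. \<phi> t (xb, yb t) = ereal (b t)"
    and local_min: "\<And>e. e > 0 \<Longrightarrow> \<exists>d>0. local_minorant M \<phi> xb yb b xs ys e d"
begin

sublocale finite_measure M by (rule fin)

lemma measurable_data [measurable]:
  "yb \<in> borel_measurable M" "ys \<in> borel_measurable M" "nh \<in> borel_measurable M" "b \<in> borel_measurable M"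
  using yb ys nh b by auto

lemma phi_measurable [measurable]: "(\<lambda>(t, z). \<phi> t z) \<in> borel_measurable (M \<Otimes>\<^sub>M borel)"
  using normal by (simp add: normal_integrand_def)

lemma phi_comp_measurable [measurable]:
  assumes "Z \<in> borel_measurable M"
  shows "(\<lambda>t. \<phi> t (Z t)) \<in> borel_measurable M"
proof -
  have "(\<lambda>t. (t, Z t)) \<in> M \<rightarrow>\<^sub>M M \<Otimes>\<^sub>M borel" using assms by measurable
  from measurable_compose[OF this phi_measurable] show ?thesis by simp
qed

text \<open>The weight in the penalty. As it dominates \<open>b + nh\<close> pointwise, comparing a penalized minimizer \<open>u\<close> with the base point bounds
\<open>k * (norm (u - x))\<^sup>2\<close> uniformly in \<open>t\<close>; the summand \<open>2\<close> absorbs the error made in smoothing the norm. Being integrable, \<open>q\<close> keeps the penalty integrable.\<close>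

definition q :: "'t \<Rightarrow> real" where "q t = \<bar>b t\<bar> + nh t + 2"

lemma q_pos: "t \<in> space M \<Longrightarrow> 0 < q t"
  using nh_pos[of t] by (simp add: q_def)

lemma q_integrable: "integrable M q"
  unfolding q_def using b nh by auto

lemma q_measurable [measurable]: "q \<in> borel_measurable M"
  using q_integrable by auto

text \<open>The tilted integrand with penalty. The square root is \<open>norm (snd z - yb t)\<close> for \<open>\<tau> = 0\<close>, and a smooth majorant of it
for \<open>\<tau> > 0\<close>.\<close>

definition objective :: "real \<Rightarrow> real \<Rightarrow> real \<Rightarrow> 'x \<Rightarrow> 't \<Rightarrow> 'x \<times> 'y \<Rightarrow> real" where
  "objective e \<tau> k x t z = real_of_ereal (\<phi> t z) + e * sqrt ((norm (snd z - yb t))\<^sup>2 + \<tau>\<^sup>2)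
      + k * q t * (norm (fst z - x))\<^sup>2 - inner (ys t) (snd z - yb t)"

text \<open>Finiteness of the integrand is made part of feasibility because \<open>objective\<close> sees it through \<open>real_of_ereal\<close> only, which sends
\<open>\<infinity>\<close> to \<open>0\<close>.\<close>

definition feasible :: "'t set \<Rightarrow> real \<Rightarrow> 'x \<Rightarrow> real \<Rightarrow> 't \<Rightarrow> ('x \<times> 'y) set" where
  "feasible S r a \<eta> t = {z. fst z \<in> cball a \<eta> \<and> (t \<in> S \<longrightarrow> snd z \<in> cball (yb t) r) \<and> \<phi> t z < \<infinity>}"

lemma phi_finite:
  assumes "t \<in> space M" "fst z \<in> cball xb \<rho>" "\<phi> t z < \<infinity>"
  shows "\<phi> t z = ereal (real_of_ereal (\<phi> t z))"
    and "inner (ys t) (snd z - yb t) - nh t \<le> real_of_ereal (\<phi> t z)"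
proof -
  have "ereal (inner (ys t) (snd z - yb t) - nh t) \<le> \<phi> t z"
    using lower[OF assms(1,2), of "snd z"] by simp
  with assms(3) show "\<phi> t z = ereal (real_of_ereal (\<phi> t z))"
    "inner (ys t) (snd z - yb t) - nh t \<le> real_of_ereal (\<phi> t z)"
    by (cases "\<phi> t z"; simp)+
qed

lemma objective_lower:
  assumes "t \<in> space M" "fst z \<in> cball xb \<rho>" "\<phi> t z < \<infinity>" "e \<ge> 0" "k \<ge> 0"
  shows "e * norm (snd z - yb t) + k * q t * (norm (fst z - x))\<^sup>2 - nh t \<le> objective e \<tau> k x t z"
proof -
  have "norm (snd z - yb t) \<le> sqrt ((norm (snd z - yb t))\<^sup>2 + \<tau>\<^sup>2)"
    by (rule real_le_rsqrt) simp
  then have "e * norm (snd z - yb t) \<le> e * sqrt ((norm (snd z - yb t))\<^sup>2 + \<tau>\<^sup>2)"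
    using assms(4) by (rule mult_left_mono)
  then show ?thesis using phi_finite(2)[OF assms(1-3)] by (simp add: objective_def)
qed

lemma penalty_nonneg: "t \<in> space M \<Longrightarrow> k \<ge> 0 \<Longrightarrow> 0 \<le> k * q t * (norm v)\<^sup>2"
  using q_pos[of t] by simp

lemma objective_measurable [measurable]:
  assumes [measurable]: "Z \<in> borel_measurable M"
  shows "(\<lambda>t. objective e \<tau> k x t (Z t)) \<in> borel_measurable M"
  unfolding objective_def by measurable

text \<open>The integrand is bounded below by \<open>- nh t\<close> after tilting, so that the term \<open>e * norm (w - yb t)\<close> bounds the sublevel sets.\<close>

lemma compact_objective_sublevel:
  assumes t: "t \<in> space M" and a: "cball a \<eta> \<subseteq> cball xb \<rho>" and e: "e > 0" and k: "k \<ge> 0"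
  shows "compact {z \<in> feasible S r a \<eta> t. objective e \<tau> k x t z \<le> L}"
proof -
  define c where "c z = L - (e * sqrt ((norm (snd z - yb t))\<^sup>2 + \<tau>\<^sup>2)
      + k * q t * (norm (fst z - x))\<^sup>2 - inner (ys t) (snd z - yb t))" for z :: "'x \<times> 'y"
  have cont: "continuous_on UNIV c" unfolding c_def by (intro continuous_intros)
  have "lsc (\<phi> t)" using normal t by (simp add: normal_integrand_def)
  from lsc_closed_sublevel[OF this cont] have cl: "closed {z. \<phi> t z \<le> ereal (c z)}" .
  define C where "C = (cball a \<eta> :: 'x set) \<times> (if t \<in> S then cball (yb t) r else UNIV)"
  have "{z \<in> feasible S r a \<eta> t. objective e \<tau> k x t z \<le> L} = C \<inter> {z. \<phi> t z \<le> ereal (c z)}"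
  proof (intro set_eqI iffI)
    fix z assume z: "z \<in> {z \<in> feasible S r a \<eta> t. objective e \<tau> k x t z \<le> L}"
    then have 1: "fst z \<in> cball xb \<rho>" "\<phi> t z < \<infinity>" using a by (auto simp: feasible_def)
    have "real_of_ereal (\<phi> t z) \<le> c z" using z by (simp add: objective_def c_def)
    then have "\<phi> t z \<le> ereal (c z)" using phi_finite(1)[OF t 1] by (metis ereal_less_eq(3))
    then show "z \<in> C \<inter> {z. \<phi> t z \<le> ereal (c z)}" using z by (cases z) (auto simp: feasible_def C_def)
  next
    fix z assume z: "z \<in> C \<inter> {z. \<phi> t z \<le> ereal (c z)}"
    then have 1: "fst z \<in> cball xb \<rho>" "\<phi> t z < \<infinity>" using a by (auto simp: C_def)
    have "real_of_ereal (\<phi> t z) \<le> c z" using z phi_finite(1)[OF t 1] by (metis IntD2 ereal_less_eq(3) mem_Collect_eq)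
    then show "z \<in> {z \<in> feasible S r a \<eta> t. objective e \<tau> k x t z \<le> L}"
      using z 1(2) by (cases z) (auto simp: feasible_def C_def objective_def c_def split: if_splits)
  qed
  moreover have "closed C" unfolding C_def by (auto intro: closed_Times)
  moreover have "bounded {z \<in> feasible S r a \<eta> t. objective e \<tau> k x t z \<le> L}"
  proof (rule bounded_subset)
    show "bounded (cball a \<eta> \<times> cball (yb t) ((L + nh t) / e))"
      by (intro compact_imp_bounded compact_Times compact_cball)
    show "{z \<in> feasible S r a \<eta> t. objective e \<tau> k x t z \<le> L} \<subseteq> cball a \<eta> \<times> cball (yb t) ((L + nh t) / e)"
    proof
      fix z assume z: "z \<in> {z \<in> feasible S r a \<eta> t. objective e \<tau> k x t z \<le> L}"
      then have 1: "fst z \<in> cball xb \<rho>" "\<phi> t z < \<infinity>" using a by (auto simp: feasible_def)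
      have "e * norm (snd z - yb t) \<le> L + nh t"
        using objective_lower[OF t 1, of e k x \<tau>] e k z penalty_nonneg[OF t k, of "fst z - x"] by auto
      then have "norm (snd z - yb t) \<le> (L + nh t) / e" using e by (simp add: pos_le_divide_eq mult.commute)
      then show "z \<in> cball a \<eta> \<times> cball (yb t) ((L + nh t) / e)"
        using z by (cases z) (auto simp: feasible_def dist_norm norm_minus_commute)
    qed
  qed
  ultimately show ?thesis using cl by (simp add: compact_eq_bounded_closed closed_Int)
qed

text \<open>Nothing is demanded at points \<open>t\<close> without feasible elements.\<close>

definition minimizer :: "'t set \<Rightarrow> real \<Rightarrow> 'x \<Rightarrow> real \<Rightarrow> real \<Rightarrow> real \<Rightarrow> real \<Rightarrow> 'x \<Rightarrow> ('t \<Rightarrow> 'x \<times> 'y) \<Rightarrow> bool" where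
  "minimizer S r a \<eta> e \<tau> k x Z \<longleftrightarrow> Z \<in> borel_measurable M \<and>
     (\<forall>t\<in>space M. \<forall>z\<in>feasible S r a \<eta> t. Z t \<in> feasible S r a \<eta> t \<and> objective e \<tau> k x t (Z t) \<le> objective e \<tau> k x t z)"

lemma minimizer_exists:
  assumes a: "cball a \<eta> \<subseteq> cball xb \<rho>" and e: "e > 0" and k: "k \<ge> 0" and S[measurable]: "S \<in> sets M"
  shows "\<exists>Z. minimizer S r a \<eta> e \<tau> k x Z"
proof -
  define H where "H t z = (if z \<in> feasible S r a \<eta> t then ereal (objective e \<tau> k x t z) else \<infinity>)" for t z
  have [measurable]: "(\<lambda>p. \<phi> (fst p) (snd p)) \<in> borel_measurable (M \<Otimes>\<^sub>M borel)"
    using phi_measurable by (simp add: case_prod_beta')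
  have "(\<lambda>p. H (fst p) (snd p)) \<in> borel_measurable (M \<Otimes>\<^sub>M borel)"
    unfolding H_def feasible_def objective_def mem_Collect_eq mem_cball dist_norm by measurable
  then have Hm: "(\<lambda>(t, z). H t z) \<in> borel_measurable (M \<Otimes>\<^sub>M borel)"
    by (simp add: case_prod_beta')
  have cpt: "inf_compact (H t)" if t: "t \<in> space M" for t
    unfolding inf_compact_def
  proof
    fix L :: real
    have "{z. H t z \<le> ereal L} = {z \<in> feasible S r a \<eta> t. objective e \<tau> k x t z \<le> L}"
      by (auto simp: H_def split: if_splits)
    then show "compact {z. H t z \<le> ereal L}" using compact_objective_sublevel[OF t a e k] by simp
  qed
  obtain Z where Z: "Z \<in> borel_measurable M" "\<And>t z. t \<in> space M \<Longrightarrow> H t (Z t) \<le> H t z"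
    by (rule measurable_minimizer[OF fin complete Hm cpt]) (auto simp: H_def)
  have "Z t \<in> feasible S r a \<eta> t \<and> objective e \<tau> k x t (Z t) \<le> objective e \<tau> k x t z"
    if t: "t \<in> space M" and z: "z \<in> feasible S r a \<eta> t" for t z
    using Z(2)[OF t, of z] z by (auto simp: H_def split: if_splits)
  then show ?thesis using Z(1) unfolding minimizer_def by blast
qed

text \<open>The second components may oscillate, but by compactness of the sublevel sets they have a cluster point. This is the only
form in which lower semicontinuity of the integrand in both variables enters the passage to the limit.\<close>

lemma limit_point:
  assumes t: "t \<in> space M" and e: "e > 0"
    and z: "\<And>j::nat. z j \<in> feasible S r xb \<rho> t" "\<And>j. objective e \<tau> 0 x' t (z j) \<le> L"
    and lim: "(\<lambda>j. fst (z j)) \<longlonglongrightarrow> x"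
  obtains w where "(x, w) \<in> feasible S r xb \<rho> t" "objective e \<tau> 0 x' t (x, w) \<le> L"
proof -
  have "compact {z \<in> feasible S r xb \<rho> t. objective e \<tau> 0 x' t z \<le> L}"
    by (rule compact_objective_sublevel[OF t _ e]) auto
  then obtain l s where l: "l \<in> {z \<in> feasible S r xb \<rho> t. objective e \<tau> 0 x' t z \<le> L}"
    "strict_mono (s :: nat \<Rightarrow> nat)" "(z \<circ> s) \<longlonglongrightarrow> l"
    using z unfolding compact_def by (metis (mono_tags, lifting) mem_Collect_eq)
  have "(\<lambda>j. fst (z (s j))) \<longlonglongrightarrow> fst l" using tendsto_fst[OF l(3)] by (simp add: o_def)
  moreover have "(\<lambda>j. fst (z (s j))) \<longlonglongrightarrow> x"
    using LIMSEQ_subseq_LIMSEQ[OF lim l(2)] by (simp add: o_def)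
  ultimately have "fst l = x" by (rule LIMSEQ_unique)
  then show thesis using that[of "snd l"] l(1) by (cases l) auto
qed

definition good :: "'t \<Rightarrow> bool" where
  "good t \<longleftrightarrow> t \<in> space M \<and> \<phi> t (xb, yb t) = ereal (b t) \<and> norm (ys t) \<le> Cs"

lemma AE_good: "AE t in M. good t"
  using ys_bound b_eq AE_space by eventually_elim (simp add: good_def)

lemma good_space: "good t \<Longrightarrow> t \<in> space M" by (simp add: good_def)

lemma base_feasible: "good t \<Longrightarrow> xb \<in> cball a \<eta> \<Longrightarrow> r \<ge> 0 \<Longrightarrow> (xb, yb t) \<in> feasible S r a \<eta> t"
  by (simp add: good_def feasible_def)

lemma base_objective: "good t \<Longrightarrow> \<tau> \<ge> 0 \<Longrightarrow> objective e \<tau> k x t (xb, yb t) = b t + e * \<tau> + k * q t * (norm (xb - x))\<^sup>2"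
  by (simp add: objective_def good_def)

lemma minimizer_good:
  assumes "minimizer S r a \<eta> e \<tau> k x Z" "good t" "xb \<in> cball a \<eta>" "r \<ge> 0" "\<tau> \<ge> 0"
  shows "Z t \<in> feasible S r a \<eta> t" "objective e \<tau> k x t (Z t) \<le> b t + e * \<tau> + k * q t * (norm (xb - x))\<^sup>2"
proof -
  have "Z t \<in> feasible S r a \<eta> t \<and> objective e \<tau> k x t (Z t) \<le> objective e \<tau> k x t (xb, yb t)"
    using assms(1) good_space[OF assms(2)] base_feasible[OF assms(2-4)] unfolding minimizer_def by blast
  then show "Z t \<in> feasible S r a \<eta> t" "objective e \<tau> k x t (Z t) \<le> b t + e * \<tau> + k * q t * (norm (xb - x))\<^sup>2"
    by (simp_all add: base_objective[OF assms(2,5)])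
qed

lemma integrable_objective:
  assumes "Z \<in> borel_measurable M" "integrable M h" "e \<ge> 0" "k \<ge> 0"
    and "AE t in M. fst (Z t) \<in> cball xb \<rho> \<and> \<phi> t (Z t) < \<infinity> \<and> objective e \<tau> k x t (Z t) \<le> h t"
  shows "integrable M (\<lambda>t. objective e \<tau> k x t (Z t))"
proof (rule Bochner_Integration.integrable_bound)
  show "integrable M (\<lambda>t. \<bar>h t\<bar> + nh t)" using assms(2) nh by auto
  show "(\<lambda>t. objective e \<tau> k x t (Z t)) \<in> borel_measurable M" using assms(1) by measurable
  show "AE t in M. norm (objective e \<tau> k x t (Z t)) \<le> norm (\<bar>h t\<bar> + nh t)"
    using assms(5) AE_space
  proof eventually_elim
    case (elim t)
    have "- nh t \<le> objective e \<tau> k x t (Z t)"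
      using objective_lower[of t "Z t" e k x \<tau>] elim assms(3,4) penalty_nonneg[of t k "fst (Z t) - x"]
      by (smt (verit) mult_nonneg_nonneg norm_ge_zero)
    then show ?case using elim nh_pos[of t] by (auto simp: abs_le_iff)
  qed
qed

end

section \<open>From local minimality in \<open>L\<^sup>1\<close> to pointwise minimality\<close>

lemma integral_absolutely_continuous:
  fixes v :: "'t \<Rightarrow> real"
  assumes "finite_measure M" "integrable M v" "\<And>t. t \<in> space M \<Longrightarrow> 0 \<le> v t" "d > 0"
  shows "\<exists>c>0. \<forall>B\<in>sets M. measure M B < c \<longrightarrow> (\<integral>t. indicator B t * v t \<partial>M) < d"
proof -
  interpret finite_measure M by fact
  have [measurable]: "v \<in> borel_measurable M" using assms(2) by auto
  have "(\<lambda>N::nat. \<integral>t. indicator {t\<in>space M. v t > real N} t * v t \<partial>M) \<longlonglongrightarrow> (\<integral>t. 0 \<partial>M)"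
  proof (rule integral_dominated_convergence)
    show "integrable M v" by fact
    show "AE t in M. (\<lambda>N::nat. indicator {t\<in>space M. v t > real N} t * v t) \<longlonglongrightarrow> 0"
    proof (rule AE_I2)
      fix t
      obtain n :: nat where "v t \<le> real n" using real_arch_simple by blast
      then have "\<forall>N\<ge>n. indicator {t\<in>space M. v t > real N} t * v t = 0"
        by (auto simp: indicator_def)
      then show "(\<lambda>N::nat. indicator {t\<in>space M. v t > real N} t * v t) \<longlonglongrightarrow> 0"
        by (intro tendsto_eventually) (auto simp: eventually_sequentially)
    qed
    show "AE t in M. norm (indicator {t\<in>space M. v t > real N} t * v t) \<le> v t" for N :: nat
      using assms(3) by (intro AE_I2) (auto simp: indicator_def)
  qed (use assms in auto)
  then have "eventually (\<lambda>N::nat. (\<integral>t. indicator {t\<in>space M. v t > real N} t * v t \<partial>M) < d / 2) sequentially"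
    using \<open>d > 0\<close> by (intro order_tendstoD(2)) auto
  then obtain N :: nat where N: "(\<integral>t. indicator {t\<in>space M. v t > real N} t * v t \<partial>M) < d / 2"
    by (auto simp: eventually_sequentially)
  define A where "A = {t\<in>space M. v t > real N}"
  have [measurable]: "A \<in> sets M" unfolding A_def by measurable
  show ?thesis
  proof (intro exI[of _ "d / (2 * (real N + 1))"] conjI ballI impI)
    show "0 < d / (2 * (real N + 1))" using \<open>d > 0\<close> by simp
    fix B assume [measurable]: "B \<in> sets M" and B: "measure M B < d / (2 * (real N + 1))"
    have i1: "integrable M (\<lambda>t. indicator A t * v t)" "integrable M (\<lambda>t. indicator B t * v t)"
      using integrable_real_mult_indicator[OF _ assms(2)] by (auto simp: mult.commute)
    have i2: "integrable M (\<lambda>t. real N * indicator B t)" by (intro integrable_mult_right) (simp add: emeasure_eq_measure)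
    have "(\<integral>t. indicator B t * v t \<partial>M) \<le> (\<integral>t. indicator A t * v t + real N * indicator B t \<partial>M)"
      using assms(3) i1 i2 by (intro integral_mono) (auto simp: indicator_def A_def)
    also have "\<dots> = (\<integral>t. indicator A t * v t \<partial>M) + real N * measure M B"
      using i1 i2 by (subst Bochner_Integration.integral_add) auto
    also have "real N * measure M B \<le> (real N + 1) * measure M B" by (intro mult_right_mono) auto
    also have "(\<integral>t. indicator A t * v t \<partial>M) + (real N + 1) * measure M B < d / 2 + d / 2"
      using N B unfolding A_def[symmetric] by (intro add_strict_mono) (auto simp: pos_less_divide_eq algebra_simps)
    finally show "(\<integral>t. indicator B t * v t \<partial>M) < d" by simp
  qed
qed

context integral_functional
begin

lemma integrable_inner_ys:
  assumes "integrable M v"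
  shows "integrable M (\<lambda>t. inner (ys t) (v t))"
    and "\<bar>\<integral>t. inner (ys t) (v t) \<partial>M\<bar> \<le> Cs * (\<integral>t. norm (v t) \<partial>M)"
    and "(\<integral>t. \<bar>inner (ys t) (v t)\<bar> \<partial>M) \<le> Cs * (\<integral>t. norm (v t) \<partial>M)"
proof -
  have [measurable]: "v \<in> borel_measurable M" using assms by auto
  have i: "integrable M (\<lambda>t. Cs * norm (v t))" using assms by auto
  have ae: "AE t in M. \<bar>inner (ys t) (v t)\<bar> \<le> Cs * norm (v t)"
    using ys_bound
  proof eventually_elim
    case (elim t)
    have "\<bar>inner (ys t) (v t)\<bar> \<le> norm (ys t) * norm (v t)" by (rule Cauchy_Schwarz_ineq2)
    also have "\<dots> \<le> Cs * norm (v t)" using elim by (intro mult_right_mono) auto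
    finally show ?case .
  qed
  show i2: "integrable M (\<lambda>t. inner (ys t) (v t))"
    by (rule Bochner_Integration.integrable_bound[OF i]) (use ae in auto)
  show 3: "(\<integral>t. \<bar>inner (ys t) (v t)\<bar> \<partial>M) \<le> Cs * (\<integral>t. norm (v t) \<partial>M)"
    using integral_mono_AE[OF integrable_abs[OF i2] i ae] by simp
  show "\<bar>\<integral>t. inner (ys t) (v t) \<partial>M\<bar> \<le> Cs * (\<integral>t. norm (v t) \<partial>M)"
    using integral_abs_bound[of M "\<lambda>t. inner (ys t) (v t)"] 3 by linarith
qed

text \<open>Replacing \<open>yb\<close> by \<open>W\<close> on \<open>B\<close> moves it by less than \<open>d\<close> in \<open>L\<^sup>1\<close>. This cannot lower the tilted integral, although it lowers the tilted
integrand at every point of \<open>B\<close>.\<close>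

lemma improvement_null:
  assumes "e > 0"
  shows "\<exists>d>0. \<forall>B\<in>sets M. \<forall>W\<in>borel_measurable M.
    integrable M (\<lambda>t. indicator B t * norm (W t - yb t)) \<longrightarrow> (\<integral>t. indicator B t * norm (W t - yb t) \<partial>M) < d \<longrightarrow>
    (AE t in M. t \<in> B \<longrightarrow> \<phi> t (xb, W t) < \<infinity> \<and> objective e 0 0 xb t (xb, W t) < b t) \<longrightarrow> B \<in> null_sets M"
proof -
  obtain d where d: "d > 0" and loc: "local_minorant M \<phi> xb yb b xs ys e d"
    using local_min[OF assms] by blast
  show ?thesis
  proof (intro exI[of _ d] conjI ballI impI)
    fix B W
    assume B[measurable]: "B \<in> sets M" and W[measurable]: "W \<in> borel_measurable M"
      and int: "integrable M (\<lambda>t. indicator B t * norm (W t - yb t))"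
      and small: "(\<integral>t. indicator B t * norm (W t - yb t) \<partial>M) < d"
      and imp: "AE t in M. t \<in> B \<longrightarrow> \<phi> t (xb, W t) < \<infinity> \<and> objective e 0 0 xb t (xb, W t) < b t"
    define y where "y t = (if t \<in> B then W t else yb t)" for t
    have [measurable]: "y \<in> borel_measurable M" unfolding y_def by measurable
    have ny: "norm (y t - yb t) = indicator B t * norm (W t - yb t)" for t
      by (simp add: y_def indicator_def)
    have iyn: "integrable M (\<lambda>t. norm (y t - yb t))" unfolding ny by (rule int)
    have iyd: "integrable M (\<lambda>t. y t - yb t)"
      by (rule Bochner_Integration.integrable_bound[OF iyn]) auto
    then have iy: "integrable M y" using Bochner_Integration.integrable_add[OF iyd yb] by simp
    define h where "h t = objective e 0 0 xb t (xb, y t)" for t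
    have hb: "AE t in M. \<phi> t (xb, y t) < \<infinity> \<and> h t \<le> b t \<and> (t \<in> B \<longrightarrow> h t < b t)"
      using imp AE_good
    proof eventually_elim
      case (elim t)
      then show ?case using base_objective[of t 0 e 0 xb] by (auto simp: h_def y_def good_def)
    qed
    have ih: "integrable M h" unfolding h_def
      by (rule integrable_objective[where h=b]) (use hb assms b \<rho> in \<open>auto simp: h_def\<close>)
    define f where "f t = h t - e * norm (y t - yb t) + inner (ys t) (y t - yb t)" for t
    have jf: "integrable M f" unfolding f_def
      using ih iyn integrable_inner_ys(1)[OF iyd] by auto
    have "AE t in M. \<phi> t (xb, y t) = ereal (f t)"
      using hb AE_space
    proof eventually_elim
      case (elim t)
      have "\<phi> t (xb, y t) = ereal (real_of_ereal (\<phi> t (xb, y t)))"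
        using phi_finite(1)[of t "(xb, y t)"] elim \<rho> by simp
      also have "real_of_ereal (\<phi> t (xb, y t)) = f t" by (simp add: f_def h_def objective_def)
      finally show ?case .
    qed
    from loc[unfolded local_minorant_def, rule_format, OF iy jf this] have "(\<integral>t. b t \<partial>M) + (\<integral>t. inner (ys t) (y t - yb t) \<partial>M)
        - e * (\<integral>t. norm (y t - yb t) \<partial>M) \<le> (\<integral>t. f t \<partial>M)"
      using small by (simp add: ny)
    also have "(\<integral>t. f t \<partial>M) = (\<integral>t. h t \<partial>M) - e * (\<integral>t. norm (y t - yb t) \<partial>M) + (\<integral>t. inner (ys t) (y t - yb t) \<partial>M)"
      unfolding f_def using ih iyn integrable_inner_ys(1)[OF iyd] by simp
    finally have "(\<integral>t. b t - h t \<partial>M) \<le> 0" using ih b by simp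
    moreover have nn: "AE t in M. 0 \<le> b t - h t" using hb by eventually_elim simp
    ultimately have "(\<integral>t. b t - h t \<partial>M) = 0" using integral_nonneg_AE[OF nn] by linarith
    then have "AE t in M. b t - h t = 0"
      using integral_nonneg_eq_0_iff_AE[OF _ nn] ih b by auto
    with hb have "AE t in M. t \<notin> B" by eventually_elim auto
    then show "B \<in> null_sets M" by (simp add: AE_iff_null_sets[OF B])
  qed (rule d)
qed

text \<open>The set \<open>S\<close> consists of the points at which some \<open>w\<close> improves on \<open>yb t\<close>. The best such \<open>w\<close> has integrable distance at most
\<open>(b t + nh t) / e\<close> from \<open>yb t\<close>, so that its use on a set of small measure is a small perturbation in \<open>L\<^sup>1\<close>; by
\<open>improvement_null\<close>, the subsets of \<open>S\<close> of small measure are null. A perturbation bounded by \<open>r\<close> is small in \<open>L\<^sup>1\<close>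
even if it takes place everywhere, and therefore the ball of radius \<open>r\<close> contains no improvement for almost all \<open>t \<in> S\<close>.\<close>

lemma exceptional_set:
  assumes e: "e > 0"
  shows "\<exists>S\<in>sets M. \<exists>r>0. \<exists>c>0. (AE t in M. \<forall>z\<in>feasible S r xb 0 t. b t \<le> objective e 0 0 xb t z) \<and>
    (\<forall>B\<in>sets M. B \<subseteq> S \<longrightarrow> measure M B < c \<longrightarrow> B \<in> null_sets M)"
proof -
  obtain d where d: "d > 0" and null: "\<And>B W. B \<in> sets M \<Longrightarrow> W \<in> borel_measurable M \<Longrightarrow>
    integrable M (\<lambda>t. indicator B t * norm (W t - yb t)) \<Longrightarrow> (\<integral>t. indicator B t * norm (W t - yb t) \<partial>M) < d \<Longrightarrow>
    (AE t in M. t \<in> B \<longrightarrow> \<phi> t (xb, W t) < \<infinity> \<and> objective e 0 0 xb t (xb, W t) < b t) \<Longrightarrow> B \<in> null_sets M"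
    using improvement_null[OF e] by meson
  have cb: "cball xb 0 \<subseteq> cball xb \<rho>" using \<rho> by auto
  obtain Z where Z: "minimizer {} 1 xb 0 e 0 0 xb Z"
    using minimizer_exists[OF cb e order_refl sets.empty_sets] by blast
  have [measurable]: "Z \<in> borel_measurable M" using Z by (simp add: minimizer_def)
  have Zg: "Z t \<in> feasible {} 1 xb 0 t" "objective e 0 0 xb t (Z t) \<le> b t" if "good t" for t
    using minimizer_good[OF Z that] by auto
  have Zx: "Z t = (xb, snd (Z t))" "\<phi> t (Z t) < \<infinity>" if "good t" for t
    using Zg(1)[OF that] by (auto simp: feasible_def prod_eq_iff)
  define W where "W t = snd (Z t)" for t
  have [measurable]: "W \<in> borel_measurable M" unfolding W_def by measurable
  define S where "S = {t\<in>space M. objective e 0 0 xb t (Z t) < b t}"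
  have S[measurable]: "S \<in> sets M" unfolding S_def by measurable
  have WI: "integrable M (\<lambda>t. norm (W t - yb t))"
  proof (rule Bochner_Integration.integrable_bound)
    show "integrable M (\<lambda>t. (b t + nh t) / e)" using b nh by auto
    show "AE t in M. norm (norm (W t - yb t)) \<le> norm ((b t + nh t) / e)"
      using AE_good
    proof eventually_elim
      case (elim t)
      have "e * norm (W t - yb t) - nh t \<le> objective e 0 0 xb t (Z t)"
        using objective_lower[of t "Z t" e 0 xb 0] Zx[OF elim] good_space[OF elim] e \<rho>
        by (simp add: W_def) (metis centre_in_cball fst_conv less_imp_le mem_cball)
      then have "e * norm (W t - yb t) \<le> b t + nh t" using Zg(2)[OF elim] by simp
      then have "norm (W t - yb t) \<le> (b t + nh t) / e" using e by (simp add: pos_le_divide_eq mult.commute)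
      then show ?case
        unfolding real_norm_def abs_norm_cancel by (rule order_trans[OF _ abs_ge_self])
    qed
  qed auto
  obtain c where c: "c > 0" "\<And>B. B \<in> sets M \<Longrightarrow> measure M B < c \<Longrightarrow> (\<integral>t. indicator B t * norm (W t - yb t) \<partial>M) < d"
    using integral_absolutely_continuous[OF fin WI _ d] by auto
  define r where "r = d / (2 * (measure M (space M) + 1))"
  have mu0: "0 \<le> measure M (space M)" by simp
  have r: "r > 0" unfolding r_def using d mu0 by (simp add: add_nonneg_pos)
  have small: "B \<in> null_sets M" if B: "B \<in> sets M" "B \<subseteq> S" "measure M B < c" for B
  proof (rule null[OF B(1), of W])
    show "integrable M (\<lambda>t. indicator B t * norm (W t - yb t))"
      using integrable_real_mult_indicator[OF B(1) WI] by (simp add: mult.commute)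
    show "(\<integral>t. indicator B t * norm (W t - yb t) \<partial>M) < d" by (rule c(2)[OF B(1,3)])
    show "AE t in M. t \<in> B \<longrightarrow> \<phi> t (xb, W t) < \<infinity> \<and> objective e 0 0 xb t (xb, W t) < b t"
      using AE_good
    proof eventually_elim
      case (elim t)
      then show ?case using Zx[OF elim] B(2) by (auto simp: W_def S_def)
    qed
  qed simp
  obtain Z2 where Z2: "minimizer S r xb 0 e 0 0 xb Z2"
    using minimizer_exists[OF cb e order_refl S] by blast
  have [measurable]: "Z2 \<in> borel_measurable M" using Z2 by (simp add: minimizer_def)
  have Z2g: "Z2 t \<in> feasible S r xb 0 t" "objective e 0 0 xb t (Z2 t) \<le> b t" if "good t" for t
    using minimizer_good[OF Z2 that] r by auto
  have Z2x: "Z2 t = (xb, snd (Z2 t))" "\<phi> t (Z2 t) < \<infinity>" "t \<in> S \<Longrightarrow> norm (snd (Z2 t) - yb t) \<le> r" if "good t" for t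
    using Z2g(1)[OF that] by (auto simp: feasible_def prod_eq_iff dist_norm norm_minus_commute)
  define B where "B = {t\<in>S. objective e 0 0 xb t (Z2 t) < b t}"
  have Bm[measurable]: "B \<in> sets M"
  proof -
    have "B = S \<inter> {t\<in>space M. objective e 0 0 xb t (Z2 t) < b t}" by (auto simp: B_def S_def)
    then show ?thesis by simp
  qed
  have bd: "AE t in M. indicator B t * norm (snd (Z2 t) - yb t) \<le> r"
    using AE_good
  proof eventually_elim
    case (elim t)
    then show ?case using Z2x(3)[OF elim] r by (auto simp: indicator_def B_def)
  qed
  have ir: "integrable M (\<lambda>t. r)" by simp
  have i2: "integrable M (\<lambda>t. indicator B t * norm (snd (Z2 t) - yb t))"
    by (rule Bochner_Integration.integrable_bound[OF ir]) (use bd r in auto)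
  have "B \<in> null_sets M"
  proof (rule null[OF Bm _ i2])
    have "(\<integral>t. indicator B t * norm (snd (Z2 t) - yb t) \<partial>M) \<le> (\<integral>t. r \<partial>M)"
      by (rule integral_mono_AE[OF i2 ir bd])
    also have "\<dots> = r * measure M (space M)" by simp
    also have "\<dots> \<le> r * (measure M (space M) + 1)" using r by (intro mult_left_mono) auto
    also have "\<dots> = d / 2"
    proof -
      have "measure M (space M) + 1 \<noteq> 0" using mu0 by linarith
      then show ?thesis unfolding r_def by (metis nonzero_divide_mult_cancel_right mult_divide_mult_cancel_right times_divide_eq_left)
    qed
    also have "\<dots> < d" using d by simp
    finally show "(\<integral>t. indicator B t * norm (snd (Z2 t) - yb t) \<partial>M) < d" .
    show "AE t in M. t \<in> B \<longrightarrow> \<phi> t (xb, snd (Z2 t)) < \<infinity> \<and> objective e 0 0 xb t (xb, snd (Z2 t)) < b t"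
      using AE_good
    proof eventually_elim
      case (elim t)
      then show ?case using Z2x(1,2)[OF elim] by (auto simp: B_def)
    qed
  qed simp
  then have "AE t in M. t \<notin> B" by (simp add: AE_iff_null_sets[OF Bm])
  then have "AE t in M. \<forall>z\<in>feasible S r xb 0 t. b t \<le> objective e 0 0 xb t z"
    using AE_good
  proof eventually_elim
    case (elim t)
    show ?case
    proof
      fix z assume z: "z \<in> feasible S r xb 0 t"
      have ts: "t \<in> space M" using elim(2) by (rule good_space)
      show "b t \<le> objective e 0 0 xb t z"
      proof (cases "t \<in> S")
        case True
        then have "b t \<le> objective e 0 0 xb t (Z2 t)" using elim(1) by (auto simp: B_def)
        also have "\<dots> \<le> objective e 0 0 xb t z" using Z2 ts z by (auto simp: minimizer_def)
        finally show ?thesis .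
      next
        case False
        then have "b t \<le> objective e 0 0 xb t (Z t)" using ts by (auto simp: S_def)
        also have "\<dots> \<le> objective e 0 0 xb t z"
        proof -
          have "z \<in> feasible {} 1 xb 0 t" using z by (simp add: feasible_def)
          then show ?thesis using Z ts unfolding minimizer_def by blast
        qed
        finally show ?thesis .
      qed
    qed
  qed
  then show ?thesis using S r c(1) small by blast
qed

text \<open>The function \<open>g\<close> is the infimum of the tilted integrand over the ball of radius \<open>\<eta>\<close>. Along radii tending to \<open>0\<close> these infima
increase; by \<open>limit_point\<close>, their limit is not less than the value at some feasible \<open>(xb, w)\<close>, hence not less than \<open>b t\<close>. Dominated
convergence yields the integrals.\<close>

lemma minorant:
  assumes e: "e > 0" and r: "r > 0" and S: "S \<in> sets M"
    and min: "AE t in M. \<forall>z\<in>feasible S r xb 0 t. b t \<le> objective e 0 0 xb t z"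
    and \<kappa>: "\<kappa> > 0"
  shows "\<exists>\<eta>>0. \<exists>g. \<eta> \<le> \<rho> \<and> integrable M g \<and> (\<integral>t. b t \<partial>M) - \<kappa> \<le> (\<integral>t. g t \<partial>M) \<and>
    (AE t in M. g t \<le> b t \<and> (\<forall>z\<in>feasible S r xb \<eta> t. g t \<le> objective e 0 0 xb t z))"
proof -
  define \<eta> where "\<eta> j = \<rho> / (real j + 1)" for j :: nat
  have \<eta>: "0 < \<eta> j" "\<eta> j \<le> \<rho>" for j using \<rho> by (auto simp: \<eta>_def divide_le_eq)
  have \<eta>_mono: "\<eta> j \<le> \<eta> i" if "i \<le> j" for i j
    unfolding \<eta>_def using that \<rho> by (intro divide_left_mono) auto
  have \<eta>_lim: "\<eta> \<longlonglongrightarrow> 0"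
    unfolding \<eta>_def using LIMSEQ_inverse_real_of_nat[THEN tendsto_mult_left, of \<rho>]
    by (simp add: divide_inverse add.commute)
  have cb: "cball xb (\<eta> j) \<subseteq> cball xb \<rho>" for j using \<eta>[of j] by auto
  have "\<forall>j. \<exists>Z. minimizer S r xb (\<eta> j) e 0 0 xb Z"
    using minimizer_exists[OF cb e _ S, of 0] by auto
  from choice[OF this] obtain Z where Z: "\<And>j. minimizer S r xb (\<eta> j) e 0 0 xb (Z j)" by auto
  have Zm [measurable]: "Z j \<in> borel_measurable M" for j using Z[of j] by (simp add: minimizer_def)
  define g where "g j t = objective e 0 0 xb t (Z j t)" for j t
  have [measurable]: "g j \<in> borel_measurable M" for j unfolding g_def by measurable
  have Zg: "Z j t \<in> feasible S r xb (\<eta> j) t" "g j t \<le> b t" if "good t" for j t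
    using minimizer_good[OF Z[of j] that] r \<eta>[of j] by (auto simp: g_def)
  have feas_mono: "feasible S r xb (\<eta> j) t \<subseteq> feasible S r xb (\<eta> i) t" if "i \<le> j" for i j t
    using \<eta>_mono[OF that] by (auto simp: feasible_def)
  have feas_rho: "feasible S r xb (\<eta> j) t \<subseteq> feasible S r xb \<rho> t" for j t
    using \<eta>(2)[of j] by (auto simp: feasible_def)
  have g_least: "g j t \<le> objective e 0 0 xb t z" if "t \<in> space M" "z \<in> feasible S r xb (\<eta> j) t" for j t z
    using Z[of j] that by (auto simp: minimizer_def g_def)
  have g_incr: "g i t \<le> g j t" if "good t" "i \<le> j" for i j t
    using g_least[OF good_space[OF that(1)], of "Z j t" i] Zg(1)[OF that(1), of j] feas_mono[OF that(2)]
    by (auto simp: g_def)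
  have g_low: "- nh t \<le> g j t" if "good t" for j t
  proof -
    have "Z j t \<in> feasible S r xb \<rho> t" using Zg(1)[OF that] feas_rho by blast
    then have "e * norm (snd (Z j t) - yb t) - nh t \<le> g j t"
      unfolding g_def using objective_lower[OF good_space[OF that], of "Z j t" e 0 xb 0] e by (simp add: feasible_def)
    moreover have "0 \<le> e * norm (snd (Z j t) - yb t)" using e by simp
    ultimately show ?thesis by linarith
  qed
  have lim: "AE t in M. (\<lambda>j. g j t) \<longlonglongrightarrow> b t"
    using min AE_good
  proof eventually_elim
    case (elim t)
    have "Bseq (\<lambda>j. g j t)"
    proof (rule BseqI'[of _ "\<bar>b t\<bar> + nh t"])
      fix j
      show "norm (g j t) \<le> \<bar>b t\<bar> + nh t"
        using g_low[OF elim(2), of j] Zg(2)[OF elim(2), of j] nh_pos[OF good_space[OF elim(2)]] by auto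
    qed
    moreover have "incseq (\<lambda>j. g j t)" using g_incr[OF elim(2)] by (simp add: incseq_def)
    ultimately obtain L where L: "(\<lambda>j. g j t) \<longlonglongrightarrow> L"
      using Bseq_mono_convergent[of "\<lambda>j. g j t"] by (auto simp: convergent_def incseq_def)
    have gL: "g j t \<le> L" for j by (rule incseq_le[OF \<open>incseq _\<close> L])
    have "(\<lambda>j. fst (Z j t)) \<longlonglongrightarrow> xb"
    proof (rule metric_tendsto_imp_tendsto[OF \<eta>_lim])
      show "eventually (\<lambda>j. dist (fst (Z j t)) xb \<le> dist (\<eta> j) 0) sequentially"
      proof (rule always_eventually, rule allI)
        fix j
        have "dist xb (fst (Z j t)) \<le> \<eta> j" using Zg(1)[OF elim(2), of j] by (simp add: feasible_def)
        then show "dist (fst (Z j t)) xb \<le> dist (\<eta> j) 0" using \<eta>(1)[of j] by (simp add: dist_commute)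
      qed
    qed
    moreover have "\<And>j. Z j t \<in> feasible S r xb \<rho> t" using Zg(1)[OF elim(2)] feas_rho by blast
    moreover have "\<And>j. objective e 0 0 xb t (Z j t) \<le> L" using gL by (simp add: g_def)
    ultimately obtain w where w: "(xb, w) \<in> feasible S r xb \<rho> t" "objective e 0 0 xb t (xb, w) \<le> L"
      using limit_point[OF good_space[OF elim(2)] e, of "\<lambda>j. Z j t" S r 0 xb L xb] by blast
    then have "(xb, w) \<in> feasible S r xb 0 t" by (simp add: feasible_def)
    with elim(1) have "b t \<le> objective e 0 0 xb t (xb, w)" by (rule bspec)
    then have "b t \<le> L" using w(2) by linarith
    moreover have "L \<le> b t" by (rule LIMSEQ_le_const2[OF L]) (use Zg(2)[OF elim(2)] in auto)
    ultimately show ?case using L by simp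
  qed
  have dom: "integrable M (\<lambda>t. \<bar>b t\<bar> + nh t)" using b nh by auto
  have bound: "AE t in M. norm (g j t) \<le> \<bar>b t\<bar> + nh t" for j
    using AE_good
  proof eventually_elim
    case (elim t)
    then show ?case using g_low[OF elim, of j] Zg(2)[OF elim, of j] nh_pos[OF good_space[OF elim]] by auto
  qed
  have "(\<lambda>j. \<integral>t. g j t \<partial>M) \<longlonglongrightarrow> (\<integral>t. b t \<partial>M)"
    by (rule integral_dominated_convergence[OF _ _ dom lim bound]) auto
  then have "eventually (\<lambda>j. (\<integral>t. b t \<partial>M) - \<kappa> < (\<integral>t. g j t \<partial>M)) sequentially"
    using \<kappa> by (intro order_tendstoD(1)) auto
  then obtain j where j: "(\<integral>t. b t \<partial>M) - \<kappa> < (\<integral>t. g j t \<partial>M)" by (auto simp: eventually_sequentially)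
  have "integrable M (g j)" by (rule Bochner_Integration.integrable_bound[OF dom]) (use bound[of j] in auto)
  moreover have "AE t in M. g j t \<le> b t \<and> (\<forall>z\<in>feasible S r xb (\<eta> j) t. g j t \<le> objective e 0 0 xb t z)"
    using AE_good
  proof eventually_elim
    case (elim t)
    then show ?case using Zg(2)[OF elim] g_least[OF good_space[OF elim]] by blast
  qed
  ultimately show ?thesis using \<eta>[of j] j by (intro exI[of _ "\<eta> j"] conjI exI[of _ "g j"]) auto
qed

end

section \<open>The penalized problem\<close>

lemma AE_bounded_if_integrals_bounded:
  fixes f :: "nat \<Rightarrow> 't \<Rightarrow> real"
  assumes int: "\<And>k. integrable M (f k)" and inc: "AE t in M. incseq (\<lambda>k. f k t)"
    and nn: "AE t in M. \<forall>k. 0 \<le> f k t" and C: "\<And>k. (\<integral>t. f k t \<partial>M) \<le> C"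
  shows "AE t in M. \<exists>L. \<forall>k. f k t \<le> L"
proof -
  have [measurable]: "f k \<in> borel_measurable M" for k using int by auto
  have nnk: "AE t in M. 0 \<le> f k t" for k using nn by eventually_elim simp
  have "(\<integral>\<^sup>+ t. (SUP k. ennreal (f k t)) \<partial>M) = (SUP k. \<integral>\<^sup>+ t. ennreal (f k t) \<partial>M)"
  proof (rule nn_integral_monotone_convergence_SUP_AE)
    show "AE t in M. ennreal (f k t) \<le> ennreal (f (Suc k) t)" for k
      using inc by eventually_elim (auto simp: incseq_Suc_iff intro: ennreal_leI)
  qed auto
  also have "\<dots> \<le> ennreal C"
  proof (rule SUP_least)
    fix k
    have "(\<integral>\<^sup>+ t. ennreal (f k t) \<partial>M) = ennreal (\<integral>t. f k t \<partial>M)"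
      by (rule nn_integral_eq_integral[OF int nnk])
    also have "\<dots> \<le> ennreal C" using C by (rule ennreal_leI)
    finally show "(\<integral>\<^sup>+ t. ennreal (f k t) \<partial>M) \<le> ennreal C" .
  qed
  finally have "(\<integral>\<^sup>+ t. (SUP k. ennreal (f k t)) \<partial>M) \<noteq> \<infinity>" by (auto simp: top_unique)
  then have "AE t in M. (SUP k. ennreal (f k t)) \<noteq> \<infinity>"
    by (intro nn_integral_noteq_infinite) auto
  then show ?thesis
  proof eventually_elim
    case (elim t)
    then obtain L where L: "L \<ge> 0" "(SUP k. ennreal (f k t)) = ennreal L"
      by (cases "SUP k. ennreal (f k t)") auto
    have "f k t \<le> L" for k
    proof -
      have "ennreal (f k t) \<le> ennreal L" unfolding L(2)[symmetric] by (rule SUP_upper) simp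
      then show ?thesis using L(1) by (simp add: ennreal_le_iff)
    qed
    then show ?case by blast
  qed
qed

text \<open>The norm term has weight \<open>2 * e\<close>: one half is consumed by \<open>g\<close>, which bounds the tilted integrand of weight \<open>e\<close>, and
the other half controls the distance to \<open>yb\<close>.\<close>

locale penalized_problem = integral_functional +
  fixes S :: "'a set" and r e \<eta> \<kappa> \<tau> :: real and g :: "'a \<Rightarrow> real" and Z :: "nat \<Rightarrow> 'b \<Rightarrow> 'a \<Rightarrow> 'b \<times> 'c"
  assumes e: "e > 0" "e \<le> 1" and r: "r > 0" and S: "S \<in> sets M"
    and \<eta>: "\<eta> > 0" "\<eta> \<le> \<rho>" and \<tau>: "\<tau> > 0" "\<tau> \<le> 1"
    and g: "integrable M g" and g_int: "(\<integral>t. b t \<partial>M) - \<kappa> \<le> (\<integral>t. g t \<partial>M)"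
    and g_min: "AE t in M. g t \<le> b t \<and> (\<forall>z\<in>feasible S r xb \<eta> t. g t \<le> objective e 0 0 xb t z)"
    and Z: "\<And>k x. minimizer S r xb \<eta> (2 * e) \<tau> (real k) x (Z k x)"
begin

definition p :: "nat \<Rightarrow> 'b \<Rightarrow> 'a \<Rightarrow> real" where "p k x t = objective (2 * e) \<tau> (real k) x t (Z k x t)"

text \<open>The value function of the penalized problem. Again \<open>2 * e\<close> is twice the weight in the local estimate, which leaves growth of rate \<open>e\<close> in \<open>x\<close>.\<close>

definition P :: "nat \<Rightarrow> 'b \<Rightarrow> real" where
  "P k x = (\<integral>t. p k x t \<partial>M) - inner xs (x - xb) + 2 * e * norm (x - xb)"

lemma Z_measurable [measurable]: "Z k x \<in> borel_measurable M"
  using Z[of k x] by (simp add: minimizer_def)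

lemma p_measurable [measurable]: "p k x \<in> borel_measurable M"
  unfolding p_def by measurable

lemma Z_good:
  assumes "good t"
  shows "Z k x t \<in> feasible S r xb \<eta> t"
    and "p k x t \<le> b t + 2 * e * \<tau> + real k * q t * (norm (xb - x))\<^sup>2"
  using minimizer_good[OF Z[of k x] assms] r \<eta> \<tau> by (auto simp: p_def)

lemma feasible_rho: "z \<in> feasible S r xb \<eta> t \<Longrightarrow> z \<in> feasible S r xb \<rho> t"
  using \<eta> by (auto simp: feasible_def)

lemma feasibleD:
  "z \<in> feasible S r xb \<eta> t \<Longrightarrow> fst z \<in> cball xb \<rho>" "z \<in> feasible S r xb \<eta> t \<Longrightarrow> \<phi> t z < \<infinity>"
  using \<eta> by (auto simp: feasible_def)

lemma p_least: "t \<in> space M \<Longrightarrow> z \<in> feasible S r xb \<eta> t \<Longrightarrow> p k x t \<le> objective (2 * e) \<tau> (real k) x t z"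
  using Z[of k x] by (auto simp: minimizer_def p_def)

lemma objective_ge_linear:
  "objective e 0 0 xb t z + e * norm (snd z - yb t) + k * q t * (norm (fst z - x))\<^sup>2 \<le> objective (2 * e) \<tau> k x t z"
proof -
  have "norm (snd z - yb t) \<le> sqrt ((norm (snd z - yb t))\<^sup>2 + \<tau>\<^sup>2)" by (rule real_le_rsqrt) simp
  then have "e * norm (snd z - yb t) \<le> e * sqrt ((norm (snd z - yb t))\<^sup>2 + \<tau>\<^sup>2)"
    using e by (intro mult_left_mono) auto
  then show ?thesis by (simp add: objective_def)
qed

lemma p_lower:
  assumes "good t"
  shows "real k * q t * (norm (fst (Z k x t) - x))\<^sup>2 - nh t \<le> p k x t" "- nh t \<le> p k x t"
proof -
  note f = feasibleD[OF Z_good(1)[OF assms, of k x]]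
  have "2 * e * norm (snd (Z k x t) - yb t) + real k * q t * (norm (fst (Z k x t) - x))\<^sup>2 - nh t \<le> p k x t"
    unfolding p_def by (rule objective_lower[OF good_space[OF assms] f]) (use e in auto)
  moreover have "0 \<le> 2 * e * norm (snd (Z k x t) - yb t)" using e by simp
  ultimately show 1: "real k * q t * (norm (fst (Z k x t) - x))\<^sup>2 - nh t \<le> p k x t" by linarith
  then show "- nh t \<le> p k x t"
    using penalty_nonneg[OF good_space[OF assms], of "real k" "fst (Z k x t) - x"] by simp
qed

lemma p_integrable: "integrable M (p k x)"
  unfolding p_def
proof (rule integrable_objective)
  show "integrable M (\<lambda>t. b t + 2 * e * \<tau> + real k * q t * (norm (xb - x))\<^sup>2)"
    using b q_integrable by auto
  show "AE t in M. fst (Z k x t) \<in> cball xb \<rho> \<and> \<phi> t (Z k x t) < \<infinity> \<and>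
      objective (2 * e) \<tau> (real k) x t (Z k x t) \<le> b t + 2 * e * \<tau> + real k * q t * (norm (xb - x))\<^sup>2"
    using AE_good
  proof eventually_elim
    case (elim t)
    then show ?case using Z_good[OF elim, of k x] feasibleD[OF Z_good(1)[OF elim, of k x]] by (simp add: p_def)
  qed
qed (use e in auto)

lemma P_base: "P k xb \<le> (\<integral>t. b t \<partial>M) + 2 * e * \<tau> * measure M (space M)"
proof -
  have "(\<integral>t. p k xb t \<partial>M) \<le> (\<integral>t. b t + 2 * e * \<tau> \<partial>M)"
  proof (rule integral_mono_AE[OF p_integrable])
    show "AE t in M. p k xb t \<le> b t + 2 * e * \<tau>"
      using AE_good by eventually_elim (use Z_good(2)[of _ k xb] in auto)
  qed (use b in auto)
  also have "\<dots> = (\<integral>t. b t \<partial>M) + 2 * e * \<tau> * measure M (space M)" using b by simp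
  finally show ?thesis by (simp add: P_def)
qed

text \<open>The minimizer for \<open>x'\<close> is a competitor for \<open>x\<close>, and \<open>\<lambda>x. (norm (u - x))\<^sup>2\<close> is Lipschitz on a ball of radius \<open>\<eta>\<close> that contains \<open>u\<close>.\<close>

lemma p_lipschitz:
  assumes "good t" "x \<in> cball xb \<eta>" "x' \<in> cball xb \<eta>"
  shows "p k x t \<le> p k x' t + real k * q t * (4 * \<eta> * norm (x - x'))"
proof -
  define u where "u = fst (Z k x' t)"
  have u: "u \<in> cball xb \<eta>" using Z_good(1)[OF assms(1), of k x'] by (simp add: u_def feasible_def)
  have "p k x t \<le> objective (2 * e) \<tau> (real k) x t (Z k x' t)"
    by (rule p_least[OF good_space[OF assms(1)] Z_good(1)[OF assms(1)]])
  also have "\<dots> = p k x' t + real k * q t * ((norm (u - x))\<^sup>2 - (norm (u - x'))\<^sup>2)"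
    by (simp add: objective_def p_def u_def algebra_simps)
  also have "(norm (u - x))\<^sup>2 - (norm (u - x'))\<^sup>2 \<le> 4 * \<eta> * norm (x - x')"
  proof -
    have 1: "norm (u - x) \<le> norm (u - xb) + norm (xb - x)" "norm (u - x') \<le> norm (u - xb) + norm (xb - x')"
      using norm_triangle_ineq[of "u - xb" "xb - x"] norm_triangle_ineq[of "u - xb" "xb - x'"] by simp_all
    have 2: "norm (u - xb) \<le> \<eta>" "norm (xb - x) \<le> \<eta>" "norm (xb - x') \<le> \<eta>"
      using u assms by (simp_all add: dist_norm norm_minus_commute)
    have 3: "norm (u - x) - norm (u - x') \<le> norm (x - x')"
      using norm_triangle_ineq2[of "u - x" "u - x'"] by (simp add: norm_minus_commute)
    have "(norm (u - x))\<^sup>2 - (norm (u - x'))\<^sup>2 = (norm (u - x) - norm (u - x')) * (norm (u - x) + norm (u - x'))"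
      by (simp add: power2_eq_square algebra_simps)
    also have "\<dots> \<le> norm (x - x') * (norm (u - x) + norm (u - x'))"
      using 3 by (intro mult_right_mono) auto
    also have "\<dots> \<le> norm (x - x') * (4 * \<eta>)" using 1 2 by (intro mult_left_mono) auto
    finally show ?thesis by (simp add: mult.commute)
  qed
  finally show ?thesis using q_pos[OF good_space[OF assms(1)]] by (simp add: mult_left_mono)
qed

lemma P_continuous: "continuous_on (cball xb \<eta>) (P k)"
proof -
  define Q where "Q = (\<integral>t. q t \<partial>M)"
  have Q: "Q \<ge> 0" unfolding Q_def using q_pos by (intro integral_nonneg_AE AE_I2) (auto intro: less_imp_le)
  have 1: "(\<integral>t. p k x t \<partial>M) \<le> (\<integral>t. p k x' t \<partial>M) + real k * Q * (4 * \<eta>) * norm (x - x')"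
    if "x \<in> cball xb \<eta>" "x' \<in> cball xb \<eta>" for x x'
  proof -
    have "(\<integral>t. p k x t \<partial>M) \<le> (\<integral>t. p k x' t + real k * q t * (4 * \<eta> * norm (x - x')) \<partial>M)"
    proof (rule integral_mono_AE[OF p_integrable])
      show "AE t in M. p k x t \<le> p k x' t + real k * q t * (4 * \<eta> * norm (x - x'))"
        using AE_good by eventually_elim (rule p_lipschitz[OF _ that])
    qed (use p_integrable q_integrable in auto)
    also have "\<dots> = (\<integral>t. p k x' t \<partial>M) + real k * Q * (4 * \<eta>) * norm (x - x')"
      using p_integrable q_integrable by (simp add: Q_def)
    finally show ?thesis .
  qed
  have "(real k * Q * (4 * \<eta>))-lipschitz_on (cball xb \<eta>) (\<lambda>x. \<integral>t. p k x t \<partial>M)"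
  proof (rule lipschitz_onI)
    fix x x' assume "x \<in> cball xb \<eta>" "x' \<in> cball xb \<eta>"
    with 1[of x x'] 1[of x' x] show "dist (\<integral>t. p k x t \<partial>M) (\<integral>t. p k x' t \<partial>M) \<le> real k * Q * (4 * \<eta>) * dist x x'"
      by (simp add: dist_norm norm_minus_commute abs_le_iff)
  qed (use Q \<eta> in auto)
  then have "continuous_on (cball xb \<eta>) (\<lambda>x. \<integral>t. p k x t \<partial>M)" by (rule lipschitz_on_continuous_on)
  then show ?thesis unfolding P_def by (intro continuous_intros)
qed

lemma p_mono: "good t \<Longrightarrow> k \<le> l \<Longrightarrow> p k x t \<le> p l x t"
proof -
  assume t: "good t" and kl: "k \<le> l"
  have "p k x t \<le> objective (2 * e) \<tau> (real k) x t (Z l x t)"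
    by (rule p_least[OF good_space[OF t] Z_good(1)[OF t]])
  also have "\<dots> \<le> p l x t"
    using kl q_pos[OF good_space[OF t]] by (simp add: objective_def p_def mult_right_mono)
  finally show ?thesis .
qed

lemma P_mono: "k \<le> l \<Longrightarrow> P k x \<le> P l x"
proof -
  assume kl: "k \<le> l"
  have "(\<integral>t. p k x t \<partial>M) \<le> (\<integral>t. p l x t \<partial>M)"
  proof (rule integral_mono_AE[OF p_integrable p_integrable])
    show "AE t in M. p k x t \<le> p l x t" using AE_good by eventually_elim (rule p_mono[OF _ kl])
  qed
  then show ?thesis by (simp add: P_def)
qed

text \<open>All terms lie above \<open>g\<close>, whose integral misses that of \<open>b\<close> by at most \<open>\<kappa>\<close>. If the total is at most \<open>\<integral>b + \<kappa>\<close>, only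
\<open>2 * \<kappa>\<close> remains for the nonnegative terms.\<close>

lemma near_optimal:
  assumes F[measurable]: "F \<in> borel_measurable M" and Ff: "AE t in M. F t \<in> feasible S r xb \<eta> t"
    and w: "integrable M w" "(\<integral>t. w t \<partial>M) \<le> (\<integral>t. b t \<partial>M) + \<kappa>"
    and v[measurable]: "v \<in> borel_measurable M" and v0: "AE t in M. 0 \<le> v t"
    and le: "AE t in M. objective e 0 0 xb t (F t) + e * norm (snd (F t) - yb t) + v t \<le> w t"
  shows "integrable M (\<lambda>t. objective e 0 0 xb t (F t))"
    and "integrable M (\<lambda>t. norm (snd (F t) - yb t))" and "integrable M v"
    and "e * (\<integral>t. norm (snd (F t) - yb t) \<partial>M) \<le> 2 * \<kappa>" and "(\<integral>t. v t \<partial>M) \<le> 2 * \<kappa>"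
    and "(\<integral>t. \<bar>objective e 0 0 xb t (F t) - b t\<bar> \<partial>M) \<le> 3 * \<kappa>"
proof -
  define h where "h t = objective e 0 0 xb t (F t)" for t
  define n where "n t = norm (snd (F t) - yb t)" for t
  have [measurable]: "h \<in> borel_measurable M" "n \<in> borel_measurable M"
    unfolding h_def n_def by measurable
  have ae: "AE t in M. g t \<le> h t \<and> g t \<le> b t \<and> 0 \<le> n t \<and> 0 \<le> v t \<and> h t + e * n t + v t \<le> w t"
    using g_min Ff v0 le by eventually_elim (simp add: h_def n_def)
  have wg: "integrable M (\<lambda>t. w t - g t)" using w g by auto
  have en: "AE t in M. 0 \<le> e * n t"  using e by (intro AE_I2) (simp add: n_def)
  have "integrable M h" unfolding h_def
  proof (rule integrable_objective[where h=w])
    show "AE t in M. fst (F t) \<in> cball xb \<rho> \<and> \<phi> t (F t) < \<infinity> \<and> objective e 0 0 xb t (F t) \<le> w t"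
      using ae Ff en
    proof eventually_elim
      case (elim t)
      then show ?case using feasibleD[OF elim(2)] unfolding h_def by linarith
    qed
  qed (use e w in auto)
  then show h: "integrable M (\<lambda>t. objective e 0 0 xb t (F t))" unfolding h_def .
  have "integrable M (\<lambda>t. e * n t)"
  proof (rule Bochner_Integration.integrable_bound[OF wg])
    show "AE t in M. norm (e * n t) \<le> norm (w t - g t)" using ae en by eventually_elim auto
  qed auto
  then have n: "integrable M n" using e by simp
  then show "integrable M (\<lambda>t. norm (snd (F t) - yb t))" unfolding n_def .
  show vi: "integrable M v"
  proof (rule Bochner_Integration.integrable_bound[OF wg])
    show "AE t in M. norm (v t) \<le> norm (w t - g t)" using ae en by eventually_elim auto
  qed auto
  have gap: "(\<integral>t. w t - g t \<partial>M) \<le> 2 * \<kappa>" using w g g_int by simp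
  have "(\<integral>t. e * n t \<partial>M) \<le> (\<integral>t. w t - g t \<partial>M)"
    by (rule integral_mono_AE) (use n wg ae in auto)
  then show "e * (\<integral>t. norm (snd (F t) - yb t) \<partial>M) \<le> 2 * \<kappa>" using gap by (simp add: n_def)
  have "(\<integral>t. v t \<partial>M) \<le> (\<integral>t. w t - g t \<partial>M)"
  proof (rule integral_mono_AE[OF vi wg])
    show "AE t in M. v t \<le> w t - g t" using ae en by eventually_elim auto
  qed
  then show "(\<integral>t. v t \<partial>M) \<le> 2 * \<kappa>" using gap by simp
  have "(\<integral>t. \<bar>h t - b t\<bar> \<partial>M) \<le> (\<integral>t. (w t - g t) + (b t - g t) \<partial>M)"
  proof (rule integral_mono_AE)
    show "AE t in M. \<bar>h t - b t\<bar> \<le> (w t - g t) + (b t - g t)" using ae en by eventually_elim auto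
    show "integrable M (\<lambda>t. \<bar>h t - b t\<bar>)" using h b by (simp add: h_def)
    show "integrable M (\<lambda>t. (w t - g t) + (b t - g t))"
      by (intro Bochner_Integration.integrable_add Bochner_Integration.integrable_diff w b g)
  qed
  also have "\<dots> = (\<integral>t. w t - g t \<partial>M) + ((\<integral>t. b t \<partial>M) - (\<integral>t. g t \<partial>M))"
    by (simp only: Bochner_Integration.integral_add[OF wg Bochner_Integration.integrable_diff[OF b g]]
        Bochner_Integration.integral_diff[OF b g])
  also have "\<dots> \<le> 3 * \<kappa>" using gap g_int by simp
  finally show "(\<integral>t. \<bar>objective e 0 0 xb t (F t) - b t\<bar> \<partial>M) \<le> 3 * \<kappa>" by (simp add: h_def)
qed

text \<open>As \<open>k\<close> grows, the penalty forces \<open>u\<close> towards \<open>x\<close>, and \<open>p k x\<close> increases to the minimum of the unpenalized objective over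
\<open>w\<close> with \<open>u = x\<close> fixed. Boundedness of the integrals makes this limit finite almost everywhere and integrable.\<close>

lemma limit_problem:
  assumes x: "x \<in> cball xb \<eta>" and C: "\<And>k. (\<integral>t. p k x t \<partial>M) \<le> C"
  obtains y F where "y \<in> borel_measurable M" "integrable M F" "(\<integral>t. F t \<partial>M) \<le> C"
    "AE t in M. (x, y t) \<in> feasible S r xb \<eta> t \<and> F t = objective (2 * e) \<tau> 0 x t (x, y t)"
proof -
  have xr: "cball x 0 \<subseteq> cball xb \<rho>" using x \<eta> by auto
  have e2: "2 * e > 0" using e by simp
  obtain Y where Y: "minimizer S r x 0 (2 * e) \<tau> 0 x Y"
    using minimizer_exists[OF xr e2 order_refl S] by blast
  have [measurable]: "Y \<in> borel_measurable M" using Y by (simp add: minimizer_def)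
  define y where "y t = snd (Y t)" for t
  have [measurable]: "y \<in> borel_measurable M" unfolding y_def by measurable
  define F where "F t = objective (2 * e) \<tau> 0 x t (Y t)" for t
  have [measurable]: "F \<in> borel_measurable M" unfolding F_def by measurable
  have "AE t in M. \<exists>L. \<forall>k. p k x t + nh t \<le> L"
  proof (rule AE_bounded_if_integrals_bounded)
    show "integrable M (\<lambda>t. p k x t + nh t)" for k using p_integrable nh by auto
    show "AE t in M. incseq (\<lambda>k. p k x t + nh t)"
      using AE_good by eventually_elim (auto simp: incseq_def intro: p_mono)
    show "AE t in M. \<forall>k. 0 \<le> p k x t + nh t"
      using AE_good
    proof eventually_elim
      case (elim t)
      show ?case
      proof
        fix k show "0 \<le> p k x t + nh t" using p_lower(2)[OF elim, of k x] by simp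
      qed
    qed
    show "(\<integral>t. p k x t + nh t \<partial>M) \<le> C + (\<integral>t. nh t \<partial>M)" for k
      using C[of k] p_integrable nh by simp
  qed
  then have main: "AE t in M. (x, y t) \<in> feasible S r xb \<eta> t \<and> F t = objective (2 * e) \<tau> 0 x t (x, y t) \<and>
      incseq (\<lambda>k. p k x t) \<and> (\<lambda>k. p k x t) \<longlonglongrightarrow> F t"
    using AE_good
  proof eventually_elim
    case (elim t)
    have ts: "t \<in> space M" by (rule good_space[OF elim(2)])
    have inc: "incseq (\<lambda>k. p k x t)" using p_mono[OF elim(2)] by (simp add: incseq_def)
    obtain L0 where L0: "\<And>k. p k x t + nh t \<le> L0" using elim(1) by blast
    have "Bseq (\<lambda>k. p k x t)"
    proof (rule BseqI'[of _ "\<bar>L0\<bar> + nh t"])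
      fix k
      show "norm (p k x t) \<le> \<bar>L0\<bar> + nh t" using p_lower(2)[OF elim(2), of k x] L0[of k] nh_pos[OF ts] by auto
    qed
    then obtain L where L: "(\<lambda>k. p k x t) \<longlonglongrightarrow> L"
      using Bseq_mono_convergent[of "\<lambda>k. p k x t"] inc by (auto simp: convergent_def incseq_def)
    have pL: "p k x t \<le> L" for k by (rule incseq_le[OF inc L])
    have feas: "Z k x t \<in> feasible S r xb \<rho> t" for k
      by (rule feasible_rho[OF Z_good(1)[OF elim(2)]])
    have objective: "objective (2 * e) \<tau> 0 x t (Z k x t) \<le> L" for k
    proof -
      have "objective (2 * e) \<tau> 0 x t (Z k x t) \<le> p k x t"
        using penalty_nonneg[OF ts, of "real k" "fst (Z k x t) - x"] by (simp add: p_def objective_def)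
      then show ?thesis using pL[of k] by linarith
    qed
    have "(\<lambda>k. (norm (fst (Z k x t) - x))\<^sup>2) \<longlonglongrightarrow> 0"
    proof (rule tendsto_sandwich[OF _ _ tendsto_const])
      show "(\<lambda>k. ((L + nh t) / q t) * (1 / real k)) \<longlonglongrightarrow> 0"
        using tendsto_mult_left[OF lim_1_over_n, of "(L + nh t) / q t"] by simp
      show "eventually (\<lambda>k. (norm (fst (Z k x t) - x))\<^sup>2 \<le> ((L + nh t) / q t) * (1 / real k)) sequentially"
        using eventually_gt_at_top[of 0]
      proof eventually_elim
        case (elim k)
        have "real k * q t * (norm (fst (Z k x t) - x))\<^sup>2 \<le> L + nh t"
          using p_lower(1)[OF \<open>good t\<close>, of k x] pL[of k] by linarith
        then show ?case using elim q_pos[OF ts] by (simp add: field_simps)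
      qed
    qed auto
    from tendsto_real_sqrt[OF this] have "(\<lambda>k. norm (fst (Z k x t) - x)) \<longlonglongrightarrow> 0" by simp
    then have "(\<lambda>k. fst (Z k x t) - x) \<longlonglongrightarrow> 0" by (rule tendsto_norm_zero_cancel)
    then have "(\<lambda>k. fst (Z k x t)) \<longlonglongrightarrow> x" by (rule LIM_zero_cancel)
    from limit_point[OF ts e2 feas objective this]
    obtain w where w: "(x, w) \<in> feasible S r xb \<rho> t" "objective (2 * e) \<tau> 0 x t (x, w) \<le> L" .
    have w0: "(x, w) \<in> feasible S r x 0 t" using w(1) by (simp add: feasible_def)
    have Yt: "Y t \<in> feasible S r x 0 t" "F t \<le> L"
    proof -
      have "Y t \<in> feasible S r x 0 t \<and> objective (2 * e) \<tau> 0 x t (Y t) \<le> objective (2 * e) \<tau> 0 x t (x, w)"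
        using Y ts w0 unfolding minimizer_def by blast
      then show "Y t \<in> feasible S r x 0 t" "F t \<le> L" using w(2) by (auto simp: F_def)
    qed
    have Yx: "Y t = (x, y t)" using Yt(1) by (auto simp: feasible_def y_def prod_eq_iff)
    have feasY: "(x, y t) \<in> feasible S r xb \<eta> t" using Yt(1) x unfolding Yx by (simp add: feasible_def)
    have "p k x t \<le> F t" for k
      using p_least[OF ts feasY, of k x] by (simp add: F_def Yx objective_def)
    then have "L \<le> F t" by (intro LIMSEQ_le_const2[OF L]) auto
    with Yt(2) L feasY inc show ?case by (simp add: F_def Yx)
  qed
  have "incseq (\<lambda>k. \<integral>t. p k x t \<partial>M)"
    unfolding incseq_def
  proof (intro allI impI)
    fix k l :: nat assume kl: "k \<le> l"
    show "(\<integral>t. p k x t \<partial>M) \<le> (\<integral>t. p l x t \<partial>M)"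
    proof (rule integral_mono_AE[OF p_integrable p_integrable])
      show "AE t in M. p k x t \<le> p l x t" using AE_good by eventually_elim (rule p_mono[OF _ kl])
    qed
  qed
  then obtain I where I: "(\<lambda>k. \<integral>t. p k x t \<partial>M) \<longlonglongrightarrow> I"
    using incseq_convergent[of "\<lambda>k. \<integral>t. p k x t \<partial>M" C] C by blast
  have mono: "AE t in M. mono (\<lambda>k. p k x t)" using main by eventually_elim simp
  have lim: "AE t in M. (\<lambda>k. p k x t) \<longlonglongrightarrow> F t" using main by eventually_elim (elim conjE)
  have Fi: "integrable M F" "(\<integral>t. F t \<partial>M) = I"
    using integrable_monotone_convergence[OF p_integrable mono lim I]
      integral_monotone_convergence[OF p_integrable mono lim I] by auto
  have "I \<le> C" by (rule LIMSEQ_le_const2[OF I]) (use C in auto)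
  show thesis
    by (rule that[of y F]) (use Fi \<open>I \<le> C\<close> main in \<open>auto elim: eventually_mono\<close>)
qed

text \<open>An argument of Dini type: the sets of all \<open>x\<close> in the ball with \<open>norm (x - xb) \<ge> \<eta>'\<close> and \<open>P k x \<le> \<integral>b + \<kappa>0\<close> are compact and
decrease with \<open>k\<close>. By \<open>limit_problem\<close>, a common point \<open>x\<close> of them comes with a function \<open>y\<close> whose unpenalized value is at most
\<open>\<integral>b + \<kappa>0\<close>. This \<open>y\<close> is close to \<open>yb\<close> by \<open>near_optimal\<close>, and the local estimate gives \<open>e * norm (x - xb) \<le> \<kappa>0\<close>, which
is too small.\<close>

lemma minimizers_near:
  assumes d: "d > 0" and loc: "local_minorant M \<phi> xb yb b xs ys e d"
    and \<kappa>d: "2 * \<kappa> / e < d / 2" and \<eta>d: "\<eta> < d / 2" and xs\<eta>: "norm xs * \<eta> \<le> \<kappa> / 2"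
    and \<kappa>0: "\<kappa>0 \<le> \<kappa> / 2" "\<kappa>0 < e * \<eta>'"
  shows "\<exists>k0. \<forall>k\<ge>k0. \<forall>x\<in>cball xb \<eta>. P k x \<le> (\<integral>t. b t \<partial>M) + \<kappa>0 \<longrightarrow> norm (x - xb) < \<eta>'"
proof (rule ccontr)
  assume neg: "\<not> ?thesis"
  define V where "V k = {x\<in>cball xb \<eta>. \<eta>' \<le> norm (x - xb) \<and> P k x \<le> (\<integral>t. b t \<partial>M) + \<kappa>0}" for k
  have Vmono: "V l \<subseteq> V k" if "k \<le> l" for k l
    using P_mono[OF that] unfolding V_def by (blast intro: order_trans)
  have Vne: "V k \<noteq> {}" for k
  proof -
    obtain l x where "l \<ge> k" "x \<in> V l" using neg unfolding V_def by (force simp: not_less)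
    then show ?thesis using Vmono by blast
  qed
  have Vcpt: "compact (V k)" for k
  proof -
    have "closed {x \<in> cball xb \<eta>. P k x \<le> (\<integral>t. b t \<partial>M) + \<kappa>0}"
      by (intro continuous_on_closed_Collect_le P_continuous continuous_intros closed_cball)
    moreover have "closed {x. \<eta>' \<le> norm (x - xb)}"
      by (intro closed_Collect_le continuous_intros)
    moreover have "V k = {x \<in> cball xb \<eta>. P k x \<le> (\<integral>t. b t \<partial>M) + \<kappa>0} \<inter> {x. \<eta>' \<le> norm (x - xb)}"
      by (auto simp: V_def)
    moreover have "bounded (V k)"
      by (rule bounded_subset[OF bounded_cball[of xb \<eta>]]) (auto simp: V_def)
    ultimately show ?thesis by (simp add: compact_eq_bounded_closed closed_Int)
  qed
  have "\<Inter>(range V) \<noteq> {}" by (rule compact_nest[OF Vcpt Vne Vmono])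
  then obtain x where x: "\<And>k. x \<in> V k" by auto
  have xc: "x \<in> cball xb \<eta>" "\<eta>' \<le> norm (x - xb)" using x[of 0] by (auto simp: V_def)
  have nx: "norm (x - xb) \<le> \<eta>" using xc(1) by (simp add: dist_norm norm_minus_commute)
  define C where "C = (\<integral>t. b t \<partial>M) + \<kappa>0 + inner xs (x - xb) - 2 * e * norm (x - xb)"
  have C: "(\<integral>t. p k x t \<partial>M) \<le> C" for k using x[of k] by (simp add: V_def P_def C_def)
  have "inner xs (x - xb) \<le> \<kappa> / 2"
  proof -
    have "inner xs (x - xb) \<le> norm xs * norm (x - xb)" by (rule norm_cauchy_schwarz)
    also have "\<dots> \<le> norm xs * \<eta>" using nx by (intro mult_left_mono) auto
    finally show ?thesis using xs\<eta> by simp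
  qed
  moreover have "0 \<le> e * norm (x - xb)" using e by simp
  ultimately have C\<kappa>: "C \<le> (\<integral>t. b t \<partial>M) + \<kappa>" using \<kappa>0(1) by (simp add: C_def)
  obtain y F where y[measurable]: "y \<in> borel_measurable M" and F: "integrable M F" "(\<integral>t. F t \<partial>M) \<le> C"
    and yF: "AE t in M. (x, y t) \<in> feasible S r xb \<eta> t \<and> F t = objective (2 * e) \<tau> 0 x t (x, y t)"
    by (rule limit_problem[OF xc(1) C])
  have le: "AE t in M. objective e 0 0 xb t (x, y t) + e * norm (snd (x, y t) - yb t) + 0 \<le> F t"
    using yF
  proof eventually_elim
    case (elim t)
    then show ?case using objective_ge_linear[of t "(x, y t)" 0 x] by simp
  qed
  have feas: "AE t in M. (x, y t) \<in> feasible S r xb \<eta> t" using yF by eventually_elim simp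
  have FC: "(\<integral>t. F t \<partial>M) \<le> (\<integral>t. b t \<partial>M) + \<kappa>" using F(2) C\<kappa> by linarith
  have pairm: "(\<lambda>t. (x, y t)) \<in> borel_measurable M" by measurable
  have z0: "(\<lambda>_. 0 :: real) \<in> borel_measurable M" "AE t in M. 0 \<le> (0 :: real)" by auto
  note no = near_optimal[OF pairm feas F(1) FC z0 le]
  define h where "h t = objective e 0 0 xb t (x, y t)" for t
  have h: "integrable M h" unfolding h_def by (rule no(1))
  have n: "integrable M (\<lambda>t. norm (y t - yb t))" using no(2) by simp
  have yd: "integrable M (\<lambda>t. y t - yb t)"
    by (rule Bochner_Integration.integrable_bound[OF n]) auto
  then have yi: "integrable M y" using Bochner_Integration.integrable_add[OF yd yb] by simp
  have "e * (\<integral>t. norm (y t - yb t) \<partial>M) \<le> 2 * \<kappa>" using no(4) by simp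
  then have "(\<integral>t. norm (y t - yb t) \<partial>M) \<le> 2 * \<kappa> / e" using e by (simp add: pos_le_divide_eq mult.commute)
  then have small: "norm (x - xb) + (\<integral>t. norm (y t - yb t) \<partial>M) < d" using \<kappa>d \<eta>d nx by linarith
  define f where "f t = h t - e * norm (y t - yb t) + inner (ys t) (y t - yb t)" for t
  have fi: "integrable M f" unfolding f_def using h n integrable_inner_ys(1)[OF yd] by auto
  have "AE t in M. \<phi> t (x, y t) = ereal (f t)"
    using feas AE_space
  proof eventually_elim
    case (elim t)
    have "\<phi> t (x, y t) = ereal (real_of_ereal (\<phi> t (x, y t)))"
      by (rule phi_finite(1)[OF elim(2) feasibleD[OF elim(1)]])
    then show ?case by (simp add: f_def h_def objective_def)
  qed
  from loc[unfolded local_minorant_def, rule_format, OF yi fi this small]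
  have "(\<integral>t. b t \<partial>M) + inner xs (x - xb) + (\<integral>t. inner (ys t) (y t - yb t) \<partial>M)
        - e * (norm (x - xb) + (\<integral>t. norm (y t - yb t) \<partial>M)) \<le> (\<integral>t. f t \<partial>M)" .
  also have "(\<integral>t. f t \<partial>M) = (\<integral>t. h t \<partial>M) - e * (\<integral>t. norm (y t - yb t) \<partial>M) + (\<integral>t. inner (ys t) (y t - yb t) \<partial>M)"
    unfolding f_def using h n integrable_inner_ys(1)[OF yd] by simp
  finally have "(\<integral>t. b t \<partial>M) + inner xs (x - xb) - e * norm (x - xb) \<le> (\<integral>t. h t \<partial>M)"
    by (simp add: algebra_simps)
  also have "(\<integral>t. h t \<partial>M) \<le> (\<integral>t. F t \<partial>M)"
  proof (rule integral_mono_AE[OF h F(1)])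
    show "AE t in M. h t \<le> F t" using le
    proof eventually_elim
      case (elim t)
      moreover have "0 \<le> e * norm (y t - yb t)" using e by simp
      ultimately show ?case by (simp add: h_def)
    qed
  qed
  also have "\<dots> \<le> C" by (rule F(2))
  finally have "e * norm (x - xb) \<le> \<kappa>0" by (simp add: C_def)
  moreover have "e * \<eta>' \<le> e * norm (x - xb)" using xc(2) e by simp
  ultimately show False using \<kappa>0(2) by linarith
qed

text \<open>Let \<open>v\<close> be the defect \<open>(\<integral>t. X' t \<partial>M) - xs\<close>. If \<open>x\<close> moves to \<open>x - s *\<^sub>R v\<close> while the inner minimizers are kept, then \<open>P k\<close>
changes by at most \<open>- s * (norm v)\<^sup>2 + 2 * e * s * norm v\<close> plus a term of order \<open>s\<^sup>2\<close>. As \<open>x\<close> is a minimizer, letting \<open>s\<close> tend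
to \<open>0\<close> gives the bound for \<open>norm v\<close>.\<close>

lemma first_order:
  assumes x: "x \<in> cball xb \<eta>" "norm (x - xb) < \<eta>" and min: "\<And>x'. x' \<in> cball xb \<eta> \<Longrightarrow> P k x \<le> P k x'"
  defines "X' \<equiv> \<lambda>t. (2 * real k * q t) *\<^sub>R (x - fst (Z k x t))"
  shows "integrable M X'" and "norm ((\<integral>t. X' t \<partial>M) - xs) \<le> 2 * e"
proof -
  define u where "u t = fst (Z k x t)" for t
  have [measurable]: "u \<in> borel_measurable M" unfolding u_def by measurable
  have ub: "norm (x - u t) \<le> 2 * \<eta>" if "good t" for t
  proof -
    have "dist xb (u t) \<le> \<eta>" using Z_good(1)[OF that, of k x] by (simp add: u_def feasible_def)
    then show ?thesis using x norm_triangle_ineq[of "x - xb" "xb - u t"] by (simp add: dist_norm)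
  qed
  have iq: "integrable M (\<lambda>t. 2 * real k * q t * (2 * \<eta>))" using q_integrable by auto
  show iX: "integrable M X'"
  proof (rule Bochner_Integration.integrable_bound[OF iq])
    show "X' \<in> borel_measurable M" unfolding X'_def by measurable
    show "AE t in M. norm (X' t) \<le> norm (2 * real k * q t * (2 * \<eta>))"
      using AE_good
    proof eventually_elim
      case (elim t)
      have "norm (X' t) = 2 * real k * q t * norm (x - u t)"
        using q_pos[OF good_space[OF elim]] by (simp add: X'_def u_def)
      also have "\<dots> \<le> 2 * real k * q t * (2 * \<eta>)"
        using q_pos[OF good_space[OF elim]] ub[OF elim] by (intro mult_left_mono) auto
      finally show ?case by simp
    qed
  qed
  define v where "v = (\<integral>t. X' t \<partial>M) - xs"
  define Q where "Q = (\<integral>t. q t \<partial>M)"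
  have Q: "Q \<ge> 0" unfolding Q_def using q_pos by (intro integral_nonneg_AE AE_I2) (auto intro: less_imp_le)
  show "norm v \<le> 2 * e"
  proof (cases "v = 0")
    case True then show ?thesis using e by simp
  next
    case False
    then have nv: "norm v > 0" by simp
    define s0 where "s0 = (\<eta> - norm (x - xb)) / norm v"
    have s0: "s0 > 0" unfolding s0_def using x nv by simp
    have ineq: "norm v \<le> 2 * e + real k * Q * norm v * s" if s: "0 < s" "s \<le> s0" for s
    proof -
      define x' where "x' = x - s *\<^sub>R v"
      have "s * norm v \<le> \<eta> - norm (x - xb)" using s nv unfolding s0_def by (simp add: pos_le_divide_eq)
      then have x'c: "x' \<in> cball xb \<eta>"
        using norm_triangle_ineq[of "x - xb" "- (s *\<^sub>R v)"] s
        unfolding x'_def mem_cball dist_norm by (simp add: norm_minus_commute algebra_simps)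
      have pt: "p k x' t \<le> p k x t - s * inner (X' t) v + real k * q t * (s\<^sup>2 * (norm v)\<^sup>2)" if "good t" for t
      proof -
        have "p k x' t \<le> objective (2 * e) \<tau> (real k) x' t (Z k x t)"
          by (rule p_least[OF good_space[OF that] Z_good(1)[OF that]])
        also have "\<dots> = p k x t + real k * q t * ((norm (u t - x'))\<^sup>2 - (norm (u t - x))\<^sup>2)"
          by (simp add: objective_def p_def u_def algebra_simps)
        also have "(norm (u t - x'))\<^sup>2 - (norm (u t - x))\<^sup>2 = - 2 * s * inner (x - u t) v + s\<^sup>2 * (norm v)\<^sup>2"
          unfolding x'_def power2_norm_eq_inner
          by (simp add: inner_diff_left inner_diff_right inner_commute power2_eq_square algebra_simps)
        finally show ?thesis by (simp add: X'_def u_def algebra_simps)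
      qed
      have "(\<integral>t. p k x' t \<partial>M) \<le> (\<integral>t. p k x t - s * inner (X' t) v + real k * q t * (s\<^sup>2 * (norm v)\<^sup>2) \<partial>M)"
      proof (rule integral_mono_AE[OF p_integrable])
        show "integrable M (\<lambda>t. p k x t - s * inner (X' t) v + real k * q t * (s\<^sup>2 * (norm v)\<^sup>2))"
          using p_integrable q_integrable iX by auto
        show "AE t in M. p k x' t \<le> p k x t - s * inner (X' t) v + real k * q t * (s\<^sup>2 * (norm v)\<^sup>2)"
          using AE_good by eventually_elim (rule pt)
      qed
      also have "\<dots> = (\<integral>t. p k x t \<partial>M) - s * inner (v + xs) v + real k * Q * (s\<^sup>2 * (norm v)\<^sup>2)"
        using p_integrable q_integrable iX by (simp add: Q_def v_def)
      finally have 1: "(\<integral>t. p k x' t \<partial>M) \<le> (\<integral>t. p k x t \<partial>M) - s * inner (v + xs) v + real k * Q * (s\<^sup>2 * (norm v)\<^sup>2)" .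
      have "(\<integral>t. p k x t \<partial>M) - inner xs (x - xb) + 2 * e * norm (x - xb)
          \<le> (\<integral>t. p k x' t \<partial>M) - inner xs (x' - xb) + 2 * e * norm (x' - xb)"
        using min[OF x'c] by (simp add: P_def)
      moreover have "inner xs (x' - xb) = inner xs (x - xb) - s * inner xs v"
        by (simp add: x'_def inner_diff_right)
      moreover have "norm (x' - xb) \<le> norm (x - xb) + s * norm v"
        using norm_triangle_ineq[of "x - xb" "- (s *\<^sub>R v)"] s unfolding x'_def by (simp add: algebra_simps)
      then have "2 * e * norm (x' - xb) \<le> 2 * e * norm (x - xb) + 2 * e * (s * norm v)"
        using e by (simp add: distrib_left[symmetric])
      moreover have "s * inner (v + xs) v = s * (norm v)\<^sup>2 + s * inner xs v"
        by (simp add: inner_add_left power2_norm_eq_inner distrib_left)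
      ultimately have "s * (norm v)\<^sup>2 \<le> 2 * e * (s * norm v) + real k * Q * (s\<^sup>2 * (norm v)\<^sup>2)"
        using 1 by linarith
      then have "(s * norm v) * norm v \<le> (s * norm v) * (2 * e + real k * Q * norm v * s)"
        by (simp add: power2_eq_square algebra_simps)
      then show ?thesis using s nv by simp
    qed
    have "((\<lambda>s. 2 * e + real k * Q * norm v * s) \<longlongrightarrow> 2 * e + real k * Q * norm v * 0) (at_right 0)"
      by (intro tendsto_intros)
    then have "((\<lambda>s. 2 * e + real k * Q * norm v * s) \<longlongrightarrow> 2 * e) (at_right 0)" by simp
    moreover have "eventually (\<lambda>s. norm v \<le> 2 * e + real k * Q * norm v * s) (at_right 0)"
      unfolding eventually_at_right_field using ineq s0 by (intro exI[of _ s0]) auto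
    ultimately show ?thesis by (intro tendsto_lowerbound) auto
  qed
qed

text \<open>Where no constraint is active, \<open>Z k x t\<close> minimizes \<open>\<phi> t\<close> minus a smooth function locally; its gradient is the subgradient.\<close>

lemma pointwise_subgradient:
  assumes "good t" and X: "norm (fst (Z k x t) - xb) < \<eta>" and Y: "t \<in> S \<Longrightarrow> norm (snd (Z k x t) - yb t) < r"
  shows "((2 * real k * q t) *\<^sub>R (x - fst (Z k x t)),
      ys t - (2 * e / sqrt ((norm (snd (Z k x t) - yb t))\<^sup>2 + \<tau>\<^sup>2)) *\<^sub>R (snd (Z k x t) - yb t))
    \<in> regular_subdiff (\<phi> t) (Z k x t)"
proof -
  define z where "z = Z k x t"
  define R where "R u = inner (ys t) (snd u - yb t) - 2 * e * sqrt ((norm (snd u - yb t))\<^sup>2 + \<tau>\<^sup>2)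
      - real k * q t * (norm (fst u - x))\<^sup>2" for u
  have ts: "t \<in> space M" by (rule good_space[OF assms(1)])
  have zf: "z \<in> feasible S r xb \<eta> t" unfolding z_def by (rule Z_good(1)[OF assms(1)])
  have zfin: "\<phi> t z = ereal (real_of_ereal (\<phi> t z))"
    by (rule phi_finite(1)[OF ts feasibleD[OF zf]])
  define v1 v2 where "v1 = (2 * real k * q t) *\<^sub>R (x - fst z)"
    and "v2 = ys t - (2 * e / sqrt ((norm (snd z - yb t))\<^sup>2 + \<tau>\<^sup>2)) *\<^sub>R (snd z - yb t)"
  have pos: "inner (snd z - yb t) (snd z - yb t) + \<tau>\<^sup>2 > 0"
    using \<tau> by (intro add_nonneg_pos) auto
  have "(R has_derivative (\<lambda>h. inner (v1, v2) h)) (at z)"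
    unfolding R_def power2_norm_eq_inner
    apply (rule derivative_eq_intros refl | rule pos)+
    apply (rule ext)
    subgoal for h
      by (cases h) (simp add: v1_def v2_def power2_norm_eq_inner inner_diff_left inner_diff_right inner_commute algebra_simps divide_simps)
    done
  moreover have "eventually (\<lambda>z'. ereal (real_of_ereal (\<phi> t z) + (R z' - R z)) \<le> \<phi> t z') (nhds z)"
  proof -
    have "open {z'. norm (fst z' - xb) < \<eta> \<and> (t \<in> S \<longrightarrow> norm (snd z' - yb t) < r)}"
    proof -
      have "open {z'::'b \<times> 'c. norm (fst z' - xb) < \<eta>}" "open {z'::'b \<times> 'c. norm (snd z' - yb t) < r}"
        by (intro open_Collect_less continuous_intros)+
      then show ?thesis by (cases "t \<in> S") (auto intro: open_Collect_conj)
    qed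
    then have "eventually (\<lambda>z'. z' \<in> {z'. norm (fst z' - xb) < \<eta> \<and> (t \<in> S \<longrightarrow> norm (snd z' - yb t) < r)}) (nhds z)"
      using X Y unfolding z_def by (intro eventually_nhds_in_open) auto
    then show ?thesis
    proof eventually_elim
      case (elim z')
      show ?case
      proof (cases "\<phi> t z' = \<infinity>")
        case True then show ?thesis by simp
      next
        case False
        then have z'f: "z' \<in> feasible S r xb \<eta> t"
          using elim by (auto simp: feasible_def dist_norm norm_minus_commute less_top)
        have "objective (2 * e) \<tau> (real k) x t z \<le> objective (2 * e) \<tau> (real k) x t z'"
          using p_least[OF ts z'f, of k x] by (simp add: p_def z_def)
        then have "real_of_ereal (\<phi> t z) + (R z' - R z) \<le> real_of_ereal (\<phi> t z')"
          by (simp add: objective_def R_def)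
        then show ?thesis using phi_finite(1)[OF ts feasibleD[OF z'f]] by (metis ereal_less_eq(3))
      qed
    qed
  qed
  ultimately have "(v1, v2) \<in> regular_subdiff (\<phi> t) z"
    by (rule regular_subdiff_if_smooth_minorant[of "\<phi> t" z _ R, OF zfin])
  then show ?thesis by (simp add: v1_def v2_def z_def)
qed

end

section \<open>Approximation within a given tolerance\<close>

context integral_functional
begin

text \<open>The requirements on the approximating functions, with tolerance \<open>\<epsilon>\<close> in place of limits.\<close>

definition approximates ::
  "real \<Rightarrow> 'x \<Rightarrow> ('t \<Rightarrow> 'x) \<Rightarrow> ('t \<Rightarrow> 'x) \<Rightarrow> ('t \<Rightarrow> 'y) \<Rightarrow> ('t \<Rightarrow> 'y) \<Rightarrow> ('t \<Rightarrow> real) \<Rightarrow> bool" where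
  "approximates \<epsilon> x X X' Y Y' f \<longleftrightarrow>
    X \<in> borel_measurable M \<and> integrable M X' \<and> integrable M Y \<and> Y' \<in> borel_measurable M \<and>
    (AE t in M. (X' t, Y' t) \<in> regular_subdiff (\<phi> t) (X t, Y t)) \<and>
    norm (xb - x) \<le> \<epsilon> \<and> (AE t in M. norm (xb - X t) \<le> \<epsilon>) \<and> (\<integral>t. norm (yb t - Y t) \<partial>M) \<le> \<epsilon> \<and>
    (AE t in M. norm (ys t - Y' t) \<le> \<epsilon>) \<and> norm ((\<integral>t. X' t \<partial>M) - xs) \<le> \<epsilon> \<and>
    (\<integral>t. norm (X' t) * norm (X t - x) \<partial>M) \<le> \<epsilon> \<and>
    integrable M f \<and> (AE t in M. \<phi> t (X t, Y t) = ereal (f t)) \<and> (\<integral>t. \<bar>f t - b t\<bar> \<partial>M) \<le> \<epsilon>"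

text \<open>The constants are chosen in the order \<open>e\<close>, then \<open>S\<close>, \<open>r\<close>, \<open>c\<close> and \<open>d\<close>, then \<open>\<kappa>\<close>, \<open>\<eta>\<close>, \<open>\<kappa>0\<close>, \<open>\<tau>\<close> and finally \<open>k\<close>. Thus \<open>\<kappa>\<close> may be small
compared with \<open>e\<close>, with \<open>r * c\<close> and with \<open>d\<close>, and the smoothing error \<open>2 * e * \<tau>\<close> small compared with the growth \<open>e * \<eta>'\<close> over the
distance \<open>\<eta>'\<close>.\<close>

lemma approximation_step:
  assumes \<epsilon>: "\<epsilon> > 0"
  shows "\<exists>x X X' Y Y' f. approximates \<epsilon> x X X' Y Y' f"
proof -
  define e where "e = min (\<epsilon> / 2) 1"
  have e: "e > 0" "e \<le> 1" "2 * e \<le> \<epsilon>" using \<epsilon> by (auto simp: e_def)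
  obtain S r c where S[measurable]: "S \<in> sets M" and r: "r > 0" and c: "c > 0"
    and min: "AE t in M. \<forall>z\<in>feasible S r xb 0 t. b t \<le> objective e 0 0 xb t z"
    and small: "\<And>B. B \<in> sets M \<Longrightarrow> B \<subseteq> S \<Longrightarrow> measure M B < c \<Longrightarrow> B \<in> null_sets M"
    using exceptional_set[OF e(1)] by blast
  obtain d where d: "d > 0" and loc: "local_minorant M \<phi> xb yb b xs ys e d"
    using local_min[OF e(1)] by blast
  \<comment> \<open>The bound \<open>D\<close> for the \<open>L\<^sup>1\<close> distance of \<open>Y\<close> from \<open>yb\<close>: less than \<open>d / 2\<close> to use the local estimate, less than \<open>r * c\<close> to keep \<open>Y\<close> inside the balls on \<open>S\<close>, and small for the convergence of the values.\<close>
  define D where "D = Min {d / 5, r * c / 2, \<epsilon>, \<epsilon> / (2 * (\<bar>Cs\<bar> + 1))}"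
  have "D \<in> {d / 5, r * c / 2, \<epsilon>, \<epsilon> / (2 * (\<bar>Cs\<bar> + 1))}" unfolding D_def by (intro Min_in) auto
  moreover have "\<forall>y\<in>{d / 5, r * c / 2, \<epsilon>, \<epsilon> / (2 * (\<bar>Cs\<bar> + 1))}. y > 0"
    using d r c \<epsilon> by (simp add: add_nonneg_pos)
  ultimately have D: "D > 0" by (rule bspec[rotated])
  have D_le: "D \<le> d / 5" "D \<le> r * c / 2" "D \<le> \<epsilon>" "D \<le> \<epsilon> / (2 * (\<bar>Cs\<bar> + 1))"
    unfolding D_def by (intro Min_le; simp)+
  define \<kappa> where "\<kappa> = min (e * D / 2) (\<epsilon> / 6)"
  have \<kappa>: "\<kappa> > 0" "\<kappa> \<le> \<epsilon> / 6" using e D \<epsilon> by (auto simp: \<kappa>_def)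
  have "\<kappa> \<le> e * D / 2" by (simp add: \<kappa>_def)
  then have \<kappa>D: "2 * \<kappa> / e \<le> D" using e by (simp add: pos_divide_le_eq mult.commute)
  obtain \<eta>0 g where \<eta>0: "\<eta>0 > 0" "\<eta>0 \<le> \<rho>" and g: "integrable M g" "(\<integral>t. b t \<partial>M) - \<kappa> \<le> (\<integral>t. g t \<partial>M)"
    "AE t in M. g t \<le> b t \<and> (\<forall>z\<in>feasible S r xb \<eta>0 t. g t \<le> objective e 0 0 xb t z)"
    using minorant[OF e(1) r S min \<kappa>(1)] by blast
  define \<eta> where "\<eta> = Min {\<eta>0, d / 3, \<epsilon>, \<kappa> / (2 * (norm xs + 1))}"
  have nx1: "norm xs + 1 > 0" by (simp add: add_nonneg_pos)
  have "\<eta> \<in> {\<eta>0, d / 3, \<epsilon>, \<kappa> / (2 * (norm xs + 1))}" unfolding \<eta>_def by (intro Min_in) auto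
  moreover have "\<forall>y\<in>{\<eta>0, d / 3, \<epsilon>, \<kappa> / (2 * (norm xs + 1))}. y > 0"
    using \<eta>0 d \<epsilon> \<kappa> nx1 by simp
  ultimately have \<eta>: "\<eta> > 0" by (rule bspec[rotated])
  have \<eta>_le: "\<eta> \<le> \<eta>0" "\<eta> \<le> d / 3" "\<eta> \<le> \<epsilon>" "\<eta> \<le> \<kappa> / (2 * (norm xs + 1))"
    unfolding \<eta>_def by (intro Min_le; simp)+
  have xs\<eta>: "norm xs * \<eta> \<le> \<kappa> / 2"
  proof -
    have "norm xs * \<eta> \<le> (norm xs + 1) * \<eta>" using \<eta> by (intro mult_right_mono) auto
    also have "\<dots> \<le> \<kappa> / 2" using \<eta>_le(4) nx1 by (simp add: field_simps)
    finally show ?thesis .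
  qed
  have g_min: "AE t in M. g t \<le> b t \<and> (\<forall>z\<in>feasible S r xb \<eta> t. g t \<le> objective e 0 0 xb t z)"
    using g(3) by eventually_elim (use \<eta>_le(1) in \<open>auto simp: feasible_def\<close>)
  \<comment> \<open>The inner minimizer is within \<open>2 * \<eta>'\<close> of \<open>x\<close>, which is within \<open>\<eta>'\<close> of \<open>xb\<close>; a quarter of \<open>\<eta>\<close> thus keeps it in the interior.\<close>
  define \<eta>' where "\<eta>' = \<eta> / 4"
  define \<kappa>0 where "\<kappa>0 = min (\<kappa> / 2) (e * \<eta>' / 2)"
  have \<kappa>0: "\<kappa>0 > 0" "\<kappa>0 \<le> \<kappa> / 2" "\<kappa>0 < e * \<eta>'"
  proof -
    have "e * \<eta>' > 0" using e \<eta> by (simp add: \<eta>'_def)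
    then show "\<kappa>0 > 0" "\<kappa>0 \<le> \<kappa> / 2" "\<kappa>0 < e * \<eta>'" using \<kappa> unfolding \<kappa>0_def by linarith+
  qed
  define \<mu> where "\<mu> = measure M (space M)"
  have \<mu>: "\<mu> \<ge> 0" "\<mu> + 1 > 0" by (simp_all add: \<mu>_def add_nonneg_pos)
  define \<tau> where "\<tau> = min 1 (\<kappa>0 / (2 * e * (\<mu> + 1)))"
  have \<tau>: "\<tau> > 0" "\<tau> \<le> 1" using \<kappa>0 e \<mu> by (auto simp: \<tau>_def)
  have \<tau>\<kappa>: "2 * e * \<tau> * \<mu> \<le> \<kappa>0"
  proof -
    have "\<tau> \<le> \<kappa>0 / (2 * e * (\<mu> + 1))" by (simp add: \<tau>_def)
    moreover have "0 < 2 * e * (\<mu> + 1)" using e \<mu> by simp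
    ultimately have "\<tau> * (2 * e * (\<mu> + 1)) \<le> \<kappa>0" by (simp add: pos_le_divide_eq)
    moreover have "2 * e * \<tau> * \<mu> \<le> \<tau> * (2 * e * (\<mu> + 1))" using e \<tau> by (simp add: algebra_simps)
    ultimately show ?thesis by linarith
  qed
  have cb: "cball xb \<eta> \<subseteq> cball xb \<rho>" using \<eta>_le(1) \<eta>0(2) by auto
  have e2: "2 * e > 0" using e by simp
  have "\<forall>k x. \<exists>Z. minimizer S r xb \<eta> (2 * e) \<tau> (real k) x Z"
    using minimizer_exists[OF cb e2 of_nat_0_le_iff S] by blast
  then obtain Z where Z: "\<And>k x. minimizer S r xb \<eta> (2 * e) \<tau> (real k) x (Z k x)" by metis
  interpret pp: penalized_problem M \<phi> xb xs yb ys b nh \<rho> Cs S r e \<eta> \<kappa> \<tau> g Z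
    by unfold_locales (use e r S \<eta> \<eta>_le(1) \<eta>0 \<tau> g g_min Z in auto)
  have "2 * \<kappa> / e < d / 2" "\<eta> < d / 2" using \<kappa>D D_le(1) d \<eta>_le(2) by linarith+
  from pp.minimizers_near[OF d loc this xs\<eta> \<kappa>0(2,3)]
  obtain k0 where k0: "\<And>k x. k \<ge> k0 \<Longrightarrow> x \<in> cball xb \<eta> \<Longrightarrow> pp.P k x \<le> (\<integral>t. b t \<partial>M) + \<kappa>0 \<Longrightarrow> norm (x - xb) < \<eta>'"
    by blast
  obtain k1 :: nat where k1: "1 / \<eta>'\<^sup>2 \<le> real k1" using real_arch_simple by blast
  define k where "k = max k0 (max k1 1)"
  have \<eta>': "\<eta>' > 0" using \<eta> by (simp add: \<eta>'_def)
  have k: "k \<ge> k0" "k \<ge> 1" "1 \<le> real k * \<eta>'\<^sup>2"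
  proof -
    have "1 / \<eta>'\<^sup>2 \<le> real k" using k1 unfolding k_def by linarith
    then show "1 \<le> real k * \<eta>'\<^sup>2" using \<eta>' by (simp add: pos_divide_le_eq)
  qed (auto simp: k_def)
  have "cball xb \<eta> \<noteq> {}" using \<eta> by auto
  from continuous_attains_inf[OF compact_cball this pp.P_continuous[of k]]
  obtain x where x: "x \<in> cball xb \<eta>" and xmin: "\<And>x'. x' \<in> cball xb \<eta> \<Longrightarrow> pp.P k x \<le> pp.P k x'" by blast
  have Px: "pp.P k x \<le> (\<integral>t. b t \<partial>M) + \<kappa>0"
    using xmin[of xb] pp.P_base[of k] \<tau>\<kappa> \<eta> unfolding \<mu>_def by simp
  have x\<eta>': "norm (x - xb) < \<eta>'" by (rule k0[OF k(1) x Px])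
  define X where "X t = fst (Z k x t)" for t
  define Y where "Y t = snd (Z k x t)" for t
  have XY: "Z k x t = (X t, Y t)" for t by (simp add: X_def Y_def)
  have [measurable]: "X \<in> borel_measurable M" "Y \<in> borel_measurable M"
    unfolding X_def Y_def by measurable
  have feas: "AE t in M. Z k x t \<in> feasible S r xb \<eta> t"
    using AE_good by eventually_elim (rule pp.Z_good(1))
  define v where "v t = real k * q t * (norm (X t - x))\<^sup>2" for t
  have v: "v \<in> borel_measurable M" unfolding v_def by measurable
  have v0: "AE t in M. 0 \<le> v t"
    using AE_space by eventually_elim (simp add: v_def penalty_nonneg)
  have le: "AE t in M. objective e 0 0 xb t (Z k x t) + e * norm (snd (Z k x t) - yb t) + v t \<le> pp.p k x t"
    unfolding pp.p_def v_def X_def by (intro AE_I2 pp.objective_ge_linear)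
  have "inner xs (x - xb) \<le> \<kappa> / 2"
  proof -
    have "inner xs (x - xb) \<le> norm xs * norm (x - xb)" by (rule norm_cauchy_schwarz)
    also have "\<dots> \<le> norm xs * \<eta>" using x by (intro mult_left_mono) (auto simp: dist_norm norm_minus_commute)
    finally show ?thesis using xs\<eta> by simp
  qed
  moreover have "0 \<le> 2 * e * norm (x - xb)" using e by simp
  ultimately have pk: "(\<integral>t. pp.p k x t \<partial>M) \<le> (\<integral>t. b t \<partial>M) + \<kappa>" using Px \<kappa>0(2) by (simp add: pp.P_def)
  note no = pp.near_optimal[OF pp.Z_measurable feas pp.p_integrable pk v v0 le]
  have nY: "integrable M (\<lambda>t. norm (Y t - yb t))" using no(2) by (simp add: Y_def)
  have Yd: "integrable M (\<lambda>t. Y t - yb t)" by (rule Bochner_Integration.integrable_bound[OF nY]) auto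
  then have Yi: "integrable M Y" using Bochner_Integration.integrable_add[OF Yd yb] by simp
  have "e * (\<integral>t. norm (Y t - yb t) \<partial>M) \<le> 2 * \<kappa>" using no(4) by (simp add: Y_def)
  then have "(\<integral>t. norm (Y t - yb t) \<partial>M) \<le> 2 * \<kappa> / e" using e by (simp add: pos_le_divide_eq mult.commute)
  then have YD: "(\<integral>t. norm (Y t - yb t) \<partial>M) \<le> D" using \<kappa>D by linarith
  have X_near: "norm (X t - xb) < \<eta>" if t: "good t" for t
  proof -
    have ts: "t \<in> space M" by (rule good_space[OF t])
    have q: "q t > 0" by (rule q_pos[OF ts])
    have "v t - nh t \<le> b t + 2 * e * \<tau> + real k * q t * (norm (xb - x))\<^sup>2"
      using pp.p_lower(1)[OF t, of k x] pp.Z_good(2)[OF t, of k x] unfolding v_def X_def by linarith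
    moreover have "2 * e * \<tau> \<le> 2" using e \<tau> mult_mono[of e 1 \<tau> 1] by simp
    ultimately have "v t \<le> q t + real k * q t * (norm (xb - x))\<^sup>2" by (simp add: q_def)
    also have "\<dots> \<le> real k * q t * \<eta>'\<^sup>2 + real k * q t * \<eta>'\<^sup>2"
    proof (rule add_mono)
      show "q t \<le> real k * q t * \<eta>'\<^sup>2" using mult_left_mono[OF k(3), of "q t"] q by (simp add: mult_ac)
      have "(norm (xb - x))\<^sup>2 \<le> \<eta>'\<^sup>2" using x\<eta>' by (intro power_mono) (auto simp: norm_minus_commute)
      then show "real k * q t * (norm (xb - x))\<^sup>2 \<le> real k * q t * \<eta>'\<^sup>2"
        using q by (intro mult_left_mono) auto
    qed
    finally have "real k * q t * (norm (X t - x))\<^sup>2 \<le> real k * q t * (2 * \<eta>'\<^sup>2)" by (simp add: v_def)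
    then have "(norm (X t - x))\<^sup>2 \<le> 2 * \<eta>'\<^sup>2" using q k(2) by (simp add: mult_le_cancel_left)
    also have "\<dots> \<le> (2 * \<eta>')\<^sup>2" by (simp add: power_mult_distrib)
    finally have sq: "(norm (X t - x))\<^sup>2 \<le> (2 * \<eta>')\<^sup>2" .
    have "0 \<le> 2 * \<eta>'" using \<eta>' by simp
    from power2_le_imp_le[OF sq this] have "norm (X t - x) \<le> 2 * \<eta>'" .
    moreover have "norm (X t - xb) \<le> norm (X t - x) + norm (x - xb)"
      using norm_triangle_ineq[of "X t - x" "x - xb"] by simp
    moreover have "\<eta> = 4 * \<eta>'" by (simp add: \<eta>'_def)
    ultimately show ?thesis using x\<eta>' \<eta>' by linarith
  qed
  \<comment> \<open>By Markov's inequality, \<open>Y\<close> reaches the boundary of the balls on a subset of \<open>S\<close> of measure less than \<open>c\<close> only, hence on a null set.\<close>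
  define B where "B = {t\<in>S. r \<le> norm (Y t - yb t)}"
  have Bm[measurable]: "B \<in> sets M"
  proof -
    have "B = S \<inter> {t\<in>space M. r \<le> norm (Y t - yb t)}" using sets.sets_into_space[OF S] by (auto simp: B_def)
    then show ?thesis by simp
  qed
  have "r * measure M B = (\<integral>t. r * indicator B t \<partial>M)" by simp
  also have "\<dots> \<le> (\<integral>t. norm (Y t - yb t) \<partial>M)"
  proof (rule integral_mono[OF _ nY])
    show "integrable M (\<lambda>t. r * indicator B t)" by (intro integrable_mult_right) (simp add: emeasure_eq_measure)
    show "r * indicator B t \<le> norm (Y t - yb t)" for t by (auto simp: B_def indicator_def)
  qed
  also have "\<dots> < r * c" using YD D_le(2) D by linarith
  finally have "measure M B < c" using r by simp
  then have "B \<in> null_sets M" by (intro small) (auto simp: B_def)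
  then have Yin: "AE t in M. t \<in> S \<longrightarrow> norm (Y t - yb t) < r"
    using AE_not_in[of B M] by (auto simp: B_def not_le elim: eventually_mono)
  define X' where "X' t = (2 * real k * q t) *\<^sub>R (x - X t)" for t
  define Y' where "Y' t = ys t - (2 * e / sqrt ((norm (Y t - yb t))\<^sup>2 + \<tau>\<^sup>2)) *\<^sub>R (Y t - yb t)" for t
  have [measurable]: "Y' \<in> borel_measurable M" unfolding Y'_def by measurable
  have sub: "AE t in M. (X' t, Y' t) \<in> regular_subdiff (\<phi> t) (X t, Y t)"
    using AE_good Yin
  proof eventually_elim
    case (elim t)
    show ?case
      using pp.pointwise_subgradient[OF elim(1), of k x] X_near[OF elim(1)] elim(2)
      by (simp add: X'_def Y'_def X_def Y_def)
  qed
  have "\<eta>' < \<eta>" using \<eta> by (simp add: \<eta>'_def)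
  then have "norm (x - xb) < \<eta>" using x\<eta>' by linarith
  note fo = pp.first_order[OF x this xmin]
  have X'i: "integrable M X'" using fo(1) unfolding X'_def X_def .
  have X'x: "norm ((\<integral>t. X' t \<partial>M) - xs) \<le> \<epsilon>"
    using fo(2) e(3) unfolding X'_def X_def by linarith
  have "norm (X' t) * norm (X t - x) = 2 * v t" if "t \<in> space M" for t
    using q_pos[OF that] by (simp add: X'_def v_def norm_minus_commute power2_eq_square)
  then have "(\<integral>t. norm (X' t) * norm (X t - x) \<partial>M) = (\<integral>t. 2 * v t \<partial>M)"
    by (intro Bochner_Integration.integral_cong) auto
  also have "\<dots> = 2 * (\<integral>t. v t \<partial>M)" by simp
  also have "\<dots> \<le> \<epsilon>" using no(5) \<kappa>(2) \<epsilon> by linarith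
  finally have pen: "(\<integral>t. norm (X' t) * norm (X t - x) \<partial>M) \<le> \<epsilon>" .
  have Y'ys: "norm (ys t - Y' t) \<le> \<epsilon>" for t
  proof -
    define n where "n = norm (Y t - yb t)"
    define s where "s = sqrt (n\<^sup>2 + \<tau>\<^sup>2)"
    have "n \<le> s" unfolding s_def by (rule real_le_rsqrt) simp
    moreover have "s > 0" unfolding s_def using \<tau> by (simp add: add_nonneg_pos)
    ultimately have "n / s \<le> 1" by simp
    then have "2 * e * (n / s) \<le> 2 * e * 1" using e by (intro mult_left_mono) auto
    moreover have "norm (ys t - Y' t) = 2 * e * (n / s)"
      using e \<open>s > 0\<close> by (simp add: Y'_def n_def[symmetric] s_def[symmetric])
    ultimately show ?thesis using e(3) by linarith
  qed
  define h where "h t = objective e 0 0 xb t (Z k x t)" for t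
  have h: "integrable M h" unfolding h_def by (rule no(1))
  define f where "f t = h t - e * norm (Y t - yb t) + inner (ys t) (Y t - yb t)" for t
  have fi: "integrable M f" unfolding f_def using h nY integrable_inner_ys(1)[OF Yd] by auto
  have f_eq: "AE t in M. \<phi> t (X t, Y t) = ereal (f t)"
    using feas AE_space
  proof eventually_elim
    case (elim t)
    have "\<phi> t (Z k x t) = ereal (real_of_ereal (\<phi> t (Z k x t)))"
      by (rule phi_finite(1)[OF elim(2) pp.feasibleD[OF elim(1)]])
    then show ?case by (simp add: f_def h_def objective_def XY)
  qed
  have hb: "integrable M (\<lambda>t. \<bar>h t - b t\<bar>)" using h b by auto
  have yn: "integrable M (\<lambda>t. e * norm (Y t - yb t))" using nY by simp
  have yi: "integrable M (\<lambda>t. \<bar>inner (ys t) (Y t - yb t)\<bar>)"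
    using integrable_abs[OF integrable_inner_ys(1)[OF Yd]] .
  have "(\<integral>t. \<bar>f t - b t\<bar> \<partial>M) \<le> (\<integral>t. \<bar>h t - b t\<bar> + (e * norm (Y t - yb t) + \<bar>inner (ys t) (Y t - yb t)\<bar>) \<partial>M)"
  proof (rule integral_mono)
    show "integrable M (\<lambda>t. \<bar>f t - b t\<bar>)" using fi b by auto
    show "integrable M (\<lambda>t. \<bar>h t - b t\<bar> + (e * norm (Y t - yb t) + \<bar>inner (ys t) (Y t - yb t)\<bar>))"
      by (intro Bochner_Integration.integrable_add hb yn yi)
    show "\<bar>f t - b t\<bar> \<le> \<bar>h t - b t\<bar> + (e * norm (Y t - yb t) + \<bar>inner (ys t) (Y t - yb t)\<bar>)" for t
    proof -
      have "0 \<le> e * norm (Y t - yb t)" using e by simp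
      then show ?thesis unfolding f_def by linarith
    qed
  qed
  also have "\<dots> = (\<integral>t. \<bar>h t - b t\<bar> \<partial>M) + ((\<integral>t. e * norm (Y t - yb t) \<partial>M) + (\<integral>t. \<bar>inner (ys t) (Y t - yb t)\<bar> \<partial>M))"
    by (simp only: Bochner_Integration.integral_add[OF hb Bochner_Integration.integrable_add[OF yn yi]]
        Bochner_Integration.integral_add[OF yn yi])
  also have "\<dots> \<le> \<epsilon>"
  proof -
    have 1: "(\<integral>t. \<bar>h t - b t\<bar> \<partial>M) \<le> \<epsilon> / 2" using no(6) \<kappa>(2) unfolding h_def by linarith
    define N where "N = (\<integral>t. norm (Y t - yb t) \<partial>M)"
    have N: "0 \<le> N" unfolding N_def by (intro integral_nonneg_AE) auto
    have "(\<integral>t. e * norm (Y t - yb t) \<partial>M) = e * N" by (simp add: N_def)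
    also have "\<dots> \<le> 1 * N" using N e by (intro mult_right_mono) auto
    finally have 2: "(\<integral>t. e * norm (Y t - yb t) \<partial>M) \<le> N" by simp
    have "(\<integral>t. \<bar>inner (ys t) (Y t - yb t)\<bar> \<partial>M) \<le> Cs * N"
      unfolding N_def by (rule integrable_inner_ys(3)[OF Yd])
    also have "\<dots> \<le> \<bar>Cs\<bar> * N" using N by (intro mult_right_mono) auto
    finally have 3: "(\<integral>t. \<bar>inner (ys t) (Y t - yb t)\<bar> \<partial>M) \<le> \<bar>Cs\<bar> * N" .
    have "(\<bar>Cs\<bar> + 1) * N \<le> (\<bar>Cs\<bar> + 1) * D" using YD unfolding N_def by (intro mult_left_mono) auto
    also have "\<dots> \<le> \<epsilon> / 2"
    proof -
      have "D * (2 * (\<bar>Cs\<bar> + 1)) \<le> \<epsilon>" using D_le(4) by (subst (asm) pos_le_divide_eq) auto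
      then show ?thesis by (simp add: algebra_simps)
    qed
    finally have "\<bar>Cs\<bar> * N + N \<le> \<epsilon> / 2" by (simp add: algebra_simps)
    with 1 2 3 show ?thesis by linarith
  qed
  finally have fb: "(\<integral>t. \<bar>f t - b t\<bar> \<partial>M) \<le> \<epsilon>" .
  have X_ae: "AE t in M. norm (xb - X t) \<le> \<epsilon>"
    using AE_good
  proof eventually_elim
    case (elim t)
    show ?case using X_near[OF elim] \<eta>_le(3) by (simp add: norm_minus_commute)
  qed
  have "(\<integral>t. norm (yb t - Y t) \<partial>M) \<le> \<epsilon>" using YD D_le(3) by (simp add: norm_minus_commute)
  moreover have "norm (xb - x) \<le> \<epsilon>" using \<open>norm (x - xb) < \<eta>\<close> \<eta>_le(3) by (simp add: norm_minus_commute)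
  ultimately show ?thesis
    using X'i Yi sub X_ae Y'ys X'x pen fi f_eq fb
    unfolding approximates_def by (intro exI[of _ x] exI[of _ X] exI[of _ X'] exI[of _ Y] exI[of _ Y'] exI[of _ f] conjI) auto
qed

end

section \<open>Extended real-valued integrals and the function spaces\<close>

lemma ext_integral_eq_integral:
  fixes f :: "'t \<Rightarrow> real"
  assumes f: "integrable M f" and ae: "AE t in M. h t = ereal (f t)"
  shows "ext_integral M h = ereal (\<integral>t. f t \<partial>M)"
proof -
  have "(\<integral>\<^sup>+ t. e2ennreal (max (h t) 0) \<partial>M) = (\<integral>\<^sup>+ t. ennreal (max (f t) 0) \<partial>M)"
    by (intro nn_integral_cong_AE) (use ae in eventually_elim, auto simp: ennreal.rep_eq max_def e2ennreal_ereal zero_ereal_def)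
  also have "\<dots> = ennreal (\<integral>t. max (f t) 0 \<partial>M)"
    using f by (intro nn_integral_eq_integral) auto
  finally have 1: "(\<integral>\<^sup>+ t. e2ennreal (max (h t) 0) \<partial>M) = ennreal (\<integral>t. max (f t) 0 \<partial>M)" .
  have "(\<integral>\<^sup>+ t. e2ennreal (- min (h t) 0) \<partial>M) = (\<integral>\<^sup>+ t. ennreal (- min (f t) 0) \<partial>M)"
    by (intro nn_integral_cong_AE) (use ae in eventually_elim, auto simp: min_def e2ennreal_ereal zero_ereal_def)
  also have "\<dots> = ennreal (\<integral>t. - min (f t) 0 \<partial>M)"
    using f by (intro nn_integral_eq_integral) auto
  finally have 2: "(\<integral>\<^sup>+ t. e2ennreal (- min (h t) 0) \<partial>M) = ennreal (\<integral>t. - min (f t) 0 \<partial>M)" .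
  have 3: "0 \<le> (\<integral>t. max (f t) 0 \<partial>M)" "0 \<le> (\<integral>t. - min (f t) 0 \<partial>M)"
    by (intro integral_nonneg_AE; auto)+
  have "(\<integral>t. max (f t) 0 \<partial>M) - (\<integral>t. - min (f t) 0 \<partial>M) = (\<integral>t. max (f t) 0 - (- min (f t) 0) \<partial>M)"
    using f by (intro Bochner_Integration.integral_diff[symmetric]) auto
  also have "\<dots> = (\<integral>t. f t \<partial>M)" by (intro Bochner_Integration.integral_cong) (auto simp: max_def min_def)
  finally show ?thesis
    unfolding ext_integral_def 1 2 using 3 by (simp add: enn2ereal_ennreal)
qed

text \<open>The positive part has finite integral, since that of the negative part is bounded by that of \<open>n\<close>.\<close>

lemma ext_integral_finite:
  fixes h :: "'t \<Rightarrow> ereal"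
  assumes [measurable]: "h \<in> borel_measurable M" and n: "integrable M n" "\<And>t. t \<in> space M \<Longrightarrow> 0 \<le> n t"
    and low: "\<And>t. t \<in> space M \<Longrightarrow> - ereal (n t) \<le> h t" and fin: "ext_integral M h < \<infinity>"
  shows "AE t in M. h t = ereal (real_of_ereal (h t))" and "integrable M (\<lambda>t. real_of_ereal (h t))"
proof -
  have [measurable]: "n \<in> borel_measurable M" using n by auto
  have nfin: "(\<integral>\<^sup>+ t. ennreal (n t) \<partial>M) < \<infinity>"
    using n(1) n(2) by (subst nn_integral_eq_integral) auto
  have "(\<integral>\<^sup>+ t. e2ennreal (- min (h t) 0) \<partial>M) \<le> (\<integral>\<^sup>+ t. ennreal (n t) \<partial>M)"
  proof (rule nn_integral_mono)
    fix t assume t: "t \<in> space M"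
    have "- min (h t) 0 \<le> ereal (n t)" using low[OF t] n(2)[OF t]
      by (cases "h t") (auto simp: min_def zero_ereal_def)
    then show "e2ennreal (- min (h t) 0) \<le> ennreal (n t)"
      using e2ennreal_mono by (fastforce simp: e2ennreal_ereal)
  qed
  then have neg: "(\<integral>\<^sup>+ t. e2ennreal (- min (h t) 0) \<partial>M) < \<infinity>" using nfin by (rule le_less_trans)
  have pos: "(\<integral>\<^sup>+ t. e2ennreal (max (h t) 0) \<partial>M) < \<infinity>"
  proof (rule ccontr)
    assume "\<not> ?thesis"
    then have "(\<integral>\<^sup>+ t. e2ennreal (max (h t) 0) \<partial>M) = \<infinity>" by (simp add: less_top[symmetric])
    with fin show False by (simp add: ext_integral_def)
  qed
  have "AE t in M. e2ennreal (max (h t) 0) \<noteq> \<infinity>"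
    by (rule nn_integral_noteq_infinite) (use pos in auto)
  then show ae: "AE t in M. h t = ereal (real_of_ereal (h t))"
    using AE_space
  proof eventually_elim
    case (elim t)
    then show ?case using low[OF elim(2)] by (cases "h t") auto
  qed
  show "integrable M (\<lambda>t. real_of_ereal (h t))"
  proof (rule integrableI_bounded)
    have "(\<integral>\<^sup>+ t. ennreal (norm (real_of_ereal (h t))) \<partial>M) \<le> (\<integral>\<^sup>+ t. e2ennreal (max (h t) 0) + ennreal (n t) \<partial>M)"
    proof (rule nn_integral_mono_AE)
      show "AE t in M. ennreal (norm (real_of_ereal (h t))) \<le> e2ennreal (max (h t) 0) + ennreal (n t)"
        using ae AE_space
      proof eventually_elim
        case (elim t)
        then obtain a where a: "h t = ereal a" by blast
        have "- n t \<le> a" using low[OF elim(2)] by (simp add: a)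
        then have "\<bar>a\<bar> \<le> max a 0 + n t" using n(2)[OF elim(2)] by auto
        then have "ennreal \<bar>a\<bar> \<le> ennreal (max a 0 + n t)" by (rule ennreal_leI)
        also have "\<dots> = ennreal (max a 0) + ennreal (n t)" using n(2)[OF elim(2)] by (intro ennreal_plus) auto
        also have "ennreal (max a 0) = e2ennreal (max (h t) 0)" by (simp add: a max_def zero_ereal_def e2ennreal_ereal)
        finally show ?case by (simp add: a)
      qed
    qed
    also have "\<dots> = (\<integral>\<^sup>+ t. e2ennreal (max (h t) 0) \<partial>M) + (\<integral>\<^sup>+ t. ennreal (n t) \<partial>M)"
      by (rule nn_integral_add) auto
    also have "\<dots> < \<infinity>" using pos nfin by simp
    finally show "(\<integral>\<^sup>+ t. ennreal (norm (real_of_ereal (h t))) \<partial>M) < \<infinity>" .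
  qed auto
qed

lemma Linf_norm_le:
  assumes [measurable]: "f \<in> borel_measurable M" and "AE t in M. norm (f t) \<le> C"
  shows "Linf_norm M f \<le> ennreal C"
  unfolding Linf_norm_def
  by (rule esssup_I) (use assms in \<open>auto elim!: eventually_mono intro: ennreal_leI\<close>)

lemma LinfI:
  "f \<in> borel_measurable M \<Longrightarrow> AE t in M. norm (f t) \<le> C \<Longrightarrow> f \<in> Linf M"
  using Linf_norm_le[of f M C] by (auto simp: Linf_def intro: le_less_trans)

lemma LinfD:
  assumes "f \<in> Linf M"
  obtains C where "f \<in> borel_measurable M" "AE t in M. norm (f t) \<le> C"
proof -
  have fin: "Linf_norm M f < \<infinity>" and m: "f \<in> borel_measurable M" using assms by (auto simp: Linf_def)
  have "AE t in M. ennreal (norm (f t)) \<le> Linf_norm M f" unfolding Linf_norm_def by (rule esssup_AE)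
  then have "AE t in M. norm (f t) \<le> enn2real (Linf_norm M f)"
  proof eventually_elim
    case (elim t)
    have "Linf_norm M f = ennreal (enn2real (Linf_norm M f))" using fin by simp
    with elim show ?case by (metis enn2real_nonneg ennreal_le_iff)
  qed
  with m show thesis by (rule that)
qed

text \<open>Multiplying by the distance turns the bound on the difference quotient into \<open>local_minorant\<close>. Pairs at distance \<open>0\<close>, on which the quotient
says nothing, agree with the base point almost everywhere and satisfy the estimate with equality.\<close>

lemma regular_subdiff_E_local_min:
  fixes \<phi> :: "'t \<Rightarrow> 'x::euclidean_space \<times> 'y::euclidean_space \<Rightarrow> ereal"
  assumes sub: "(x', y') \<in> regular_subdiff_E M \<phi> x0 y0" and y0: "integrable M y0"
    and b: "integrable M b" "AE t in M. \<phi> t (x0, y0 t) = ereal (b t)" and e: "e > 0"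
  shows "\<exists>d>0. local_minorant M \<phi> x0 y0 b x' y' e d"
proof -
  define quot where "quot = (\<lambda>(x, y). (Efun M \<phi> x y - Efun M \<phi> x0 y0 - ereal (inner x' (x - x0))
          - ereal (\<integral>t. inner (y' t) (y t - y0 t) \<partial>M)) / ereal (dist_XL1 M x0 y0 x y))"
  have "0 \<le> Liminf (at_XL1 M x0 y0) quot"
    using sub by (simp add: regular_subdiff_E_def quot_def)
  moreover have "ereal (- e) < 0" using e by (simp add: zero_ereal_def)
  ultimately have "eventually (\<lambda>p. ereal (- e) < quot p) (at_XL1 M x0 y0)"
    by (simp add: le_Liminf_iff)
  then have "\<exists>\<epsilon>\<in>{0<..}. eventually (\<lambda>p. ereal (- e) < quot p)
      (principal {(x, y). integrable M y \<and> 0 < dist_XL1 M x0 y0 x y \<and> dist_XL1 M x0 y0 x y < \<epsilon>})"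
    unfolding at_XL1_def
  proof (subst (asm) eventually_INF_base)
    fix a c :: real assume "a \<in> {0<..}" "c \<in> {0<..}"
    then show "\<exists>x\<in>{0<..}. principal {(xa, y). integrable M y \<and> 0 < dist_XL1 M x0 y0 xa y \<and> dist_XL1 M x0 y0 xa y < x}
        \<le> inf (principal {(x, y). integrable M y \<and> 0 < dist_XL1 M x0 y0 x y \<and> dist_XL1 M x0 y0 x y < a})
           (principal {(x, y). integrable M y \<and> 0 < dist_XL1 M x0 y0 x y \<and> dist_XL1 M x0 y0 x y < c})"
      by (intro bexI[of _ "min a c"]) auto
  qed (auto intro: exI[of _ 1])
  then obtain d where d: "d > 0" "\<And>x y. integrable M y \<Longrightarrow> 0 < dist_XL1 M x0 y0 x y \<Longrightarrow>
      dist_XL1 M x0 y0 x y < d \<Longrightarrow> ereal (- e) < quot (x, y)"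
    by (auto simp: eventually_principal)
  show ?thesis
    unfolding local_minorant_def
  proof (intro exI[of _ d] conjI allI impI)
    fix x y f
    assume y: "integrable M y" and f: "integrable M f" and fe: "AE t in M. \<phi> t (x, y t) = ereal (f t)"
      and near: "norm (x - x0) + (\<integral>t. norm (y t - y0 t) \<partial>M) < d"
    define D where "D = norm (x - x0) + (\<integral>t. norm (y t - y0 t) \<partial>M)"
    have Dd: "dist_XL1 M x0 y0 x y = D" by (simp add: dist_XL1_def L1_norm_def D_def)
    have I0: "0 \<le> (\<integral>t. norm (y t - y0 t) \<partial>M)" by (intro integral_nonneg_AE) auto
    then have D0: "0 \<le> D" by (simp add: D_def)
    have Ef: "Efun M \<phi> x y = ereal (\<integral>t. f t \<partial>M)" "Efun M \<phi> x0 y0 = ereal (\<integral>t. b t \<partial>M)"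
      unfolding Efun_def by (rule ext_integral_eq_integral[OF f fe], rule ext_integral_eq_integral[OF b])
    show "(\<integral>t. b t \<partial>M) + inner x' (x - x0) + (\<integral>t. inner (y' t) (y t - y0 t) \<partial>M)
        - e * (norm (x - x0) + (\<integral>t. norm (y t - y0 t) \<partial>M)) \<le> (\<integral>t. f t \<partial>M)"
    proof (cases "D = 0")
      case True
      then have xx: "x = x0" and "(\<integral>t. norm (y t - y0 t) \<partial>M) = 0"
        using I0 norm_ge_zero[of "x - x0"] unfolding D_def by (simp_all add: add_nonneg_eq_0_iff)
      then have yy: "AE t in M. y t = y0 t"
        using integral_nonneg_eq_0_iff_AE[of M "\<lambda>t. norm (y t - y0 t)"] y y0 by auto
      have "AE t in M. f t = b t" using yy fe b(2) by eventually_elim (simp add: xx)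
      then have 1: "(\<integral>t. f t \<partial>M) = (\<integral>t. b t \<partial>M)"
        using f b by (intro integral_cong_AE) auto
      have 2: "(\<integral>t. inner (y' t) (y t - y0 t) \<partial>M) = 0"
        by (rule integral_eq_zero_AE) (use yy in \<open>auto elim!: eventually_mono\<close>)
      show ?thesis using 1 2 True unfolding D_def[symmetric] by (simp add: xx)
    next
      case False
      then have Dpos: "D > 0" using D0 by simp
      have "ereal (- e) < quot (x, y)"
        by (rule d(2)[OF y]) (use Dpos near in \<open>simp_all add: Dd D_def[symmetric]\<close>)
      then have "- e < ((\<integral>t. f t \<partial>M) - (\<integral>t. b t \<partial>M) - inner x' (x - x0)
          - (\<integral>t. inner (y' t) (y t - y0 t) \<partial>M)) / D"
        using Dpos by (simp add: quot_def Ef Dd)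
      then have "- e * D < (\<integral>t. f t \<partial>M) - (\<integral>t. b t \<partial>M) - inner x' (x - x0)
          - (\<integral>t. inner (y' t) (y t - y0 t) \<partial>M)"
        using Dpos by (simp only: pos_less_divide_eq)
      then show ?thesis unfolding D_def[symmetric] by simp
    qed
  qed (rule d(1))
qed

section \<open>The approximating sequences\<close>

lemma ennreal_tendsto_zeroI:
  fixes f :: "nat \<Rightarrow> ennreal"
  assumes "\<And>k. f k \<le> ennreal (1 / real (Suc k))"
  shows "f \<longlonglongrightarrow> 0"
proof (rule tendsto_sandwich[OF _ _ tendsto_const])
  have "(\<lambda>k. ennreal (1 / real (Suc k))) \<longlonglongrightarrow> ennreal 0"
    using LIMSEQ_inverse_real_of_nat by (intro tendsto_ennrealI) (simp add: inverse_eq_divide)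
  then show "(\<lambda>k. ennreal (1 / real (Suc k))) \<longlonglongrightarrow> 0" by simp
qed (use assms in auto)

lemma real_tendsto_zeroI:
  fixes f :: "nat \<Rightarrow> real"
  assumes "\<And>k. 0 \<le> f k" "\<And>k. f k \<le> 1 / real (Suc k)"
  shows "f \<longlonglongrightarrow> 0"
proof (rule tendsto_sandwich[OF _ _ tendsto_const])
  show "(\<lambda>k. 1 / real (Suc k)) \<longlonglongrightarrow> 0" using LIMSEQ_inverse_real_of_nat by (simp add: inverse_eq_divide)
qed (use assms in auto)

context integral_functional
begin

theorem approximating_sequences:
  "\<exists>(x :: nat \<Rightarrow> 'x) X X' Y Y'.
    (\<forall>k. X k \<in> Linf M \<and> integrable M (X' k) \<and> integrable M (Y k) \<and> Y' k \<in> Linf M) \<and>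
    (AE t in M. \<forall>k. (X' k t, Y' k t) \<in> regular_subdiff (\<phi> t) (X k t, Y k t)) \<and>
    (\<lambda>k. norm (xb - x k)) \<longlonglongrightarrow> 0 \<and>
    (\<lambda>k. Linf_norm M (\<lambda>t. xb - X k t)) \<longlonglongrightarrow> 0 \<and>
    (\<lambda>k. L1_norm M (\<lambda>t. yb t - Y k t)) \<longlonglongrightarrow> 0 \<and>
    (\<lambda>k. Linf_norm M (\<lambda>t. ys t - Y' k t)) \<longlonglongrightarrow> 0 \<and>
    (\<lambda>k. norm ((\<integral>t. X' k t \<partial>M) - xs)) \<longlonglongrightarrow> 0 \<and>
    (\<lambda>k. \<integral>t. norm (X' k t) * norm (X k t - x k) \<partial>M) \<longlonglongrightarrow> 0 \<and>
    (\<lambda>k. ext_integral M (\<lambda>t. \<bar>\<phi> t (X k t, Y k t) - \<phi> t (xb, yb t)\<bar>)) \<longlonglongrightarrow> 0"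
proof -
  define \<epsilon> where "\<epsilon> k = 1 / real (Suc k)" for k
  have \<epsilon>: "\<epsilon> k > 0" for k by (simp add: \<epsilon>_def)
  from approximation_step[OF \<epsilon>]
  have "\<forall>k. \<exists>x X X' Y Y' f. approximates (\<epsilon> k) x X X' Y Y' f" by blast
  then obtain x X X' Y Y' f where "\<And>k. approximates (\<epsilon> k) (x k) (X k) (X' k) (Y k) (Y' k) (f k)"
    by metis
  then have q: "X k \<in> borel_measurable M" "integrable M (X' k)" "integrable M (Y k)" "Y' k \<in> borel_measurable M"
    "AE t in M. (X' k t, Y' k t) \<in> regular_subdiff (\<phi> t) (X k t, Y k t)"
    "norm (xb - x k) \<le> \<epsilon> k" "AE t in M. norm (xb - X k t) \<le> \<epsilon> k" "(\<integral>t. norm (yb t - Y k t) \<partial>M) \<le> \<epsilon> k"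
    "AE t in M. norm (ys t - Y' k t) \<le> \<epsilon> k" "norm ((\<integral>t. X' k t \<partial>M) - xs) \<le> \<epsilon> k"
    "(\<integral>t. norm (X' k t) * norm (X k t - x k) \<partial>M) \<le> \<epsilon> k"
    "integrable M (f k)" "AE t in M. \<phi> t (X k t, Y k t) = ereal (f k t)" "(\<integral>t. \<bar>f k t - b t\<bar> \<partial>M) \<le> \<epsilon> k" for k
    unfolding approximates_def by blast+
  note [measurable] = q(1,4)
  have XL: "X k \<in> Linf M" for k
  proof (rule LinfI[OF q(1)])
    show "AE t in M. norm (X k t) \<le> norm xb + \<epsilon> k"
      using q(7)[of k]
    proof eventually_elim
      case (elim t)
      then show ?case using norm_triangle_ineq3[of xb "X k t"] by linarith
    qed
  qed
  have YL: "Y' k \<in> Linf M" for k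
  proof (rule LinfI[OF q(4)])
    show "AE t in M. norm (Y' k t) \<le> Cs + \<epsilon> k"
      using q(9)[of k] ys_bound
    proof eventually_elim
      case (elim t)
      then show ?case using norm_triangle_ineq3[of "ys t" "Y' k t"] by linarith
    qed
  qed
  have ext: "ext_integral M (\<lambda>t. \<bar>\<phi> t (X k t, Y k t) - \<phi> t (xb, yb t)\<bar>) = ereal (\<integral>t. \<bar>f k t - b t\<bar> \<partial>M)" for k
  proof (rule ext_integral_eq_integral)
    show "integrable M (\<lambda>t. \<bar>f k t - b t\<bar>)" using q(12)[of k] b by auto
    show "AE t in M. \<bar>\<phi> t (X k t, Y k t) - \<phi> t (xb, yb t)\<bar> = ereal \<bar>f k t - b t\<bar>"
      using q(13)[of k] b_eq by eventually_elim simp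
  qed
  have "(\<lambda>k. \<integral>t. \<bar>f k t - b t\<bar> \<partial>M) \<longlonglongrightarrow> 0"
    by (rule real_tendsto_zeroI) (use q(14) in \<open>auto simp: \<epsilon>_def\<close>)
  then have c7: "(\<lambda>k. ext_integral M (\<lambda>t. \<bar>\<phi> t (X k t, Y k t) - \<phi> t (xb, yb t)\<bar>)) \<longlonglongrightarrow> 0"
    unfolding ext zero_ereal_def by (rule tendsto_ereal)
  have c1: "(\<lambda>k. norm (xb - x k)) \<longlonglongrightarrow> 0"
    by (rule real_tendsto_zeroI) (use q(6) in \<open>auto simp: \<epsilon>_def\<close>)
  have c2: "(\<lambda>k. Linf_norm M (\<lambda>t. xb - X k t)) \<longlonglongrightarrow> 0"
    by (intro ennreal_tendsto_zeroI Linf_norm_le) (use q(7) in \<open>auto simp: \<epsilon>_def\<close>)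
  have c3: "(\<lambda>k. L1_norm M (\<lambda>t. yb t - Y k t)) \<longlonglongrightarrow> 0"
    unfolding L1_norm_def by (rule real_tendsto_zeroI) (use q(8) in \<open>auto simp: \<epsilon>_def\<close>)
  have c4: "(\<lambda>k. Linf_norm M (\<lambda>t. ys t - Y' k t)) \<longlonglongrightarrow> 0"
    by (intro ennreal_tendsto_zeroI Linf_norm_le) (use q(9) in \<open>auto simp: \<epsilon>_def\<close>)
  have c5: "(\<lambda>k. norm ((\<integral>t. X' k t \<partial>M) - xs)) \<longlonglongrightarrow> 0"
    by (rule real_tendsto_zeroI) (use q(10) in \<open>auto simp: \<epsilon>_def\<close>)
  have c6: "(\<lambda>k. \<integral>t. norm (X' k t) * norm (X k t - x k) \<partial>M) \<longlonglongrightarrow> 0"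
    by (rule real_tendsto_zeroI) (use q(11) in \<open>auto simp: \<epsilon>_def\<close>)
  have c0: "AE t in M. \<forall>k. (X' k t, Y' k t) \<in> regular_subdiff (\<phi> t) (X k t, Y k t)"
    unfolding AE_all_countable using q(5) by blast
  show ?thesis
    using XL YL q(2,3) c0 c1 c2 c3 c4 c5 c6 c7
    by (intro exI[of _ x] exI[of _ X] exI[of _ X'] exI[of _ Y] exI[of _ Y'] conjI allI)
qed

end

theorem theorem5p5:
  fixes M :: "'t measure" and Tpa Tna :: "'t set"
    and \<phi> :: "'t \<Rightarrow> (real ^ 'n) \<times> (real ^ 'm) \<Rightarrow> ereal"
    and \<nu> \<nu>h :: "'t \<Rightarrow> real" and \<rho> \<rho>h :: real
    and xbar xbar' :: "real ^ 'n" and ybar ybar' :: "'t \<Rightarrow> real ^ 'm"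
  assumes "finite_measure M" and "complete_measure M"
    and "atomic_decomposition M Tpa Tna"
    and "normal_integrand M \<phi>"
    and "integrable M \<nu>" and "\<And>t. t \<in> space M \<Longrightarrow> 0 \<le> \<nu> t"
    and "\<And>t v w. t \<in> space M \<Longrightarrow> \<phi> t (v, w) \<ge> - ereal (\<nu> t)"
    and "(xbar, ybar) \<in> domE M \<phi>"
    and "\<rho> > 0"
    and "\<And>t v. t \<in> Tna \<Longrightarrow> v \<in> cball xbar \<rho> \<Longrightarrow> convex_ereal (\<lambda>w. \<phi> t (v, w))"
    and "(xbar', ybar') \<in> regular_subdiff_E M \<phi> xbar ybar"
    and "\<rho>h > 0"
    and "integrable M \<nu>h" and "\<And>t. t \<in> space M \<Longrightarrow> 0 < \<nu>h t"
    and "\<And>t u w. t \<in> space M \<Longrightarrow> u \<in> cball xbar \<rho>h \<Longrightarrow>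
           \<phi> t (u, w) - ereal (inner (ybar' t) (w - ybar t)) \<ge> - ereal (\<nu>h t)"
  shows "\<exists>(x :: nat \<Rightarrow> real ^ 'n) (X :: nat \<Rightarrow> 't \<Rightarrow> real ^ 'n) (X' :: nat \<Rightarrow> 't \<Rightarrow> real ^ 'n)
            (Y :: nat \<Rightarrow> 't \<Rightarrow> real ^ 'm) (Y' :: nat \<Rightarrow> 't \<Rightarrow> real ^ 'm).
    (\<forall>k. X k \<in> Linf M \<and> integrable M (X' k) \<and> integrable M (Y k) \<and> Y' k \<in> Linf M) \<and>
    (AE t in M. \<forall>k. (X' k t, Y' k t) \<in> regular_subdiff (\<phi> t) (X k t, Y k t)) \<and>
    (\<lambda>k. norm (xbar - x k)) \<longlonglongrightarrow> 0 \<and>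
    (\<lambda>k. Linf_norm M (\<lambda>t. xbar - X k t)) \<longlonglongrightarrow> 0 \<and>
    (\<lambda>k. L1_norm M (\<lambda>t. ybar t - Y k t)) \<longlonglongrightarrow> 0 \<and>
    (\<lambda>k. Linf_norm M (\<lambda>t. ybar' t - Y' k t)) \<longlonglongrightarrow> 0 \<and>
    (\<lambda>k. norm ((\<integral>t. X' k t \<partial>M) - xbar')) \<longlonglongrightarrow> 0 \<and>
    (\<lambda>k. \<integral>t. norm (X' k t) * norm (X k t - x k) \<partial>M) \<longlonglongrightarrow> 0 \<and>
    (\<lambda>k. ext_integral M (\<lambda>t. \<bar>\<phi> t (X k t, Y k t) - \<phi> t (xbar, ybar t)\<bar>)) \<longlonglongrightarrow> 0"
proof -
  have yb: "integrable M ybar" and fin: "ext_integral M (\<lambda>t. \<phi> t (xbar, ybar t)) < \<infinity>"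
    using assms(8) by (auto simp: domE_def Efun_def)
  have [measurable]: "ybar \<in> borel_measurable M" using yb by auto
  obtain C where C: "ybar' \<in> borel_measurable M" "AE t in M. norm (ybar' t) \<le> C"
    using assms(11) by (auto simp: regular_subdiff_E_def elim: LinfD)
  have pm: "(\<lambda>(t, z). \<phi> t z) \<in> borel_measurable (M \<Otimes>\<^sub>M borel)"
    using assms(4) by (simp add: normal_integrand_def)
  have "(\<lambda>t. (t, xbar, ybar t)) \<in> M \<rightarrow>\<^sub>M M \<Otimes>\<^sub>M borel" by measurable
  from measurable_compose[OF this pm] have hm: "(\<lambda>t. \<phi> t (xbar, ybar t)) \<in> borel_measurable M" by simp
  define b where "b t = real_of_ereal (\<phi> t (xbar, ybar t))" for t
  have b: "AE t in M. \<phi> t (xbar, ybar t) = ereal (b t)" "integrable M b"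
    using ext_integral_finite[OF hm assms(5,6) assms(7) fin] unfolding b_def[abs_def] by simp_all
  have low: "ereal (inner (ybar' t) (w - ybar t) - \<nu>h t) \<le> \<phi> t (u, w)"
    if "t \<in> space M" "u \<in> cball xbar \<rho>h" for t u w
    using assms(15)[OF that, of w] by (cases "\<phi> t (u, w)") auto
  interpret integral_functional M \<phi> xbar xbar' ybar ybar' b \<nu>h \<rho>h C
    by (rule integral_functional.intro)
      (fact assms(1) assms(2) assms(4) yb C b assms(12) assms(13) | erule assms(14) | rule low, assumption+ |
        erule regular_subdiff_E_local_min[OF assms(11) yb b(2,1)])+
  show ?thesis by (rule approximating_sequences)
qed

end
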